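(* Let $\mathcal{O}=\{t_1,\dots,t_\mu\}$ be an order ideal in $\mathbb{T}^n$, and let $\mathcal{H}$ be an $(n,\mu)$-admissible Hilbert function which dominates $\mathrm{HF}^a_{\mathcal{O}}$. Let $\mathcal{P}$ be a property of 0-dimensional subschemes of affine $n$-space. Suppose that for every order ideal $\mathcal{O}'$ with $\mathrm{HF}^a_{\mathcal{O}'}=\mathcal{H}$ we are given an ideal $J_{\mathcal{O}'}$ in $K[C']$ (where $C'$ is the set of coordinates of $\mathbb{B}_{\mathcal{O}'}$) such that $\mathbb{B}^{\mathrm{df}}_{\mathcal{O}'}\setminus\mathcal{Z}(J_{\mathcal{O}'})$ contains exactly the $K$-rational points which represent schemes having a degree filtered $\mathcal{O}'$-border basis and property $\mathcal{P}$. Let $\{\mathcal{O}'_1,\dots,\mathcal{O}'_\ell\}$ be the set of all order ideals with affine Hilbert function $\mathcal{H}$. For $i=1,\dots,\ell$ carry out the following construction. (1) Write $\mathcal{O}'_i=\{t'_1,\dots,t'_\mu\}$, let $\partial\mathcal{O}'_i=\{b'_1,b'_2,\dots\}$, let $C'_i=\{c'_{\kappa\lambda}\}$ be the coordinates of $\mathbb{B}_{\mathcal{O}'_i}$, and let $J_{\mathcal{O}'_i}=\langle a_{i1},\dots,a_{ir_i}\rangle\subseteq K[C'_i]$. (2) Let $T'\in\mathrm{Mat}_\mu(K[C])$ be the matrix whose $\kappa$-th column is the first column of $t'_\kappa(\mathcal{A}_1,\dots,\mathcal{A}_n)$, where $\mathcal{A}_1,\dots,\mathcal{A}_n$ are the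 generic multiplication matrices for $\mathcal{O}$, and let $\delta_i=\det(T')$. (3) For $\kappa=1,\dots,\mu$ and $\lambda=1,\dots,\#\partial\mathcal{O}'_i$ let $p_{\kappa\lambda}\in K[C]$ be the $\kappa$-th entry of $\mathrm{adj}(T')\cdot B'_\lambda$, where $B'_\lambda$ is the first column of $b'_\lambda(\mathcal{A}_1,\dots,\mathcal{A}_n)$. (4) For $j=1,\dots,r_i$ let $a^\ast_{ij}\in K[C'_i][z]$ be the homogenization of $a_{ij}$ with respect to a new indeterminate $z$, let $\hat a_{ij}\in K[C]$ be the result of substituting $c'_{\kappa\lambda}\mapsto p_{\kappa\lambda}$ and $z\mapsto\delta_i$ in $a^\ast_{ij}$, and let $J_i=\langle\hat a_{i1},\dots,\hat a_{ir_i}\rangle$. (5) Let $I^{\mathrm{dfb}}_{\mathcal{O}\mathcal{O}'_i}=I(Z_{\mathcal{O}}(\overline{\mathcal{H}}))\cap\langle\delta_i\rangle$. Then for the ideal $$J=\sum_{i=1}^\ell\Bigl(\bigl(I^{\mathrm{dfb}}_{\mathcal{O}\mathcal{O}'_i}+I(\mathbb{B}_{\mathcal{O}}(\overline{\mathcal{H}}))\bigr)\cap\bigl(J_i+I(\mathbb{B}_{\mathcal{O}}(\overline{\mathcal{H}}))\bigr)\Bigr)$$ of $K[C]$, the set $\mathbb{B}_{\mathcal{O}}(\overline{\mathcal{H}})\setminus\mathcal{Z}(J)$ contains precisely the $K$-rational points of $\mathbb{B}_{\mathcal{O}}(\mathcal{H})$ which represent schemes having property $\mathcal{P}$.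
   Context: $K$ is an arbitrary field, $P=K[x_1,\dots,x_n]$, and $\mathbb{T}^n$ is the monoid of terms (power products) in $x_1,\dots,x_n$. An order ideal is a finite set $\mathcal{O}=\{t_1,\dots,t_\mu\}\subset\mathbb{T}^n$ with $\mu\ge 1$ containing every divisor in $\mathbb{T}^n$ of each of its elements; it is always ordered so that $\deg(t_1)\le\cdots\le\deg(t_\mu)$, hence $t_1=1$. Its border is $\partial\mathcal{O}=(x_1\mathcal{O}\cup\cdots\cup x_n\mathcal{O})\setminus\mathcal{O}=\{b_1,\dots,b_\nu\}$, and its affine Hilbert function is $\mathrm{HF}^a_{\mathcal{O}}(i)=\#\{j\mid\deg(t_j)\le i\}$. Let $C=\{c_{ij}\mid 1\le i\le\mu,\ 1\le j\le\nu\}$ be new indeterminates (the coordinates of $\mathbb{B}_{\mathcal{O}}$). The $r$-th generic multiplication matrix $\mathcal{A}_r=(a^{(r)}_{ij})\in\mathrm{Mat}_\mu(K[C])$ has $a^{(r)}_{ij}=\delta_{im}$ (Kronecker delta) if $x_rt_j=t_m$ and $a^{(r)}_{ij}=c_{im}$ if $x_rt_j=b_m$. $I(\mathbb{B}_{\mathcal{O}})\subseteq K[C]$ is generated by the entries of all commutators $\mathcal{A}_r\mathcal{A}_s-\mathcal{A}_s\mathcal{A}_r$, and the border basis scheme $\mathbb{B}_{\mathcal{O}}\subseteq\mathrm{Spec}(K[C])$ is the closed subscheme it defines. For a $K$-rational point $\Gamma=(\gamma_{ij})$ of $\mathbb{B}_{\mathcal{O}}$, let $I_\Gamma\subset P$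 be generated by $b_j-\sum_i\gamma_{ij}t_i$; $\Gamma$ represents the 0-dimensional scheme $\mathbb{X}_\Gamma\subset\mathbb{A}^n_K$ with vanishing ideal $I_\Gamma$, and $R_\Gamma=P/I_\Gamma$. $\mathbb{B}^{\mathrm{df}}_{\mathcal{O}}$ is the closed subscheme of $\mathbb{B}_{\mathcal{O}}$ defined by $I(\mathbb{B}_{\mathcal{O}})$ together with all $c_{ij}$ such that $\deg(t_i)>\deg(b_j)$. All of this applies likewise to other order ideals $\mathcal{O}'$, with coordinates denoted $C'=\{c'_{\kappa\lambda}\}$. For a 0-dimensional $\mathbb{X}\subset\mathbb{A}^n_K$ with $R_{\mathbb{X}}=P/I_{\mathbb{X}}$, let $F_iR_{\mathbb{X}}$ be the image of the polynomials of degree $\le i$; $\mathrm{HF}^a_{\mathbb{X}}(i)=\mathrm{HF}^a_{R_{\mathbb{X}}}(i)=\dim_K F_iR_{\mathbb{X}}$. $\mathbb{X}$ has a degree filtered $\mathcal{O}'$-border basis if for every $i\ge 0$ the residue classes of the elements of $\mathcal{O}'$ of degree $\le i$ form a $K$-basis of $F_iR_{\mathbb{X}}$. For a term $t=x_1^{\alpha_1}\cdots x_n^{\alpha_n}$, $t(\mathcal{A}_1,\dots,\mathcal{A}_n)=\mathcal{A}_1^{\alpha_1}\cdots\mathcal{A}_n^{\alpha_n}$; $\mathrm{adj}$ is the adjugate matrix. A sequence $(H_i)$ dominates $(H'_i)$ if $H_i\ge H'_i$ for all $i\ge 0$ (strictly, if they moreover differ); $\mathcal{H}=(H_0,H_1,\dots)$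 is $(n,\mu)$-admissible if $\mathcal{H}=\mathrm{HF}^a_{\mathbb{X}}$ for some 0-dimensional $\mathbb{X}\subset\mathbb{A}^n_K$ of length $\mu$. $\mathbb{B}_{\mathcal{O}}(\overline{\mathcal{H}})$ is the closed subscheme of $\mathbb{B}_{\mathcal{O}}$ which is the closure of the set of $K$-rational points $\Gamma$ with $\mathrm{HF}^a_{R_\Gamma}$ dominated by $\mathcal{H}$; $\mathbb{B}_{\mathcal{O}}(\mathcal{H})$ is the complement in it of the closure of the set of those $\Gamma$ with $\mathrm{HF}^a_{R_\Gamma}$ strictly dominated by $\mathcal{H}$ (so its $K$-rational points are the $\Gamma$ with $\mathrm{HF}^a_{R_\Gamma}=\mathcal{H}$). Ideals: for a sequence $\mathcal{G}=(G_0,G_1,\dots)$ dominating $\mathrm{HF}^a_{\mathcal{O}}$ with $\sigma=\min\{i\mid G_i=\mu\}$, $I(\mathbb{B}_{\mathcal{O}}(\overline{\mathcal{G}}))=I(\mathbb{B}_{\mathcal{O}})+\sum_{i=1}^{\sigma-1}D_i$, where $D_i$ is generated by the minors of size $G_i+1$ of the matrix whose columns are the first columns of $u(\mathcal{A}_1,\dots,\mathcal{A}_n)$, $u$ ranging over the terms of degree $\le i$ (minors of size exceeding the matrix contribute the zero ideal). With $\rho=\min\{i\mid H_i=\mu\}$ and $\mathcal{H}'_i$ obtained from $\mathcal{H}$ by replacing $H_i$ with $H_i-1$, $I(Z_{\mathcal{O}}(\overline{\mathcal{H}}))=\bigcap I(\mathbb{B}_{\mathcal{O}}(\overline{\mathcal{H}'_i}))$,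 where the intersection is over $i\in\{1,\dots,\rho\}$ with $H_i-1\ge\mathrm{HF}^a_{\mathcal{O}}(i)$ (empty intersection $=\langle 1\rangle$). $\mathcal{Z}(\cdot)$ denotes the zero locus. Conventions: $K$-rational points are to be read as $L$-rational points over field extensions $L\supseteq K$, e.g. $L=\overline{K}$ (in particular closures are formed using $\overline{K}$-rational points); subschemes and their defining ideals are considered up to radical. *)

theory Defs
  imports
    "HOL-Library.Poly_Mapping"
    "HOL-Algebra.Embedded_Algebras"
    "HOL-Algebra.QuotRing"
    "HOL-Algebra.Algebraic_Closure_Type"
    "Jordan_Normal_Form.Determinant"
    "Jordan_Normal_Form.DL_Submatrix"
begin

section \<open>Terms and multivariate polynomials\<close>

text \<open>
  A term is its exponent vector, so the product of terms is addition of exponent vectors.  The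
  polynomial ring in a set of indeterminates \<open>V\<close> is the subring, with carrier
  those polynomials that involve only indeterminates from \<open>V\<close>, of the ring of all
  polynomials over the type of indeterminates.
\<close>

type_synonym 'v pp = "'v \<Rightarrow>\<^sub>0 nat"
type_synonym ('v, 'a) mpol = "'v pp \<Rightarrow>\<^sub>0 'a"

definition tdeg :: "'v pp \<Rightarrow> nat" where
  "tdeg t = (\<Sum>v\<in>Poly_Mapping.keys t. Poly_Mapping.lookup t v)"

definition mvar :: "'v \<Rightarrow> ('v, 'a::comm_ring_1) mpol" where
  "mvar v = Poly_Mapping.single (Poly_Mapping.single v 1) 1"

definition mconst :: "'a::comm_ring_1 \<Rightarrow> ('v, 'a) mpol" where
  "mconst c = Poly_Mapping.single 0 c"

definition mterm :: "'v pp \<Rightarrow> ('v, 'a::comm_ring_1) mpol" where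
  "mterm t = Poly_Mapping.single t 1"

definition indets :: "('v, 'a::comm_ring_1) mpol \<Rightarrow> 'v set" where
  "indets p = (\<Union>t\<in>Poly_Mapping.keys p. Poly_Mapping.keys t)"

definition mdeg :: "('v, 'a::comm_ring_1) mpol \<Rightarrow> nat" where
  "mdeg p = Max (insert 0 (tdeg ` Poly_Mapping.keys p))"

definition polyring :: "'v set \<Rightarrow> ('v, 'a::comm_ring_1) mpol ring" where
  "polyring V = \<lparr> carrier = {p. indets p \<subseteq> V}, monoid.mult = (*), one = 1,
     ring.zero = 0, add = (+) \<rparr>"

definition meval :: "('a::comm_ring_1 \<Rightarrow> 'b::comm_ring_1) \<Rightarrow> ('v \<Rightarrow> 'b) \<Rightarrow> ('v, 'a) mpol \<Rightarrow> 'b" where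
  "meval \<phi> x p = (\<Sum>t\<in>Poly_Mapping.keys p. \<phi> (Poly_Mapping.lookup p t) * (\<Prod>v\<in>Poly_Mapping.keys t. x v ^ Poly_Mapping.lookup t v))"

text \<open>Homogenization; the new indeterminate is \<open>None\<close>.\<close>

definition homogenize :: "('v, 'a::comm_ring_1) mpol \<Rightarrow> ('v option, 'a) mpol" where
  "homogenize p = (\<Sum>t\<in>Poly_Mapping.keys p.
     Poly_Mapping.single
       ((\<Sum>v\<in>Poly_Mapping.keys t. Poly_Mapping.single (Some v) (Poly_Mapping.lookup t v))
         + Poly_Mapping.single None (mdeg p - tdeg t))
       (Poly_Mapping.lookup p t))"

text \<open>The sum of a family of ideals is the ideal generated by its union.\<close>

definition ideal_sum :: "('c, 'd) ring_scheme \<Rightarrow> 'c set set \<Rightarrow> 'c set" where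
  "ideal_sum R \<I> = Idl\<^bsub>R\<^esub> (\<Union>\<I>)"


section \<open>Order ideals and borders\<close>

text \<open>The indeterminates \<open>x\<^sub>1, \<dots>, x\<^sub>n\<close> are numbered \<open>0, \<dots>, n - 1\<close>.\<close>

abbreviation PX :: "nat \<Rightarrow> (nat, 'a::comm_ring_1) mpol ring" where
  "PX n \<equiv> polyring {..<n}"

definition terms_in :: "nat \<Rightarrow> nat pp set" where
  "terms_in n = {t. Poly_Mapping.keys t \<subseteq> {..<n}}"

definition order_ideal :: "nat \<Rightarrow> nat pp set \<Rightarrow> bool" where
  "order_ideal n T \<longleftrightarrow> finite T \<and> T \<noteq> {} \<and> T \<subseteq> terms_in n \<and>
     (\<forall>s\<in>terms_in n. \<forall>u\<in>terms_in n. s + u \<in> T \<longrightarrow> s \<in> T)"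

definition border :: "nat \<Rightarrow> nat pp set \<Rightarrow> nat pp set" where
  "border n T = (\<Union>r<n. (\<lambda>t. Poly_Mapping.single r 1 + t) ` T) - T"

definition ord_HF :: "nat pp set \<Rightarrow> nat \<Rightarrow> nat" where
  "ord_HF T i = card {t \<in> T. tdeg t \<le> i}"

text \<open>
  \<open>ts T = [t\<^sub>1, \<dots>, t\<^sub>\<mu>]\<close> and \<open>bs T = [b\<^sub>1, \<dots>, b\<^sub>\<nu>]\<close> number the
  elements of each order ideal and of its border.  Lists are indexed from 0; so are matrices and
  the coordinates \<open>c\<^sub>i\<^sub>j\<close> below.
\<close>

definition numbering ::
    "nat \<Rightarrow> (nat pp set \<Rightarrow> nat pp list) \<Rightarrow> (nat pp set \<Rightarrow> nat pp list) \<Rightarrow> bool" where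
  "numbering n ts bs \<longleftrightarrow> (\<forall>T. order_ideal n T \<longrightarrow>
     distinct (ts T) \<and> set (ts T) = T \<and> sorted (map tdeg (ts T)) \<and>
     distinct (bs T) \<and> set (bs T) = border n T)"


section \<open>Zero-dimensional schemes and their affine Hilbert functions\<close>

text \<open>
  A 0-dimensional subscheme of affine \<open>n\<close>-space over a field is given by its
  vanishing ideal \<open>I\<close> in \<open>PX n\<close>.  Its coordinate ring is
  \<open>PX n Quot I\<close>, and \<open>scalars n I\<close> is the copy of the base field in it.
\<close>

definition residue :: "nat \<Rightarrow> (nat, 'a::field) mpol set \<Rightarrow> (nat, 'a) mpol \<Rightarrow> (nat, 'a) mpol set" where
  "residue n I p = I +>\<^bsub>PX n\<^esub> p"

definition scalars :: "nat \<Rightarrow> (nat, 'a::field) mpol set \<Rightarrow> (nat, 'a) mpol set set" where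
  "scalars n I = range (\<lambda>c. residue n I (mconst c))"

definition filt :: "nat \<Rightarrow> (nat, 'a::field) mpol set \<Rightarrow> nat \<Rightarrow> (nat, 'a) mpol set set" where
  "filt n I i = residue n I ` {p \<in> carrier (PX n). mdeg p \<le> i}"

definition aff_HF :: "nat \<Rightarrow> (nat, 'a::field) mpol set \<Rightarrow> nat \<Rightarrow> nat" where
  "aff_HF n I i = ring.dim (PX n Quot I) (scalars n I) (filt n I i)"

definition admissible :: "'a::field itself \<Rightarrow> nat \<Rightarrow> nat \<Rightarrow> (nat \<Rightarrow> nat) \<Rightarrow> bool" where
  "admissible _ n \<mu> H \<longleftrightarrow> (\<exists>I :: (nat, 'a) mpol set. ideal I (PX n) \<and>
     ring.dimension (PX n Quot I) \<mu> (scalars n I) (carrier (PX n Quot I)) \<and> H = aff_HF n I)"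

text \<open>\<open>independent\<close> also requires the listed residue classes to be distinct.\<close>

definition has_df_border_basis :: "nat \<Rightarrow> nat pp list \<Rightarrow> (nat, 'a::field) mpol set \<Rightarrow> bool" where
  "has_df_border_basis n ts I \<longleftrightarrow> (\<forall>i.
     let us = map (\<lambda>t. residue n I (mterm t)) (filter (\<lambda>t. tdeg t \<le> i) ts)
     in ring.independent (PX n Quot I) (scalars n I) us \<and>
        ring.Span (PX n Quot I) (scalars n I) us = filt n I i)"


section \<open>Border basis schemes\<close>

text \<open>
  From here on \<open>ts = [t\<^sub>1, \<dots>, t\<^sub>\<mu>]\<close> lists an order ideal and
  \<open>bs = [b\<^sub>1, \<dots>, b\<^sub>\<nu>]\<close> its border.  The coordinate
  \<open>c\<^sub>i\<^sub>j\<close> is the indeterminate \<open>(i, j)\<close>.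
\<close>

type_synonym 'a cpol = "(nat \<times> nat, 'a) mpol"

abbreviation KC :: "nat pp list \<Rightarrow> nat pp list \<Rightarrow> 'a::comm_ring_1 cpol ring" where
  "KC ts bs \<equiv> polyring ({..<length ts} \<times> {..<length bs})"

definition gen_mult_mat :: "nat pp list \<Rightarrow> nat pp list \<Rightarrow> nat \<Rightarrow> 'a::field cpol mat" where
  "gen_mult_mat ts bs r = mat (length ts) (length ts) (\<lambda>(i, j).
     let u = Poly_Mapping.single r 1 + ts ! j in
     if u \<in> set ts then (if ts ! i = u then 1 else 0)
     else mvar (i, THE m. m < length bs \<and> bs ! m = u))"

definition border_ideal :: "nat \<Rightarrow> nat pp list \<Rightarrow> nat pp list \<Rightarrow> 'a::field cpol set" where
  "border_ideal n ts bs = Idl\<^bsub>KC ts bs\<^esub>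
     (\<Union>r<n. \<Union>s<n. elements_mat
        (gen_mult_mat ts bs r * gen_mult_mat ts bs s - gen_mult_mat ts bs s * gen_mult_mat ts bs r))"

text \<open>
  The points with coordinates in an extension field \<open>L\<close> of the base field, embedded by
  \<open>\<iota>\<close>, of the closed subscheme of \<open>Spec (K[C])\<close> defined by \<open>I\<close>.
\<close>

definition zeros ::
    "('k::field \<Rightarrow> 'l::field) \<Rightarrow> nat pp list \<Rightarrow> nat pp list \<Rightarrow> 'k cpol set \<Rightarrow> 'l mat set" where
  "zeros \<iota> ts bs I = {\<Gamma> \<in> carrier_mat (length ts) (length bs).
     \<forall>f\<in>I. meval \<iota> (\<lambda>v. \<Gamma> $$ v) f = 0}"

definition scheme_ideal ::
    "nat \<Rightarrow> nat pp list \<Rightarrow> nat pp list \<Rightarrow> 'l::field mat \<Rightarrow> (nat, 'l) mpol set" where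
  "scheme_ideal n ts bs \<Gamma> = Idl\<^bsub>PX n\<^esub>
     {mterm (bs ! j) - (\<Sum>i<length ts. mconst (\<Gamma> $$ (i, j)) * mterm (ts ! i)) | j. j < length bs}"

definition df_ideal :: "nat \<Rightarrow> nat pp list \<Rightarrow> nat pp list \<Rightarrow> 'a::field cpol set" where
  "df_ideal n ts bs = border_ideal n ts bs <+>\<^bsub>KC ts bs\<^esub> Idl\<^bsub>KC ts bs\<^esub>
     {mvar (i, j) | i j. i < length ts \<and> j < length bs \<and> tdeg (ts ! i) > tdeg (bs ! j)}"


section \<open>Hilbert function strata\<close>

text \<open>
  Closures are formed over the base field \<open>K\<close> from points with coordinates in the algebraic
  closure of \<open>K\<close>.
\<close>

definition vanishing_ideal ::
    "nat pp list \<Rightarrow> nat pp list \<Rightarrow> 'k::field alg_closure mat set \<Rightarrow> 'k cpol set" where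
  "vanishing_ideal ts bs S =
     {f \<in> carrier (KC ts bs). \<forall>\<gamma>\<in>S. meval to_ac (\<lambda>v. \<gamma> $$ v) f = 0}"

text \<open>
  Domination of Hilbert functions is the pointwise order on \<open>nat \<Rightarrow> nat\<close>; strict
  domination is the associated strict order.
\<close>

definition closed_stratum :: "('k::field \<Rightarrow> 'l::field) \<Rightarrow> nat \<Rightarrow> nat pp list \<Rightarrow> nat pp list \<Rightarrow>
    (nat \<Rightarrow> nat) \<Rightarrow> 'l mat set" where
  "closed_stratum \<iota> n ts bs H = zeros \<iota> ts bs (vanishing_ideal ts bs
     {\<gamma> \<in> zeros to_ac ts bs (border_ideal n ts bs). aff_HF n (scheme_ideal n ts bs \<gamma>) \<le> H})"

definition stratum :: "('k::field \<Rightarrow> 'l::field) \<Rightarrow> nat \<Rightarrow> nat pp list \<Rightarrow> nat pp list \<Rightarrow>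
    (nat \<Rightarrow> nat) \<Rightarrow> 'l mat set" where
  "stratum \<iota> n ts bs H = closed_stratum \<iota> n ts bs H - zeros \<iota> ts bs (vanishing_ideal ts bs
     {\<gamma> \<in> zeros to_ac ts bs (border_ideal n ts bs). aff_HF n (scheme_ideal n ts bs \<gamma>) < H})"

text \<open>\<open>t(A\<^sub>1, \<dots>, A\<^sub>n)\<close>, the factors being multiplied in the order of the indices.\<close>

definition term_mat :: "nat \<Rightarrow> nat pp list \<Rightarrow> nat pp list \<Rightarrow> nat pp \<Rightarrow> 'a::field cpol mat" where
  "term_mat n ts bs t =
     foldr (\<lambda>r M. (gen_mult_mat ts bs r ^\<^sub>m Poly_Mapping.lookup t r) * M) [0..<n] (1\<^sub>m (length ts))"

definition first_col :: "nat \<Rightarrow> nat pp list \<Rightarrow> nat pp list \<Rightarrow> nat pp \<Rightarrow> 'a::field cpol vec" where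
  "first_col n ts bs t = col (term_mat n ts bs t) 0"

definition minors :: "nat \<Rightarrow> 'a::comm_ring_1 mat \<Rightarrow> 'a set" where
  "minors k A = {det (submatrix A I J) | I J.
     I \<subseteq> {..<dim_row A} \<and> J \<subseteq> {..<dim_col A} \<and> card I = k \<and> card J = k}"

text \<open>
  The order of the columns, here the one on the type of exponent vectors, affects the minors only
  up to sign.
\<close>

definition minor_ideal :: "nat \<Rightarrow> nat pp list \<Rightarrow> nat pp list \<Rightarrow> (nat \<Rightarrow> nat) \<Rightarrow> nat \<Rightarrow>
    'a::field cpol set" where
  "minor_ideal n ts bs G i = Idl\<^bsub>KC ts bs\<^esub> minors (G i + 1)
     (mat_of_cols (length ts) (map (first_col n ts bs)
        (sorted_list_of_set {u \<in> terms_in n. tdeg u \<le> i})))"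

text \<open>
  Defining ideals of \<open>closed_stratum\<close>, and of the union of the closed strata of the
  Hilbert functions strictly dominated by \<open>H\<close>; both only up to radical.
\<close>

definition closed_stratum_ideal :: "nat \<Rightarrow> nat pp list \<Rightarrow> nat pp list \<Rightarrow> (nat \<Rightarrow> nat) \<Rightarrow>
    'a::field cpol set" where
  "closed_stratum_ideal n ts bs G = border_ideal n ts bs <+>\<^bsub>KC ts bs\<^esub>
     ideal_sum (KC ts bs) (minor_ideal n ts bs G ` {1..<(LEAST i. G i = length ts)})"

definition Z_ideal :: "nat \<Rightarrow> nat pp list \<Rightarrow> nat pp list \<Rightarrow> (nat \<Rightarrow> nat) \<Rightarrow> 'a::field cpol set" where
  "Z_ideal n ts bs H = carrier (KC ts bs) \<inter>
     (\<Inter>i\<in>{i \<in> {1..(LEAST i. H i = length ts)}. H i - 1 \<ge> ord_HF (set ts) i}.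
        closed_stratum_ideal n ts bs (H(i := H i - 1)))"


section \<open>Change of order ideal\<close>

text \<open>
  \<open>ts\<close>, \<open>bs\<close> belong to the order ideal of the ambient border basis scheme,
  \<open>ts'\<close>, \<open>bs'\<close> to a second order ideal with equally many elements.  Where
  \<open>\<delta> = change_det\<close> is invertible, \<open>ts'\<close> also represents a basis and, by
  Cramer's rule, \<open>p\<^sub>\<kappa>\<^sub>l / \<delta>\<close> with \<open>p = change_num\<close> are the
  coordinates of the same scheme with respect to \<open>ts'\<close>.  Substituting them into
  \<open>a\<close> and clearing denominators gives \<open>change_poly\<close>.
\<close>

definition change_mat :: "nat \<Rightarrow> nat pp list \<Rightarrow> nat pp list \<Rightarrow> nat pp list \<Rightarrow> 'a::field cpol mat" where
  "change_mat n ts bs ts' = mat_of_cols (length ts) (map (first_col n ts bs) ts')"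

definition change_det :: "nat \<Rightarrow> nat pp list \<Rightarrow> nat pp list \<Rightarrow> nat pp list \<Rightarrow> 'a::field cpol" where
  "change_det n ts bs ts' = det (change_mat n ts bs ts')"

definition change_num :: "nat \<Rightarrow> nat pp list \<Rightarrow> nat pp list \<Rightarrow> nat pp list \<Rightarrow> nat pp list \<Rightarrow>
    nat \<times> nat \<Rightarrow> 'a::field cpol" where
  "change_num n ts bs ts' bs' = (\<lambda>(\<kappa>, l).
     (adj_mat (change_mat n ts bs ts') *\<^sub>v first_col n ts bs (bs' ! l)) $ \<kappa>)"

definition change_poly :: "nat \<Rightarrow> nat pp list \<Rightarrow> nat pp list \<Rightarrow> nat pp list \<Rightarrow> nat pp list \<Rightarrow>
    'a::field cpol \<Rightarrow> 'a cpol" where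
  "change_poly n ts bs ts' bs' a = meval mconst
     (case_option (change_det n ts bs ts') (change_num n ts bs ts' bs')) (homogenize a)"

definition dfb_ideal :: "nat \<Rightarrow> nat pp list \<Rightarrow> nat pp list \<Rightarrow> nat pp list \<Rightarrow> (nat \<Rightarrow> nat) \<Rightarrow>
    'a::field cpol set" where
  "dfb_ideal n ts bs ts' H = Z_ideal n ts bs H \<inter> Idl\<^bsub>KC ts bs\<^esub> {change_det n ts bs ts'}"

text \<open>
  The summand of the final ideal that belongs to the order ideal \<open>ts'\<close>, where \<open>as\<close>
  lists the generators of the ideal given for \<open>ts'\<close>.
\<close>

definition summand_ideal :: "nat \<Rightarrow> nat pp list \<Rightarrow> nat pp list \<Rightarrow> nat pp list \<Rightarrow> nat pp list \<Rightarrow>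
    (nat \<Rightarrow> nat) \<Rightarrow> 'a::field cpol list \<Rightarrow> 'a cpol set" where
  "summand_ideal n ts bs ts' bs' H as =
     (dfb_ideal n ts bs ts' H <+>\<^bsub>KC ts bs\<^esub> closed_stratum_ideal n ts bs H) \<inter>
     (Idl\<^bsub>KC ts bs\<^esub> (change_poly n ts bs ts' bs' ` set as)
        <+>\<^bsub>KC ts bs\<^esub> closed_stratum_ideal n ts bs H)"

end

theory Submission
  imports Defs "Jordan_Normal_Form.Char_Poly"
begin

text \<open>
  Let \<open>\<Gamma>\<close> be a point of the border basis scheme of \<open>\<O>\<close> with coordinates in an extension field.
  The proof reduces the membership of \<open>\<Gamma>\<close> in all the loci involved to linear algebra in the
  coordinate ring \<open>R\<close> of the scheme that \<open>\<Gamma>\<close> represents.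

  Because the multiplication matrices commute at \<open>\<Gamma>\<close>, the elements of \<open>\<O>\<close> represent a basis of
  \<open>R\<close>, and the coordinate vector of a term \<open>u\<close> is the first column of \<open>u(A\<^sub>1, \<dots>, A\<^sub>n)\<close>, evaluated at
  \<open>\<Gamma>\<close> (\<open>scheme_ideal_iff\<close>).  So the value of the affine Hilbert function at \<open>i\<close> is the rank of
  the matrix of the coordinate vectors of the terms of degree at most \<open>i\<close>, and the vanishing of
  minors expresses upper bounds for it (\<open>aff_HF_le_iff_minors\<close>).  Over every extension field the
  ideals of minors therefore cut out the points whose Hilbert function is at most \<open>H\<close>
  (\<open>zeros_closed_stratum_ideal\<close>), and the intersection of the ideals for the functions obtained by
  lowering one value of \<open>H\<close> cuts out those with a strictly smaller Hilbert function
  (\<open>zeros_Z_ideal\<close>).  The strata themselves are defined as closures of sets of points over the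
  algebraic closure of the base field; a form of Hilbert's Nullstellensatz
  (\<open>zeros_vanishing_ideal_zeros\<close>) identifies these closures with the zero loci of the ideals.

  On the points with Hilbert function exactly \<open>H\<close> the summand for an order ideal \<open>\<O>'\<close> is nonzero
  at \<open>\<Gamma>\<close> iff \<open>\<delta>\<close> and some \<open>a\<close>-hat do not vanish.  The first condition means that \<open>\<O>'\<close> also represents a
  basis of \<open>R\<close>; since \<open>\<O>'\<close> has Hilbert function \<open>H\<close>, that basis is automatically compatible with the
  degree filtration (\<open>df_border_basisI\<close>).  Then \<open>p / \<delta>\<close> is the point of the second border basis
  scheme representing the same scheme (\<open>change_of_order_ideal\<close>, \<open>border_point_change_point\<close>), and
  an \<open>a\<close>-hat is, up to a power of \<open>\<delta>\<close>, the value of \<open>a\<close> at this point (\<open>eval_change_poly\<close>), so the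
  second condition is the given description of the property.  Conversely, every \<open>\<Gamma>\<close> with Hilbert
  function \<open>H\<close> is reached by some \<open>\<O>'\<close>: by Macaulay's theorem the standard terms for the
  degree-lexicographic order form an order ideal with the required properties
  (\<open>order_ideal_std\<close>).
\<close>



section \<open>Polynomials and their evaluation\<close>

abbreviation keys :: "('b \<Rightarrow>\<^sub>0 'a::zero) \<Rightarrow> 'b set" where "keys \<equiv> Poly_Mapping.keys"
abbreviation lookup :: "('b \<Rightarrow>\<^sub>0 'a::zero) \<Rightarrow> 'b \<Rightarrow> 'a" where "lookup \<equiv> Poly_Mapping.lookup"

lemma field_hom_imp_comm_ring_hom: "field_hom \<iota> \<Longrightarrow> comm_ring_hom \<iota>"
  by (simp add: field_hom.axioms(1) idom_hom.axioms)

lemma sum_single_lookup: "(\<Sum>t\<in>keys p. Poly_Mapping.single t (lookup p t)) = p"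
proof (rule poly_mapping_eqI)
  fix k
  have "(\<Sum>t\<in>keys p. lookup p t when t = k) = lookup p k"
    by (cases "k \<in> keys p") (auto simp: when_def in_keys_iff)
  thus "lookup (\<Sum>t\<in>keys p. Poly_Mapping.single t (lookup p t)) k = lookup p k"
    by (simp add: lookup_sum lookup_single)
qed

lemma keys_minus_subset: "keys (p - q) \<subseteq> keys p \<union> keys (q :: 'b \<Rightarrow>\<^sub>0 'a::ab_group_add)"
  by (auto simp: in_keys_iff lookup_minus)

lemma keys_sum_subset: "keys (sum f A) \<subseteq> (\<Union>a\<in>A. keys (f a :: 'b \<Rightarrow>\<^sub>0 'a::comm_monoid_add))"
  by (induction A rule: infinite_finite_induct) (use keys_add in fastforce)+

lemma keys_pp_add: "keys (s + t) = keys s \<union> keys (t :: 'v pp)"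
  by (auto simp: in_keys_iff lookup_add)

definition lin :: "('b \<Rightarrow> 'a::comm_ring_1) \<Rightarrow> ('b \<Rightarrow>\<^sub>0 'a) \<Rightarrow> 'a" where
  "lin f p = (\<Sum>t\<in>keys p. lookup p t * f t)"

lemma lin_superset:
  assumes "finite A" "keys p \<subseteq> A"
  shows "lin f p = (\<Sum>t\<in>A. lookup p t * f t)"
  unfolding lin_def by (rule sum.mono_neutral_left) (use assms in \<open>auto simp: in_keys_iff\<close>)

lemma lin_0 [simp]: "lin f 0 = 0"
  by (simp add: lin_def)

lemma lin_add: "lin f (p + q) = lin f p + lin f q"
proof -
  have "lin f (p + q) = (\<Sum>t\<in>keys p \<union> keys q. lookup (p + q) t * f t)"
    by (rule lin_superset) (use keys_add[of p q] in auto)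
  also have "\<dots> = lin f p + lin f q"
    by (simp add: lookup_add algebra_simps sum.distrib
        lin_superset[of "keys p \<union> keys q" p] lin_superset[of "keys p \<union> keys q" q])
  finally show ?thesis .
qed

lemma lin_uminus: "lin f (- p) = - lin f p"
  by (simp add: lin_def sum_negf)

lemma lin_minus: "lin f (p - q) = lin f p - lin f q"
  using lin_add[of f p "- q"] by (simp add: lin_uminus)

lemma lin_single [simp]: "lin f (Poly_Mapping.single t c) = c * f t"
  by (simp add: lin_def)

lemma lin_sum: "lin f (sum g A) = (\<Sum>a\<in>A. lin f (g a))"
  by (induction A rule: infinite_finite_induct) (auto simp: lin_add)

definition mon :: "('v \<Rightarrow> 'b::comm_ring_1) \<Rightarrow> 'v pp \<Rightarrow> 'b" where
  "mon x t = (\<Prod>v\<in>keys t. x v ^ lookup t v)"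

lemma mon_superset:
  assumes "finite A" "keys t \<subseteq> A"
  shows "mon x t = (\<Prod>v\<in>A. x v ^ lookup t v)"
  unfolding mon_def by (rule prod.mono_neutral_left) (use assms in \<open>auto simp: in_keys_iff\<close>)

lemma mon_0 [simp]: "mon x 0 = 1"
  by (simp add: mon_def)

lemma mon_add: "mon x (s + t) = mon x s * mon x t"
  by (simp add: mon_superset[of "keys s \<union> keys t"] keys_pp_add lookup_add power_add prod.distrib)

lemma mon_single [simp]: "mon x (Poly_Mapping.single v k) = x v ^ k"
  by (simp add: mon_def)

lemma mon_sum: "mon x (sum f A) = (\<Prod>a\<in>A. mon x (f a))"
  by (induction A rule: infinite_finite_induct) (auto simp: mon_add)

lemma meval_mon: "meval \<phi> x p = (\<Sum>t\<in>keys p. \<phi> (lookup p t) * mon x t)"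
  by (simp add: meval_def mon_def)

context comm_ring_hom
begin

lemma meval_superset:
  assumes "finite A" "keys p \<subseteq> A"
  shows "meval hom x p = (\<Sum>t\<in>A. hom (lookup p t) * mon x t)"
  unfolding meval_mon by (rule sum.mono_neutral_left) (use assms in \<open>auto simp: in_keys_iff\<close>)

lemma meval_add: "meval hom x (p + q) = meval hom x p + meval hom x q"
proof -
  have "meval hom x (p + q) = (\<Sum>t\<in>keys p \<union> keys q. hom (lookup (p + q) t) * mon x t)"
    by (rule meval_superset) (use keys_add[of p q] in auto)
  also have "\<dots> = meval hom x p + meval hom x q"
    by (simp add: lookup_add hom_add algebra_simps sum.distrib
        meval_superset[of "keys p \<union> keys q" p] meval_superset[of "keys p \<union> keys q" q])
  finally show ?thesis .
qed

lemma meval_single [simp]: "meval hom x (Poly_Mapping.single t c) = hom c * mon x t"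
  by (simp add: meval_mon)

lemma meval_0 [simp]: "meval hom x 0 = 0"
  by (simp add: meval_mon)

lemma meval_sum: "meval hom x (sum g A) = (\<Sum>a\<in>A. meval hom x (g a))"
  by (induction A rule: infinite_finite_induct) (auto simp: meval_add)

lemma meval_mult: "meval hom x (p * q) = meval hom x p * meval hom x q"
proof -
  have "p * q = (\<Sum>s\<in>keys p. \<Sum>t\<in>keys q. Poly_Mapping.single (s + t) (lookup p s * lookup q t))"
    by (subst (1) sum_single_lookup[of p, symmetric], subst (1) sum_single_lookup[of q, symmetric])
      (simp add: sum_product mult_single)
  hence "meval hom x (p * q) =
      (\<Sum>s\<in>keys p. \<Sum>t\<in>keys q. (hom (lookup p s) * mon x s) * (hom (lookup q t) * mon x t))"
    by (simp add: meval_sum hom_mult mon_add mult_ac)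
  thus ?thesis
    by (simp add: meval_mon sum_product)
qed

lemma meval_comm_ring_hom: "comm_ring_hom (meval hom x)"
proof
  show "meval hom x 1 = 1" using meval_single[of x 0 1] by simp
qed (simp_all add: meval_add meval_mult)

lemma meval_mvar: "meval hom x (mvar v) = x v"
  by (simp add: mvar_def)

lemma meval_mconst: "meval hom x (mconst c) = hom c"
  by (simp add: mconst_def)

lemma meval_cong:
  assumes "\<And>v. v \<in> indets p \<Longrightarrow> x v = y v"
  shows "meval hom x p = meval hom y p"
proof -
  have "mon x t = mon y t" if "t \<in> keys p" for t
    unfolding mon_def by (intro prod.cong refl) (use that assms in \<open>force simp: indets_def\<close>)
  thus ?thesis by (simp add: meval_mon)
qed

lemma meval_meval_mconst: "meval hom x (meval mconst y p) = meval hom (\<lambda>v. meval hom x (y v)) p"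
proof -
  interpret m: comm_ring_hom "meval hom x" by (rule meval_comm_ring_hom)
  show ?thesis
    by (simp add: meval_mon[of mconst] m.hom_sum m.hom_mult meval_mconst mon_def m.hom_prod m.hom_power)
      (simp add: meval_mon mon_def)
qed

end

lemma field_hom_to_ac: "field_hom to_ac"
  by unfold_locales auto

subsection \<open>The subring of polynomials in given indeterminates\<close>

lemma indets_add: "indets (p + q) \<subseteq> indets p \<union> indets q"
  using keys_add[of p q] by (auto simp: indets_def)

lemma indets_mult: "indets (p * q) \<subseteq> indets p \<union> indets q"
  using keys_mult[of p q] by (fastforce simp: indets_def keys_pp_add)

lemma indets_multI: "indets p \<subseteq> V \<Longrightarrow> indets q \<subseteq> V \<Longrightarrow> indets (p * q) \<subseteq> V"
  using indets_mult[of p q] by auto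

lemma indets_uminus [simp]: "indets (- p) = indets p"
  by (simp add: indets_def)

lemma indets_0 [simp]: "indets 0 = {}" and indets_1 [simp]: "indets 1 = {}"
  by (simp_all add: indets_def)

lemma indets_mconst [simp]: "indets (mconst c) = {}"
  by (simp add: indets_def mconst_def)

lemma carrier_polyring [simp]: "p \<in> carrier (polyring V) \<longleftrightarrow> indets p \<subseteq> V"
  by (simp add: polyring_def)

lemma polyring_simps [simp]:
  "p \<otimes>\<^bsub>polyring V\<^esub> q = p * q" "p \<oplus>\<^bsub>polyring V\<^esub> q = p + q"
  "\<one>\<^bsub>polyring V\<^esub> = 1" "\<zero>\<^bsub>polyring V\<^esub> = 0"
  by (simp_all add: polyring_def)

lemma cring_polyring: "cring (polyring V)"
proof (intro cringI abelian_groupI comm_monoidI)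
  fix p assume "p \<in> carrier (polyring V)"
  thus "\<exists>q\<in>carrier (polyring V). q \<oplus>\<^bsub>polyring V\<^esub> p = \<zero>\<^bsub>polyring V\<^esub>"
    by (intro bexI[of _ "- p"]) auto
qed (auto simp: algebra_simps dest!: indets_add[THEN subsetD] indets_mult[THEN subsetD])

interpretation polyring: cring "polyring V" for V :: "'v set"
  by (rule cring_polyring)

lemma polyring_a_inv [simp]:
  assumes "indets p \<subseteq> V" shows "\<ominus>\<^bsub>polyring V\<^esub> p = - p"
proof -
  have "- p \<oplus>\<^bsub>polyring V\<^esub> p = \<zero>\<^bsub>polyring V\<^esub>" by simp
  thus ?thesis using assms by (intro polyring.minus_equality[symmetric, THEN sym]) auto
qed

lemma indets_minus: "indets (p - q) \<subseteq> indets p \<union> indets q"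
  using indets_add[of p "- q"] by simp

lemma indets_sum: "(\<And>a. a \<in> A \<Longrightarrow> indets (f a) \<subseteq> V) \<Longrightarrow> indets (sum f A) \<subseteq> V"
  by (induction A rule: infinite_finite_induct) (use indets_add in fastforce)+

lemma indets_prod: "(\<And>a. a \<in> A \<Longrightarrow> indets (f a) \<subseteq> V) \<Longrightarrow> indets (prod f A) \<subseteq> V"
  by (induction A rule: infinite_finite_induct) (use indets_mult in fastforce)+

lemma indets_power: "indets (p ^ k) \<subseteq> indets p"
  by (induction k) (use indets_mult in fastforce)+

lemma indets_minusI: "indets p \<subseteq> V \<Longrightarrow> indets q \<subseteq> V \<Longrightarrow> indets (p - q) \<subseteq> V"
  using indets_minus[of p q] by auto

lemma indets_mvar: "indets (mvar v :: ('v, 'a::comm_ring_1) mpol) = {v}"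
  by (simp add: indets_def mvar_def)

text \<open>
  Closure under negation follows from closure under multiplication by \<open>- 1\<close>.
\<close>

lemma ideal_polyringI:
  fixes I :: "('v, 'a::comm_ring_1) mpol set"
  assumes "I \<subseteq> carrier (polyring V)" "0 \<in> I" "\<And>p q. p \<in> I \<Longrightarrow> q \<in> I \<Longrightarrow> p + q \<in> I"
    and mult: "\<And>p q. indets p \<subseteq> V \<Longrightarrow> q \<in> I \<Longrightarrow> p * q \<in> I"
  shows "ideal I (polyring V)"
proof (rule idealI[OF polyring.ring_axioms])
  show "subgroup I (add_monoid (polyring V))"
  proof (rule polyring.add.subgroupI)
    fix p assume "p \<in> I"
    thus "\<ominus>\<^bsub>polyring V\<^esub> p \<in> I"
      using mult[of "- 1" p] assms(1) by (auto simp: subset_iff)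
  qed (use assms in auto)
next
  fix a x :: "('v, 'a) mpol" assume "a \<in> I" "x \<in> carrier (polyring V)"
  hence "x * a \<in> I" by (intro mult) auto
  thus "x \<otimes>\<^bsub>polyring V\<^esub> a \<in> I" "a \<otimes>\<^bsub>polyring V\<^esub> x \<in> I"
    by (simp_all add: mult.commute)
qed

lemma ideal_polyringD:
  assumes "ideal I (polyring V)"
  shows "p \<in> I \<Longrightarrow> indets p \<subseteq> V" "0 \<in> I" "p \<in> I \<Longrightarrow> q \<in> I \<Longrightarrow> p + q \<in> I"
    "indets p \<subseteq> V \<Longrightarrow> q \<in> I \<Longrightarrow> p * q \<in> I" "p \<in> I \<Longrightarrow> - p \<in> I"
    "p \<in> I \<Longrightarrow> q \<in> I \<Longrightarrow> p - q \<in> I"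
proof -
  interpret ideal I "polyring V" by fact
  show sub: "indets p \<subseteq> V" if "p \<in> I" for p using a_Hcarr[OF that] by simp
  show "0 \<in> I" using additive_subgroup.zero_closed[OF is_additive_subgroup] by simp
  show add: "p + q \<in> I" if "p \<in> I" "q \<in> I" for p q using a_closed[OF that] by simp
  show "p * q \<in> I" if "indets p \<subseteq> V" "q \<in> I" using I_l_closed[OF that(2), of p] that by simp
  show neg: "- p \<in> I" if "p \<in> I" for p using a_inv_closed[OF that] sub[OF that] by simp
  show "p - q \<in> I" if "p \<in> I" "q \<in> I" using add[OF that(1) neg[OF that(2)]] by simp
qed

lemma ideal_polyring_subset: "ideal I (polyring V) \<Longrightarrow> I \<subseteq> carrier (polyring V)"
  using ideal_polyringD(1) unfolding carrier_polyring[THEN eq_reflection, symmetric] by blast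

lemma ideal_sum_in:
  assumes "ideal I (polyring V)" "\<And>a. a \<in> A \<Longrightarrow> f a \<in> I" shows "sum f A \<in> I"
  using assms(2)
  by (induction A rule: infinite_finite_induct) (auto intro: ideal_polyringD[OF assms(1)])

subsection \<open>Zero loci of ideals\<close>

context
  fixes \<iota> :: "'k::field \<Rightarrow> 'l::field" and ts bs :: "nat pp list"
  assumes hom: "field_hom \<iota>"
begin

interpretation comm_ring_hom \<iota> using hom by (rule field_hom_imp_comm_ring_hom)

lemma zeros_genideal:
  assumes "S \<subseteq> carrier (KC ts bs)"
  shows "zeros \<iota> ts bs (Idl\<^bsub>KC ts bs\<^esub> S) = zeros \<iota> ts bs S"
proof
  show "zeros \<iota> ts bs (Idl\<^bsub>KC ts bs\<^esub> S) \<subseteq> zeros \<iota> ts bs S"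
    using polyring.genideal_self[OF assms] by (auto simp: zeros_def)
  show "zeros \<iota> ts bs S \<subseteq> zeros \<iota> ts bs (Idl\<^bsub>KC ts bs\<^esub> S)"
  proof
    fix \<Gamma> assume \<Gamma>: "\<Gamma> \<in> zeros \<iota> ts bs S"
    let ?I = "{f \<in> carrier (KC ts bs). meval \<iota> (($$) \<Gamma>) f = 0}"
    have "ideal ?I (KC ts bs)"
      by (rule ideal_polyringI) (auto simp: meval_add meval_mult dest!: indets_add[THEN subsetD] indets_mult[THEN subsetD])
    hence "Idl\<^bsub>KC ts bs\<^esub> S \<subseteq> ?I"
      by (rule polyring.genideal_minimal) (use \<Gamma> assms in \<open>auto simp: zeros_def subset_iff\<close>)
    thus "\<Gamma> \<in> zeros \<iota> ts bs (Idl\<^bsub>KC ts bs\<^esub> S)"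
      using \<Gamma> by (auto simp: zeros_def)
  qed
qed

lemma zeros_set_add:
  assumes "ideal I (KC ts bs)" "ideal J (KC ts bs)"
  shows "zeros \<iota> ts bs (I <+>\<^bsub>KC ts bs\<^esub> J) = zeros \<iota> ts bs I \<inter> zeros \<iota> ts bs J"
proof -
  have *: "I <+>\<^bsub>KC ts bs\<^esub> J = {p + q | p q. p \<in> I \<and> q \<in> J}"
    by (auto simp: set_add_def')
  have "p \<in> I <+>\<^bsub>KC ts bs\<^esub> J" if "p \<in> I" for p
    unfolding * using that ideal_polyringD(2)[OF assms(2)] by (force intro: exI[of _ p])
  moreover have "p \<in> I <+>\<^bsub>KC ts bs\<^esub> J" if "p \<in> J" for p
    unfolding * using that ideal_polyringD(2)[OF assms(1)] by (force intro: exI[of _ p])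
  ultimately show ?thesis
    by (auto simp: zeros_def * meval_add)
qed

text \<open>
  A point outside both loci is separated from each by some polynomial; the product of the two
  lies in the intersection and does not vanish there.
\<close>

lemma zeros_Int:
  assumes "ideal I (KC ts bs)" "ideal J (KC ts bs)"
  shows "zeros \<iota> ts bs (I \<inter> J) = zeros \<iota> ts bs I \<union> zeros \<iota> ts bs J"
proof
  show "zeros \<iota> ts bs (I \<inter> J) \<subseteq> zeros \<iota> ts bs I \<union> zeros \<iota> ts bs J"
  proof (rule subsetI, rule ccontr)
    fix \<Gamma> assume \<Gamma>: "\<Gamma> \<in> zeros \<iota> ts bs (I \<inter> J)" "\<Gamma> \<notin> zeros \<iota> ts bs I \<union> zeros \<iota> ts bs J"
    then obtain p q where pq: "p \<in> I" "q \<in> J" "meval \<iota> (($$) \<Gamma>) p \<noteq> 0" "meval \<iota> (($$) \<Gamma>) q \<noteq> 0"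
      by (auto simp: zeros_def)
    have "p * q \<in> I \<inter> J"
      using pq ideal_polyringD(1,4)[OF assms(1)] ideal_polyringD(1,4)[OF assms(2)]
      by (metis IntI mult.commute)
    hence "meval \<iota> (($$) \<Gamma>) (p * q) = 0" using \<Gamma> by (auto simp: zeros_def)
    thus False using pq by (simp add: meval_mult)
  qed
qed (auto simp: zeros_def)

lemma zeros_carrier: "zeros \<iota> ts bs (carrier (KC ts bs)) = {}"
proof -
  have "1 \<in> carrier (KC ts bs)" by simp
  moreover have "meval \<iota> x 1 \<noteq> 0" for x :: "nat \<times> nat \<Rightarrow> 'l"
    using comm_ring_hom.meval_single[OF comm_ring_hom_axioms, of x 0 1] by simp
  ultimately show ?thesis unfolding zeros_def by blast
qed

lemma zeros_Inter:
  assumes "finite A" "\<And>i. i \<in> A \<Longrightarrow> ideal (I i) (KC ts bs)"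
  shows "zeros \<iota> ts bs (carrier (KC ts bs) \<inter> (\<Inter>i\<in>A. I i)) = (\<Union>i\<in>A. zeros \<iota> ts bs (I i))"
    and "ideal (carrier (KC ts bs) \<inter> (\<Inter>i\<in>A. I i)) (KC ts bs)"
proof -
  let ?J = "\<lambda>A. carrier (KC ts bs) \<inter> (\<Inter>i\<in>A. I i)"
  have "ideal (?J A) (KC ts bs) \<and> zeros \<iota> ts bs (?J A) = (\<Union>i\<in>A. zeros \<iota> ts bs (I i))"
    using assms
  proof (induction A rule: finite_induct)
    case empty
    show ?case using polyring.oneideal by (simp add: zeros_carrier)
  next
    case (insert a A)
    have *: "?J (insert a A) = I a \<inter> ?J A" by auto
    show ?case unfolding *
      using insert zeros_Int[of "I a" "?J A"] polyring.i_intersect[of "I a" _ "?J A"] by auto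
  qed
  thus "zeros \<iota> ts bs (?J A) = (\<Union>i\<in>A. zeros \<iota> ts bs (I i))" "ideal (?J A) (KC ts bs)" by auto
qed

lemma zeros_ideal_sum:
  assumes "\<And>I. I \<in> F \<Longrightarrow> I \<subseteq> carrier (KC ts bs)"
  shows "zeros \<iota> ts bs (ideal_sum (KC ts bs) F) =
    {\<Gamma> \<in> carrier_mat (length ts) (length bs). \<forall>I\<in>F. \<Gamma> \<in> zeros \<iota> ts bs I}"
  unfolding ideal_sum_def by (subst zeros_genideal) (use assms in \<open>auto simp: zeros_def\<close>)

end


section \<open>Specialization of points to an algebraically closed field\<close>

text \<open>
  Division without inverting the leading coefficient.  In \<open>hom_extension\<close> the coefficients live
  in a ring of which only images in fields are controlled, so zero divisors must be admitted.
\<close>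

lemma pseudo_division:
  fixes p q :: "'a::comm_ring_1 poly"
  obtains k s r where "smult (lead_coeff p ^ k) q = p * s + r" "r = 0 \<or> degree r < degree p"
    "degree s \<le> degree q - degree p"
proof -
  have "\<exists>k s r. smult (lead_coeff p ^ k) q = p * s + r \<and> (r = 0 \<or> degree r < degree p) \<and>
    degree s \<le> degree q - degree p"
  proof (induction "degree q" arbitrary: q rule: less_induct)
    case less
    consider "degree q < degree p" | "degree p = 0" | "degree p > 0" "degree p \<le> degree q"
      by linarith
    thus ?case
    proof cases
      case 1
      thus ?thesis by (intro exI[of _ 0] exI[of _ "0 :: 'a poly"] exI[of _ q]) auto
    next
      case 2
      then obtain c where "p = [:c:]" using degree_eq_zeroE by blast
      thus ?thesis by (intro exI[of _ 1] exI[of _ q] exI[of _ "0 :: 'a poly"]) auto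
    next
      case 3
      define d where "d = degree q - degree p"
      define m where "m = monom (lead_coeff q) d"
      define q' where "q' = smult (lead_coeff p) q - p * m"
      have m: "degree m \<le> d" by (simp add: m_def degree_monom_le)
      have "degree (p * m) \<le> degree q"
        using degree_mult_le[of p m] m 3 by (simp add: d_def)
      hence le: "degree q' \<le> degree q"
        unfolding q'_def by (intro degree_diff_le) (auto simp: degree_smult_le)
      have "coeff q' (degree q) = 0"
      proof -
        have eq: "p * m = monom (lead_coeff q) d * p" unfolding m_def by (rule mult.commute)
        show ?thesis
          unfolding q'_def coeff_diff eq coeff_monom_mult coeff_smult using 3
          by (simp add: d_def mult.commute)
      qed
      with le 3 have less': "degree q' < degree q"
        by (metis (no_types, lifting) degree_0 le_neq_implies_less leading_coeff_0_iff less_le_trans)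
      from less[OF this] obtain k s r where ksr: "smult (lead_coeff p ^ k) q' = p * s + r"
          "r = 0 \<or> degree r < degree p" "degree s \<le> degree q' - degree p"
        by blast
      have "smult (lead_coeff p ^ Suc k) q = smult (lead_coeff p ^ k) (q' + p * m)"
        by (simp add: q'_def mult.commute)
      also have "\<dots> = p * (s + smult (lead_coeff p ^ k) m) + r"
        using ksr(1) by (simp add: smult_add_right algebra_simps)
      finally have "smult (lead_coeff p ^ Suc k) q = p * (s + smult (lead_coeff p ^ k) m) + r" .
      moreover have "degree (s + smult (lead_coeff p ^ k) m) \<le> degree q - degree p"
        using ksr(3) less' m degree_smult_le[of "lead_coeff p ^ k" m]
        by (intro degree_add_le) (auto simp: d_def)
      ultimately show ?thesis using ksr(2) by blast
    qed
  qed
  thus ?thesis using that by blast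
qed

text \<open>
  Over a finite field the polynomial \<open>1 + \<Prod>\<^sub>a (X - a)\<close> would have no root.
\<close>

lemma infinite_UNIV_alg_closed: "infinite (UNIV :: 'a::alg_closed_field set)"
proof
  assume fin: "finite (UNIV :: 'a set)"
  define p :: "'a poly" where "p = (\<Prod>a\<in>UNIV. [:- a, 1:])"
  have "degree p = card (UNIV :: 'a set)"
    unfolding p_def by (subst degree_prod_eq_sum_degree) auto
  hence "degree p > 0" using fin by (simp add: card_gt_0_iff)
  hence "degree (p + 1) > 0" by (subst degree_add_eq_left) auto
  then obtain x where "poly (p + 1) x = 0" using alg_closed_imp_poly_has_root by blast
  moreover have "poly p x = 0" using fin by (auto simp: p_def poly_prod)
  ultimately show False by simp
qed

text \<open>
  Extension of homomorphisms to an algebraically closed field, without rings of fractions: \<open>ev\<close>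
  stands for the inclusion of a ring into a field, extended by one element \<open>x\<close>.  A homomorphism
  \<open>\<phi>\<close> on the small ring extends to the ring generated by \<open>x\<close>, with nonzero value at the element
  given by \<open>b\<close>, as soon as it does not kill a suitable element \<open>a\<close>.

  If \<open>x\<close> is transcendental, any nonzero coefficient of \<open>b\<close> serves as \<open>a\<close>, as all but finitely many
  values of \<open>x\<close> are admissible.  If \<open>x\<close> is algebraic, let \<open>p\<close> be a relation of minimal degree.
  Every relation is a multiple of \<open>p\<close> up to powers of the leading coefficient of \<open>p\<close>, so \<open>x\<close> may
  be sent to any root of the image of \<open>p\<close> provided that the leading coefficient survives.  A
  nonzero multiple of \<open>b(x)\<close> of minimal degree in \<open>x\<close> is a constant, since otherwise it would
  divide \<open>p\<close>; if this constant survives as well, then so does \<open>b(x)\<close>.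
\<close>

lemma hom_extension:
  fixes ev :: "'r::comm_ring_1 \<Rightarrow> 'l::field" and x :: 'l and b :: "'r poly"
  assumes ev: "comm_ring_hom ev" and b: "poly (map_poly ev b) x \<noteq> 0"
  obtains a where "ev a \<noteq> 0"
    "\<And>\<phi> :: 'r \<Rightarrow> 'o::alg_closed_field. comm_ring_hom \<phi> \<Longrightarrow> (\<And>r. ev r = 0 \<Longrightarrow> \<phi> r = 0) \<Longrightarrow> \<phi> a \<noteq> 0 \<Longrightarrow>
       \<exists>\<xi>. poly (map_poly \<phi> b) \<xi> \<noteq> 0 \<and>
         (\<forall>q. poly (map_poly ev q) x = 0 \<longrightarrow> poly (map_poly \<phi> q) \<xi> = 0)"
proof -
  interpret ev: comm_ring_hom ev by fact
  interpret mev: map_poly_comm_ring_hom ev ..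
  define E where "E q = poly (map_poly ev q) x" for q
  define Z where "Z q \<longleftrightarrow> (\<forall>i. ev (coeff q i) = 0)" for q
  have E_simps: "E (p + q) = E p + E q" "E (p * q) = E p * E q" "E (smult c p) = ev c * E p"
      "E (p - q) = E p - E q" "E 0 = 0" "E [:c:] = ev c" "E (- p) = - E p" for p q c
    by (simp_all add: E_def mev.hom_add mev.hom_mult ev.map_poly_hom_smult mev.hom_minus
        ev.map_poly_pCons_hom mev.hom_uminus)
  have Z_E: "E q = 0" if "Z q" for q
  proof -
    have "map_poly ev q = 0" by (rule poly_eqI) (use that in \<open>simp add: Z_def\<close>)
    thus ?thesis by (simp add: E_def)
  qed
  have Z_hom: "poly (map_poly \<phi> q) \<xi> = 0"
    if "Z q" "comm_ring_hom \<phi>" "\<And>r. ev r = 0 \<Longrightarrow> \<phi> r = 0" for \<phi> :: "'r \<Rightarrow> 'o" and q \<xi>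
  proof -
    interpret \<phi>: comm_ring_hom \<phi> by fact
    have "map_poly \<phi> q = 0" by (rule poly_eqI) (use that in \<open>simp add: Z_def\<close>)
    thus ?thesis by simp
  qed
  \<comment> \<open>Dropping the coefficients that \<open>ev\<close> kills changes neither the value nor \<open>Z\<close>.\<close>
  have reduce: "\<exists>q'. degree q' \<le> degree q \<and> E q' = E q \<and> ev (lead_coeff q') \<noteq> 0" if "\<not> Z q" for q
  proof -
    define q' where "q' = map_poly (\<lambda>c. if ev c = 0 then 0 else c) q"
    have c: "coeff q' i = (if ev (coeff q i) = 0 then 0 else coeff q i)" for i
      by (simp add: q'_def coeff_map_poly)
    have m: "map_poly ev q' = map_poly ev q" by (rule poly_eqI) (simp add: c)
    have "q' \<noteq> 0"
    proof
      assume "q' = 0"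
      hence "ev (coeff q i) = 0" for i using c[of i] by (auto split: if_splits)
      hence "Z q" by (simp add: Z_def)
      thus False using that by simp
    qed
    hence "ev (lead_coeff q') \<noteq> 0"
      using c[of "degree q'"] by (metis leading_coeff_0_iff)
    thus ?thesis using m degree_map_poly_le[of "\<lambda>c. if ev c = 0 then 0 else c" q]
      by (auto simp: E_def q'_def)
  qed
  show ?thesis
  proof (cases "\<forall>q. E q = 0 \<longrightarrow> Z q")
    case True
    obtain i where i: "ev (coeff b i) \<noteq> 0" using Z_E b by (auto simp: E_def Z_def)
    show ?thesis
    proof (rule that[OF i])
      fix \<phi> :: "'r \<Rightarrow> 'o"
      assume \<phi>: "comm_ring_hom \<phi>" "\<And>r. ev r = 0 \<Longrightarrow> \<phi> r = 0" "\<phi> (coeff b i) \<noteq> 0"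
      interpret \<phi>: comm_ring_hom \<phi> by fact
      have "map_poly \<phi> b \<noteq> 0" using \<phi>(3) by (metis \<phi>.coeff_map_poly_hom coeff_0)
      hence "finite {\<xi>. poly (map_poly \<phi> b) \<xi> = 0}" by (rule poly_roots_finite)
      then obtain \<xi> where "poly (map_poly \<phi> b) \<xi> \<noteq> 0"
        using infinite_UNIV_alg_closed[where ?'a = 'o] by (metis (mono_tags, lifting) UNIV_eq_I mem_Collect_eq)
      thus "\<exists>\<xi>. poly (map_poly \<phi> b) \<xi> \<noteq> 0 \<and>
          (\<forall>q. poly (map_poly ev q) x = 0 \<longrightarrow> poly (map_poly \<phi> q) \<xi> = 0)"
        using True Z_hom[OF _ \<phi>(1,2)] by (auto simp: E_def)
    qed
  next
    case False
    let ?P = "\<lambda>p. E p = 0 \<and> ev (lead_coeff p) \<noteq> 0"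
    have "\<exists>p. ?P p" using False reduce by metis
    then obtain p where p: "?P p" and p_min: "\<And>q. ?P q \<Longrightarrow> degree p \<le> degree q"
      using ex_has_least_nat[of ?P _ degree] by metis
    have small: "Z q" if "E q = 0" "q = 0 \<or> degree q < degree p" for q
    proof (rule ccontr)
      assume "\<not> Z q"
      moreover from this have "q \<noteq> 0" by (auto simp: Z_def)
      ultimately show False using that reduce[of q] p_min by fastforce
    qed
    have pos: "degree p > 0"
    proof (rule ccontr)
      assume "\<not> degree p > 0"
      then obtain c where "p = [:c:]" using degree_eq_zeroE by blast
      thus False using p by (simp add: E_simps)
    qed
    let ?Q = "\<lambda>r. E r \<noteq> 0 \<and> (\<exists>c. E r = E b * E c) \<and> ev (lead_coeff r) \<noteq> 0"
    have redQ: "\<exists>r'. ?Q r' \<and> degree r' \<le> degree r" if "E r \<noteq> 0" "E r = E b * E c" for r c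
    proof -
      have "\<not> Z r" using that(1) Z_E by blast
      from reduce[OF this] that show ?thesis by metis
    qed
    have "E b \<noteq> 0" "E b = E b * E [:1:]" using b by (auto simp: E_simps) (simp add: E_def)
    hence "\<exists>r. ?Q r" using redQ by blast
    then obtain r where r: "?Q r" and r_min: "\<And>q. ?Q q \<Longrightarrow> degree r \<le> degree q"
      using ex_has_least_nat[of ?Q _ degree] by metis
    have r_min': "degree r \<le> degree q" if "E q \<noteq> 0" "E q = E b * E c" for q c
      using redQ[OF that] r_min by fastforce
    from r obtain c where c: "E r = E b * E c" by blast
    have deg_r: "degree r < degree p"
    proof -
      obtain k s r1 where d: "smult (lead_coeff p ^ k) r = p * s + r1"
          "r1 = 0 \<or> degree r1 < degree p"
        using pseudo_division .
      have E_r1: "E r1 = ev (lead_coeff p ^ k) * E r"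
        using arg_cong[OF d(1), of E] p by (simp add: E_simps)
      hence "E r1 \<noteq> 0" using p r by (simp add: ev.hom_power)
      moreover have "E r1 = E b * E (smult (lead_coeff p ^ k) c)"
        unfolding E_r1 c E_simps by (simp add: mult_ac)
      ultimately have "E r1 \<noteq> 0" "E r1 = E b * E (smult (lead_coeff p ^ k) c)" .
      hence "degree r \<le> degree r1" "r1 \<noteq> 0" using r_min' E_simps(5) by auto
      thus ?thesis using d(2) by auto
    qed
    have "degree r = 0"
    proof (rule ccontr)
      assume r0: "degree r \<noteq> 0"
      obtain k s r' where d: "smult (lead_coeff r ^ k) p = r * s + r'"
          "r' = 0 \<or> degree r' < degree r" "degree s \<le> degree p - degree r"
        using pseudo_division .
      have *: "E r * E s + E r' = 0"
        using arg_cong[OF d(1), of E] p by (simp add: E_simps)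
      hence "E r' = E b * E (- (c * s))" using c by (simp add: E_simps algebra_simps eq_neg_iff_add_eq_0)
      hence r': "E r' = 0" using r_min'[of r'] d(2) E_simps(5) by force
      hence "E s = 0" using * r by simp
      hence Zs: "Z s" by (rule small) (use d(3) r0 deg_r in linarith)
      have Zr': "Z r'" by (rule small) (use d(2) deg_r r' in auto)
      have "map_poly ev s = 0" "map_poly ev r' = 0"
        using Zs Zr' by (auto simp: Z_def poly_eq_iff)
      hence "smult (ev (lead_coeff r ^ k)) (map_poly ev p) = 0"
        using arg_cong[OF d(1), of "map_poly ev"]
        by (simp add: mev.hom_add mev.hom_mult ev.map_poly_hom_smult)
      hence "ev (lead_coeff r ^ k) * ev (lead_coeff p) = 0"
        by (metis coeff_0 coeff_smult ev.coeff_map_poly_hom)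
      thus False using r p by (simp add: ev.hom_power)
    qed
    then obtain d where d: "r = [:d:]" using degree_eq_zeroE by blast
    show ?thesis
    proof (rule that[of "lead_coeff p * d"])
      show "ev (lead_coeff p * d) \<noteq> 0" using p r d by (simp add: ev.hom_mult)
      fix \<phi> :: "'r \<Rightarrow> 'o"
      assume \<phi>: "comm_ring_hom \<phi>" "\<And>r. ev r = 0 \<Longrightarrow> \<phi> r = 0" "\<phi> (lead_coeff p * d) \<noteq> 0"
      interpret \<phi>: comm_ring_hom \<phi> by fact
      interpret m\<phi>: map_poly_comm_ring_hom \<phi> ..
      have nz: "\<phi> (lead_coeff p) \<noteq> 0" "\<phi> d \<noteq> 0" using \<phi>(3) by (auto simp: \<phi>.hom_mult)
      have "degree (map_poly \<phi> p) > 0"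
        using pos nz(1) by (metis \<phi>.coeff_map_poly_hom gr0I le_degree not_le)
      then obtain \<xi> where \<xi>: "poly (map_poly \<phi> p) \<xi> = 0"
        using alg_closed_imp_poly_has_root by blast
      have vanish: "poly (map_poly \<phi> q) \<xi> = 0" if "E q = 0" for q
      proof -
        obtain k s r1 where qd: "smult (lead_coeff p ^ k) q = p * s + r1"
            "r1 = 0 \<or> degree r1 < degree p"
          using pseudo_division .
        have "E r1 = 0" using arg_cong[OF qd(1), of E] p that by (simp add: E_simps)
        hence "Z r1" using small qd(2) by blast
        hence "poly (map_poly \<phi> r1) \<xi> = 0" using Z_hom \<phi>(1,2) by blast
        hence "\<phi> (lead_coeff p ^ k) * poly (map_poly \<phi> q) \<xi> = 0"
          using arg_cong[OF qd(1), of "\<lambda>q. poly (map_poly \<phi> q) \<xi>"] \<xi>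
          by (simp add: m\<phi>.hom_add m\<phi>.hom_mult \<phi>.map_poly_hom_smult)
        thus ?thesis using nz(1) by (simp add: \<phi>.hom_power)
      qed
      have "E ([:d:] - b * c) = 0" using c d by (simp add: E_simps)
      from vanish[OF this] have "\<phi> d = poly (map_poly \<phi> b) \<xi> * poly (map_poly \<phi> c) \<xi>"
        by (simp add: m\<phi>.hom_minus m\<phi>.hom_mult \<phi>.map_poly_pCons_hom)
      hence "poly (map_poly \<phi> b) \<xi> \<noteq> 0" using nz(2) by auto
      thus "\<exists>\<xi>. poly (map_poly \<phi> b) \<xi> \<noteq> 0 \<and>
          (\<forall>q. poly (map_poly ev q) x = 0 \<longrightarrow> poly (map_poly \<phi> q) \<xi> = 0)"
        using vanish by (auto simp: E_def)
    qed
  qed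
qed

text \<open>
  Polynomials as univariate polynomials in \<open>v\<close>: the coefficients no longer involve \<open>v\<close>, which
  makes it possible to specialize points one coordinate at a time.
\<close>

definition upoly :: "'v \<Rightarrow> ('v, 'a::comm_ring_1) mpol \<Rightarrow> ('v, 'a) mpol poly" where
  "upoly v p = (\<Sum>t\<in>keys p. monom (Poly_Mapping.single (Poly_Mapping.update v 0 t) (lookup p t)) (lookup t v))"

lemma mon_update:
  "mon y t = mon (y(v := 0)) (Poly_Mapping.update v 0 t) * y v ^ lookup t v"
proof -
  have "mon y t = (\<Prod>w\<in>insert v (keys t - {v}). y w ^ lookup t w)"
    by (rule mon_superset) auto
  also have "\<dots> = y v ^ lookup t v * (\<Prod>w\<in>keys t - {v}. y w ^ lookup t w)"
    by (subst prod.insert) auto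
  also have "(\<Prod>w\<in>keys t - {v}. y w ^ lookup t w) = mon (y(v := 0)) (Poly_Mapping.update v 0 t)"
    unfolding mon_def by (intro prod.cong) (auto simp: keys_update lookup_update)
  finally show ?thesis by (simp add: mult.commute)
qed

lemma (in comm_ring_hom) meval_upoly:
  "meval hom y p = poly (map_poly (meval hom (y(v := 0))) (upoly v p)) (y v)"
proof -
  interpret m: comm_ring_hom "meval hom (y(v := 0))" by (rule meval_comm_ring_hom)
  interpret mm: map_poly_comm_ring_hom "meval hom (y(v := 0))" ..
  show ?thesis
    by (simp add: upoly_def mm.hom_sum poly_sum poly_monom mult.assoc flip: mon_update)
      (simp add: meval_mon)
qed

lemma mon_at_0: "mon (\<lambda>_. 0) t = (if t = 0 then 1 else 0)"
proof (cases "t = 0")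
  case False
  then obtain v where "v \<in> keys t" by (metis poly_mapping_eqI in_keys_iff lookup_zero)
  thus ?thesis using False unfolding mon_def
    by (subst prod_zero) (auto simp: in_keys_iff zero_power intro!: bexI[of _ v])
qed simp

lemma (in comm_ring_hom) meval_at_0: "meval hom (\<lambda>_. 0) p = hom (lookup p 0)"
proof -
  have "meval hom (\<lambda>_. 0) p = (\<Sum>t\<in>insert 0 (keys p). hom (lookup p t) * mon (\<lambda>_. 0) t)"
    by (rule meval_superset) auto
  also have "\<dots> = (\<Sum>t\<in>insert 0 (keys p). if t = 0 then hom (lookup p 0) else 0)"
    by (intro sum.cong) (auto simp: mon_at_0)
  finally show ?thesis by (simp add: sum.delta)
qed

text \<open>
  A point over any extension field specializes to a point over the algebraically closed field that
  satisfies all equations of the given point and still avoids the zeros of \<open>f\<close>.  The points are set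
  to \<open>0\<close> outside \<open>V\<close>, so the induction on \<open>V\<close> can quantify over all polynomials instead of those
  in the indeterminates of \<open>V\<close>.
\<close>

lemma specialization:
  fixes \<iota> :: "'k::field \<Rightarrow> 'l::field" and \<kappa> :: "'k \<Rightarrow> 'o::alg_closed_field"
  assumes \<iota>: "field_hom \<iota>" and \<kappa>: "field_hom \<kappa>" and "finite V"
  shows "(\<And>v. v \<notin> V \<Longrightarrow> \<Gamma> v = 0) \<Longrightarrow> meval \<iota> \<Gamma> f \<noteq> 0 \<Longrightarrow>
    \<exists>\<gamma>. (\<forall>v. v \<notin> V \<longrightarrow> \<gamma> v = 0) \<and> meval \<kappa> \<gamma> f \<noteq> 0 \<and> (\<forall>g. meval \<iota> \<Gamma> g = 0 \<longrightarrow> meval \<kappa> \<gamma> g = 0)"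
  using \<open>finite V\<close>
proof (induction V arbitrary: \<Gamma> f rule: finite_induct)
  case empty
  interpret \<iota>: field_hom \<iota> by fact
  interpret \<kappa>: field_hom \<kappa> by fact
  have "\<Gamma> = (\<lambda>_. 0)" using empty by auto
  thus ?case using empty by (intro exI[of _ "\<lambda>_. 0"]) (auto simp: \<iota>.meval_at_0 \<kappa>.meval_at_0)
next
  case (insert v V)
  interpret \<iota>: field_hom \<iota> by fact
  interpret \<kappa>: field_hom \<kappa> by fact
  let ?\<Gamma> = "\<Gamma>(v := 0)"
  have "poly (map_poly (meval \<iota> ?\<Gamma>) (upoly v f)) (\<Gamma> v) \<noteq> 0"
    using insert.prems(2) \<iota>.meval_upoly[of \<Gamma> f v] by simp
  from hom_extension[OF \<iota>.meval_comm_ring_hom this]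
  obtain a where a: "meval \<iota> ?\<Gamma> a \<noteq> 0"
    "\<And>\<phi> :: _ \<Rightarrow> 'o. comm_ring_hom \<phi> \<Longrightarrow> (\<And>r. meval \<iota> ?\<Gamma> r = 0 \<Longrightarrow> \<phi> r = 0) \<Longrightarrow> \<phi> a \<noteq> 0 \<Longrightarrow>
       \<exists>\<xi>. poly (map_poly \<phi> (upoly v f)) \<xi> \<noteq> 0 \<and>
         (\<forall>q. poly (map_poly (meval \<iota> ?\<Gamma>) q) (\<Gamma> v) = 0 \<longrightarrow> poly (map_poly \<phi> q) \<xi> = 0)"
    by metis
  have "\<And>w. w \<notin> V \<Longrightarrow> ?\<Gamma> w = 0" using insert.prems(1) by auto
  from insert.IH[OF this a(1)] obtain \<gamma> where \<gamma>: "\<And>w. w \<notin> V \<Longrightarrow> \<gamma> w = 0" "meval \<kappa> \<gamma> a \<noteq> 0"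
      "\<And>g. meval \<iota> ?\<Gamma> g = 0 \<Longrightarrow> meval \<kappa> \<gamma> g = 0"
    by blast
  from a(2)[OF \<kappa>.meval_comm_ring_hom \<gamma>(3,2)]
  obtain \<xi> where \<xi>: "poly (map_poly (meval \<kappa> \<gamma>) (upoly v f)) \<xi> \<noteq> 0"
     "\<And>q. poly (map_poly (meval \<iota> ?\<Gamma>) q) (\<Gamma> v) = 0 \<Longrightarrow> poly (map_poly (meval \<kappa> \<gamma>) q) \<xi> = 0"
    by blast
  have "(\<gamma>(v := \<xi>))(v := 0) = \<gamma>" using \<gamma>(1)[OF insert.hyps(2)] by auto
  hence \<gamma>': "meval \<kappa> (\<gamma>(v := \<xi>)) g = poly (map_poly (meval \<kappa> \<gamma>) (upoly v g)) \<xi>" for g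
    using \<kappa>.meval_upoly[of "\<gamma>(v := \<xi>)" g v] by simp
  show ?case
  proof (intro exI conjI allI impI)
    show "(\<gamma>(v := \<xi>)) w = 0" if "w \<notin> insert v V" for w using that \<gamma>(1) by auto
    show "meval \<kappa> (\<gamma>(v := \<xi>)) f \<noteq> 0" using \<xi>(1) unfolding \<gamma>' .
    show "meval \<kappa> (\<gamma>(v := \<xi>)) g = 0" if "meval \<iota> \<Gamma> g = 0" for g
      unfolding \<gamma>' using \<xi>(2)[of "upoly v g"] that \<iota>.meval_upoly[of \<Gamma> g v] by simp
  qed
qed

text \<open>
  The Nullstellensatz in the form in which it enters the closures: it says that the points over
  the algebraic closure of the base field determine the zero locus over every extension field.
\<close>

theorem zeros_vanishing_ideal_zeros:
  fixes \<iota> :: "'k::field \<Rightarrow> 'l::field"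
  assumes \<iota>: "field_hom \<iota>" and I: "I \<subseteq> carrier (KC ts bs)"
  shows "zeros \<iota> ts bs (vanishing_ideal ts bs (zeros to_ac ts bs I)) = zeros \<iota> ts bs I"
proof
  have "I \<subseteq> vanishing_ideal ts bs (zeros to_ac ts bs I)"
    using I unfolding vanishing_ideal_def zeros_def by blast
  thus "zeros \<iota> ts bs (vanishing_ideal ts bs (zeros to_ac ts bs I)) \<subseteq> zeros \<iota> ts bs I"
    by (auto simp: zeros_def)
next
  interpret \<iota>: field_hom \<iota> by fact
  interpret ac: field_hom to_ac by (rule field_hom_to_ac)
  let ?V = "{..<length ts} \<times> {..<length bs}"
  show "zeros \<iota> ts bs I \<subseteq> zeros \<iota> ts bs (vanishing_ideal ts bs (zeros to_ac ts bs I))"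
  proof (rule subsetI, rule ccontr)
    fix \<Gamma> assume \<Gamma>: "\<Gamma> \<in> zeros \<iota> ts bs I"
      "\<Gamma> \<notin> zeros \<iota> ts bs (vanishing_ideal ts bs (zeros to_ac ts bs I))"
    define \<Gamma>' where "\<Gamma>' v = (if v \<in> ?V then \<Gamma> $$ v else 0)" for v
    have \<Gamma>': "meval \<iota> (($$) \<Gamma>) f = meval \<iota> \<Gamma>' f" if "f \<in> carrier (KC ts bs)" for f
      using that by (intro \<iota>.meval_cong) (auto simp: \<Gamma>'_def)
    obtain f where f: "f \<in> vanishing_ideal ts bs (zeros to_ac ts bs I)" "meval \<iota> (($$) \<Gamma>) f \<noteq> 0"
      using \<Gamma> by (auto simp: zeros_def)
    hence fc: "f \<in> carrier (KC ts bs)" by (auto simp: vanishing_ideal_def)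
    obtain \<gamma>' where \<gamma>': "meval to_ac \<gamma>' f \<noteq> 0" "\<And>g. meval \<iota> \<Gamma>' g = 0 \<Longrightarrow> meval to_ac \<gamma>' g = 0"
      using specialization[OF \<iota> field_hom_to_ac, of ?V \<Gamma>' f] f(2) \<Gamma>'[OF fc] by (auto simp: \<Gamma>'_def)
    define \<gamma> where "\<gamma> = mat (length ts) (length bs) \<gamma>'"
    have \<gamma>: "meval to_ac (($$) \<gamma>) g = meval to_ac \<gamma>' g" if "g \<in> carrier (KC ts bs)" for g
      using that by (intro ac.meval_cong) (auto simp: \<gamma>_def)
    have "\<gamma> \<in> zeros to_ac ts bs I"
      using \<Gamma>(1) \<gamma>'(2) \<gamma> \<Gamma>' I by (auto simp: zeros_def \<gamma>_def[symmetric] subset_iff) (simp_all add: \<gamma>_def)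
    hence "meval to_ac (($$) \<gamma>) f = 0" using f(1) by (auto simp: vanishing_ideal_def)
    thus False using \<gamma>[OF fc] \<gamma>'(1) by simp
  qed
qed


section \<open>Terms modulo an ideal\<close>

lemma tdeg_superset: "finite A \<Longrightarrow> keys t \<subseteq> A \<Longrightarrow> tdeg t = (\<Sum>v\<in>A. lookup t v)"
  unfolding tdeg_def by (rule sum.mono_neutral_left) (auto simp: in_keys_iff)

lemma tdeg_add: "tdeg (s + t) = tdeg s + tdeg t"
  by (simp add: tdeg_superset[of "keys s \<union> keys t"] keys_pp_add lookup_add sum.distrib)

lemma tdeg_0 [simp]: "tdeg 0 = 0"
  by (simp add: tdeg_def)

lemma tdeg_single [simp]: "tdeg (Poly_Mapping.single v k) = k"
  by (simp add: tdeg_def)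

lemma tdeg_eq_0_iff: "tdeg t = 0 \<longleftrightarrow> t = 0"
proof
  assume "tdeg t = 0"
  hence "lookup t v = 0" for v by (cases "v \<in> keys t") (auto simp: tdeg_def in_keys_iff)
  thus "t = 0" by (intro poly_mapping_eqI) simp
qed simp

lemma terms_in_0 [simp]: "0 \<in> terms_in n"
  and terms_in_single: "r < n \<Longrightarrow> Poly_Mapping.single r k \<in> terms_in n"
  and terms_in_add: "s + t \<in> terms_in n \<longleftrightarrow> s \<in> terms_in n \<and> t \<in> terms_in n"
  by (auto simp: terms_in_def keys_pp_add)

lemma finite_terms_le: "finite {t \<in> terms_in n. tdeg t \<le> d}"
proof (rule finite_imageD)
  let ?F = "{f. \<forall>x. (x \<in> {..<n} \<longrightarrow> f x \<in> {..d}) \<and> (x \<notin> {..<n} \<longrightarrow> f x = 0)}"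
  have "lookup t v \<le> tdeg t" for t :: "nat pp" and v
    by (cases "v \<in> keys t") (auto simp: tdeg_def in_keys_iff intro: member_le_sum)
  hence "lookup ` {t \<in> terms_in n. tdeg t \<le> d} \<subseteq> ?F"
    by (auto simp: terms_in_def in_keys_iff dest: order_trans)
  thus "finite (lookup ` {t \<in> terms_in n. tdeg t \<le> d})"
    by (rule finite_subset) (intro finite_set_of_finite_funs; simp)
qed (auto simp: inj_on_def)

text \<open>
  The degree-lexicographic order.  Comparing degrees first guarantees that reduction modulo an
  ideal does not raise degrees, which is what links standard terms to the degree filtration.
\<close>

definition tless :: "nat pp \<Rightarrow> nat pp \<Rightarrow> bool" where
  "tless s t \<longleftrightarrow> tdeg s < tdeg t \<or> tdeg s = tdeg t \<and> s < t"

lemma tless_trans: "tless s t \<Longrightarrow> tless t u \<Longrightarrow> tless s u"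
  by (auto simp: tless_def)

lemma tless_irrefl [simp]: "\<not> tless t t"
  by (simp add: tless_def)

lemma tless_total: "s = t \<or> tless s t \<or> tless t s"
  by (auto simp: tless_def)

lemma tless_add: "tless s t \<Longrightarrow> tless (u + s) (u + t)"
  by (auto simp: tless_def tdeg_add)

lemma tless_le_tdeg: "tless s t \<Longrightarrow> tdeg s \<le> tdeg t"
  by (auto simp: tless_def)

lemma tless_max:
  assumes "finite S" "S \<noteq> {}"
  obtains t where "t \<in> S" "\<And>s. s \<in> S \<Longrightarrow> s = t \<or> tless s t"
proof -
  have "\<exists>t\<in>S. \<forall>s\<in>S. s = t \<or> tless s t"
    using assms
  proof (induction S rule: finite_ne_induct)
    case (insert a S)
    then obtain t where t: "t \<in> S" "\<forall>s\<in>S. s = t \<or> tless s t" by blast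
    show ?case
    proof (cases "tless t a")
      case True
      thus ?thesis using t by (intro bexI[of _ a]) (auto intro: tless_trans)
    next
      case False
      thus ?thesis using t tless_total[of a t] by (intro bexI[of _ t]) auto
    qed
  qed auto
  thus ?thesis using that by blast
qed

lemma tless_induct [consumes 1, case_names less]:
  assumes "t \<in> terms_in n"
    and "\<And>t. t \<in> terms_in n \<Longrightarrow> (\<And>s. s \<in> terms_in n \<Longrightarrow> tless s t \<Longrightarrow> P s) \<Longrightarrow> P t"
  shows "P t"
  using assms(1)
proof (induction "card {s \<in> terms_in n. tless s t}" arbitrary: t rule: less_induct)
  case less
  show ?case
  proof (rule assms(2)[OF less.prems])
    fix s assume s: "s \<in> terms_in n" "tless s t"
    have "finite {s \<in> terms_in n. tless s t}"
      by (rule finite_subset[OF _ finite_terms_le[of n "tdeg t"]]) (auto dest: tless_le_tdeg)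
    moreover have "{u \<in> terms_in n. tless u s} \<subset> {u \<in> terms_in n. tless u t}"
    proof
      show "{u \<in> terms_in n. tless u s} \<subseteq> {u \<in> terms_in n. tless u t}"
        using s by (auto intro: tless_trans)
      have "s \<in> {u \<in> terms_in n. tless u t}" "s \<notin> {u \<in> terms_in n. tless u s}" using s by auto
      thus "{u \<in> terms_in n. tless u s} \<noteq> {u \<in> terms_in n. tless u t}" by blast
    qed
    ultimately show "P s" using less.hyps s(1) by (simp add: psubset_card_mono)
  qed
qed

lemma lookup_mconst_mult [simp]: "lookup (mconst c * p) t = c * lookup p t"
  unfolding mconst_def mult_map_scale_conv_mult[symmetric] by (simp add: Poly_Mapping.map.rep_eq when_def)

lemma keys_mconst_mult: "keys (mconst c * p) \<subseteq> keys p"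
  by (auto simp: in_keys_iff)

lemma lookup_mterm: "lookup (mterm t) s = (if s = t then 1 else 0)"
  by (simp add: mterm_def lookup_single when_def)

lemma keys_mterm [simp]: "keys (mterm t :: ('v, 'a::comm_ring_1) mpol) = {t}"
  by (simp add: mterm_def)

lemma indets_mterm: "indets (mterm t :: ('v, 'a::comm_ring_1) mpol) = keys t"
  by (simp add: indets_def)

lemma mterm_add: "mterm (s + t) = mterm s * mterm t"
  by (simp add: mterm_def mult_single)

lemma mterm_0 [simp]: "mterm 0 = 1"
  by (simp add: mterm_def)

lemma mconst_mult: "mconst (c * d) = mconst c * mconst d"
  by (simp add: mconst_def mult_single)

lemma mconst_mterm: "mconst c * mterm t = Poly_Mapping.single t c"
  by (simp add: mconst_def mterm_def mult_single)

lemma carrier_PX: "p \<in> carrier (PX n) \<longleftrightarrow> keys p \<subseteq> terms_in n"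
  by (auto simp: indets_def terms_in_def)

text \<open>
  A linear combination of the terms in \<open>U\<close> is the same as a polynomial whose keys lie in \<open>U\<close>, so
  generation and linear independence of residue classes modulo \<open>I\<close> can be stated without
  mentioning coefficients.
\<close>

definition reduces_to :: "('v, 'a::comm_ring_1) mpol set \<Rightarrow> 'v pp set \<Rightarrow> ('v, 'a) mpol \<Rightarrow> bool" where
  "reduces_to I U p \<longleftrightarrow> (\<exists>q. keys q \<subseteq> U \<and> p - q \<in> I)"

definition indep_mod :: "('v, 'a::comm_ring_1) mpol set \<Rightarrow> 'v pp set \<Rightarrow> bool" where
  "indep_mod I U \<longleftrightarrow> (\<forall>p\<in>I. keys p \<subseteq> U \<longrightarrow> p = 0)"

lemma indep_mod_mono: "indep_mod I V \<Longrightarrow> U \<subseteq> V \<Longrightarrow> indep_mod I U"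
  by (auto simp: indep_mod_def)

lemma reduces_to_mono: "reduces_to I U p \<Longrightarrow> U \<subseteq> V \<Longrightarrow> reduces_to I V p"
  by (auto simp: reduces_to_def)

locale PX_ideal = ideal I "PX n" for n :: nat and I :: "(nat, 'a::field) mpol set"
begin

lemmas I = ideal_polyringD[OF ideal_axioms]

lemma mconst_I: "p \<in> I \<Longrightarrow> mconst c * p \<in> I"
  by (rule I(4)) simp_all

lemma reduces_to_self: "keys p \<subseteq> U \<Longrightarrow> reduces_to I U p"
  unfolding reduces_to_def by (intro exI[of _ p]) (simp add: I)

lemma reduces_to_linear:
  assumes "keys p \<subseteq> V" "\<And>t. t \<in> V \<Longrightarrow> reduces_to I U (mterm t)"
  shows "reduces_to I U p"
proof -
  have "\<forall>t\<in>V. \<exists>q. keys q \<subseteq> U \<and> mterm t - q \<in> I"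
    using assms(2) by (auto simp: reduces_to_def)
  then obtain q where q: "\<And>t. t \<in> V \<Longrightarrow> keys (q t) \<subseteq> U" "\<And>t. t \<in> V \<Longrightarrow> mterm t - q t \<in> I"
    by metis
  let ?q = "\<Sum>t\<in>keys p. mconst (lookup p t) * q t"
  have "keys ?q \<subseteq> U"
    using keys_sum_subset[of "\<lambda>t. mconst (lookup p t) * q t" "keys p"] keys_mconst_mult q(1) assms(1)
    by (fastforce dest!: subsetD)
  moreover have "p - ?q = (\<Sum>t\<in>keys p. mconst (lookup p t) * (mterm t - q t))"
    by (subst (1) sum_single_lookup[of p, symmetric])
      (simp add: right_diff_distrib mconst_mterm sum_subtractf)
  moreover have "\<dots> \<in> I"
    by (rule ideal_sum_in[OF ideal_axioms]) (use q(2) assms(1) mconst_I in auto)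
  ultimately show ?thesis unfolding reduces_to_def by metis
qed

lemma reduces_to_trans:
  assumes "reduces_to I V p" "\<And>t. t \<in> V \<Longrightarrow> reduces_to I U (mterm t)"
  shows "reduces_to I U p"
proof -
  obtain q where q: "keys q \<subseteq> V" "p - q \<in> I" using assms(1) by (auto simp: reduces_to_def)
  obtain q' where q': "keys q' \<subseteq> U" "q - q' \<in> I"
    using reduces_to_linear[OF q(1) assms(2)] by (auto simp: reduces_to_def)
  have "p - q' = (p - q) + (q - q')" by simp
  thus ?thesis using q q' I(3) unfolding reduces_to_def by metis
qed

subsection \<open>The residue class ring\<close>

abbreviation "Q \<equiv> PX n Quot I"
abbreviation "K \<equiv> scalars n I"
abbreviation "cls \<equiv> residue n I"

sublocale hom: ring_hom_ring "PX n" Q cls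
  using rcos_ring_hom_ring by (simp add: residue_def[abs_def])

lemma cls_eq_iff:
  assumes "p \<in> carrier (PX n)" "q \<in> carrier (PX n)"
  shows "cls p = cls q \<longleftrightarrow> p - q \<in> I"
  using quotient_eq_iff_same_a_r_cos[OF ideal_axioms assms] assms
  by (simp add: residue_def a_minus_def)

lemma cls_image_reduce:
  assumes "U \<subseteq> V" "V \<subseteq> terms_in n" "\<And>t. t \<in> V \<Longrightarrow> reduces_to I U (mterm t)"
  shows "cls ` {p. keys p \<subseteq> U} = cls ` {p. keys p \<subseteq> V}"
proof (intro equalityI subsetI)
  fix x assume "x \<in> cls ` {p. keys p \<subseteq> V}"
  then obtain p where p: "keys p \<subseteq> V" "x = cls p" by auto
  obtain q where q: "keys q \<subseteq> U" "p - q \<in> I"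
    using reduces_to_linear[OF p(1) assms(3)] by (auto simp: reduces_to_def)
  hence "cls p = cls q"
    using p assms by (intro cls_eq_iff[THEN iffD2]) (auto simp del: carrier_polyring simp: carrier_PX)
  thus "x \<in> cls ` {p. keys p \<subseteq> U}" using p q by auto
qed (use assms in auto)

lemma filt_eq: "filt n I i = cls ` {p. keys p \<subseteq> {t \<in> terms_in n. tdeg t \<le> i}}"
proof -
  have "mdeg p \<le> i \<longleftrightarrow> (\<forall>t\<in>keys p. tdeg t \<le> i)" for p :: "(nat, 'a) mpol"
    by (auto simp: mdeg_def)
  thus ?thesis by (auto simp: filt_def carrier_PX simp del: carrier_polyring)
qed

lemma carrier_Q: "carrier Q = cls ` {p. keys p \<subseteq> terms_in n}"
proof -
  have "carrier Q = cls ` carrier (PX n)"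
    by (auto simp: FactRing_def A_RCOSETS_def' residue_def)
  thus ?thesis by (auto simp: carrier_PX simp del: carrier_polyring)
qed

text \<open>
  Modulo the unit ideal the scalars do not form a field and the theory of dimensions does not
  apply.  This case is excluded separately.
\<close>

lemma dimension_trivial:
  assumes "hom.S.dimension m k E" "carrier Q = {\<zero>\<^bsub>Q\<^esub>}"
  shows "m = 0 \<and> E = {\<zero>\<^bsub>Q\<^esub>}"
  using assms by (induction rule: hom.S.dimension.induct) auto

lemma Span_PX:
  assumes "set us \<subseteq> terms_in n"
  shows "polyring.Span {..<n} (range mconst) (map mterm us) = {p :: (nat, 'a) mpol. keys p \<subseteq> set us}"
  using assms
proof (induction us)
  case (Cons u us)
  have comb: "{p :: (nat, 'a) mpol. \<exists>c. \<exists>q. keys q \<subseteq> set us \<and> p = mconst c * mterm u + q}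
    = {p. keys p \<subseteq> insert u (set us)}"
  proof (intro equalityI subsetI)
    fix p :: "(nat, 'a) mpol" assume p: "p \<in> {p. keys p \<subseteq> insert u (set us)}"
    let ?q = "p - mconst (lookup p u) * mterm u"
    have "keys ?q \<subseteq> set us"
      using p by (auto simp: in_keys_iff lookup_minus lookup_mterm split: if_splits)
    thus "p \<in> {p. \<exists>c. \<exists>q. keys q \<subseteq> set us \<and> p = mconst c * mterm u + q}"
      by (intro CollectI exI[of _ "lookup p u"] exI[of _ ?q]) simp
  next
    fix p :: "(nat, 'a) mpol" assume "p \<in> {p. \<exists>c. \<exists>q. keys q \<subseteq> set us \<and> p = mconst c * mterm u + q}"
    then obtain c q where "keys q \<subseteq> set us" "p = mconst c * mterm u + q" by blast
    thus "p \<in> {p. keys p \<subseteq> insert u (set us)}"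
      using keys_add[of "mconst c * mterm u" q] keys_mconst_mult[of c "mterm u"] by auto
  qed
  have "polyring.Span {..<n} (range mconst) (map mterm (u # us)) =
      polyring.line_extension {..<n} (range mconst) (mterm u :: (nat, 'a) mpol) {p. keys p \<subseteq> set us}"
    using Cons by simp
  also have "\<dots> = {p. \<exists>c. \<exists>q. keys q \<subseteq> set us \<and> p = mconst c * mterm u + q}"
    by (intro Set.set_eqI) (simp add: polyring.line_extension_mem_iff Bex_def)
  finally show ?case using comb by simp
qed simp

lemma Span_Q:
  assumes "set us \<subseteq> terms_in n"
  shows "hom.S.Span K (map (\<lambda>t. cls (mterm t)) us) = cls ` {p. keys p \<subseteq> set us}"
proof -
  have "hom.S.Span (cls ` range mconst) (map cls (map mterm us)) =
      cls ` polyring.Span {..<n} (range mconst) (map mterm us)"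
    by (rule hom.Span_hom) (use assms in \<open>auto simp: indets_mterm terms_in_def\<close>)
  thus ?thesis by (simp only: Span_PX[OF assms] scalars_def map_map o_def image_image)
qed

end

text \<open>
  Properness makes the residue classes of constants a field, over which dimensions of subspaces of
  the residue class ring are well defined.
\<close>

locale proper_PX_ideal = PX_ideal + assumes proper: "1 \<notin> I"
begin

lemma subfield_K: "subfield K Q"
proof (rule hom.S.subfieldI)
  have K: "K = cls ` range mconst" by (auto simp: scalars_def)
  have "subring (range mconst) (PX n :: (nat, 'a) mpol ring)"
    by (rule polyring.subringI)
      (auto simp: mconst_def single_uminus[symmetric] mult_single single_add[symmetric] indets_def
        simp flip: single_one split: if_splits)
  hence "subring K Q" unfolding K by (rule hom.img_is_subring)
  moreover have mult: "cls (mconst c) \<otimes>\<^bsub>Q\<^esub> cls (mconst d) = cls (mconst (c * d))" for c d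
    using hom.hom_mult[of "mconst c" "mconst d"]
    by (simp add: mconst_mult)
  ultimately show "subcring K Q"
    by (intro hom.S.subcringI) (auto simp: scalars_def mult.commute)
  have one: "cls (mconst 1) = \<one>\<^bsub>Q\<^esub>" using hom.hom_one by (simp add: mconst_def)
  have zero: "cls (mconst 0) = \<zero>\<^bsub>Q\<^esub>" using hom.hom_zero by (simp add: mconst_def)
  have "cls 1 \<noteq> cls 0" using proper by (subst cls_eq_iff) auto
  hence neq: "\<one>\<^bsub>Q\<^esub> \<noteq> \<zero>\<^bsub>Q\<^esub>" using one zero by (simp add: mconst_def)
  show "Units (Q\<lparr>carrier := K\<rparr>) = K - {\<zero>\<^bsub>Q\<^esub>}"
  proof (intro equalityI subsetI)
    fix x assume "x \<in> Units (Q\<lparr>carrier := K\<rparr>)"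
    then obtain c d where x: "x = cls (mconst c)" "cls (mconst (c * d)) = \<one>\<^bsub>Q\<^esub>"
      by (auto simp: Units_def scalars_def mult)
    have "x \<noteq> \<zero>\<^bsub>Q\<^esub>"
    proof
      assume "x = \<zero>\<^bsub>Q\<^esub>"
      hence "cls (mconst (c * d)) = \<zero>\<^bsub>Q\<^esub>"
        using mult[of c d] mult[of 0 d] x(1) zero by simp
      thus False using x(2) neq by simp
    qed
    thus "x \<in> K - {\<zero>\<^bsub>Q\<^esub>}" using x(1) by (auto simp: scalars_def)
  next
    fix x assume "x \<in> K - {\<zero>\<^bsub>Q\<^esub>}"
    then obtain c where c: "x = cls (mconst c)" "c \<noteq> 0" using zero by (auto simp: scalars_def)
    hence "cls (mconst (1 / c)) \<otimes>\<^bsub>Q\<^esub> x = \<one>\<^bsub>Q\<^esub>" "x \<otimes>\<^bsub>Q\<^esub> cls (mconst (1 / c)) = \<one>\<^bsub>Q\<^esub>"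
      by (simp_all add: mult one)
    thus "x \<in> Units (Q\<lparr>carrier := K\<rparr>)" using c by (auto simp: Units_def scalars_def)
  qed
qed

lemma independent_iff:
  assumes "set us \<subseteq> terms_in n" "distinct us"
  shows "hom.S.independent K (map (\<lambda>t. cls (mterm t)) us) \<longleftrightarrow> indep_mod I (set us)"
  using assms
proof (induction us)
  case Nil
  show ?case by (auto simp: indep_mod_def)
next
  case (Cons u us)
  have carr: "cls (mterm u) \<in> carrier Q"
    using Cons.prems by (intro hom.hom_closed) (auto simp: carrier_PX simp del: carrier_polyring)
  have red: "cls (mterm u) \<in> cls ` {p. keys p \<subseteq> set us} \<longleftrightarrow> reduces_to I (set us) (mterm u)"
  proof -
    have "cls (mterm u) = cls p \<longleftrightarrow> mterm u - p \<in> I" if "keys p \<subseteq> set us" for p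
      using that Cons.prems by (intro cls_eq_iff) (auto simp: carrier_PX simp del: carrier_polyring)
    thus ?thesis by (auto simp: reduces_to_def)
  qed
  have "indep_mod I (set (u # us)) \<longleftrightarrow> \<not> reduces_to I (set us) (mterm u) \<and> indep_mod I (set us)"
  proof (intro iffI conjI notI)
    assume ind: "indep_mod I (set (u # us))"
    show "indep_mod I (set us)" by (rule indep_mod_mono[OF ind]) auto
    assume "reduces_to I (set us) (mterm u)"
    then obtain q where q: "keys q \<subseteq> set us" "mterm u - q \<in> I" by (auto simp: reduces_to_def)
    have "keys (mterm u - q) \<subseteq> set (u # us)"
      using q(1) keys_minus_subset[of "mterm u" q] by auto
    hence "mterm u - q = 0" using ind q(2) by (auto simp: indep_mod_def)
    hence "u \<in> keys q" by (metis eq_iff_diff_eq_0 keys_mterm singletonI)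
    thus False using q(1) Cons.prems by auto
  next
    assume *: "\<not> reduces_to I (set us) (mterm u) \<and> indep_mod I (set us)"
    show "indep_mod I (set (u # us))"
      unfolding indep_mod_def
    proof (intro ballI impI)
      fix p assume p: "p \<in> I" "keys p \<subseteq> set (u # us)"
      show "p = 0"
      proof (cases "lookup p u = 0")
        case True
        hence "keys p \<subseteq> set us" using p by (auto simp: in_keys_iff)
        thus ?thesis using p * by (auto simp: indep_mod_def)
      next
        case False
        let ?q = "mterm u - mconst (1 / lookup p u) * p"
        have "keys ?q \<subseteq> set us"
          using p(2) False by (auto simp: in_keys_iff lookup_minus lookup_mterm split: if_splits)
        moreover have "mterm u - ?q \<in> I" using mconst_I[OF p(1)] by simp
        ultimately have "reduces_to I (set us) (mterm u)" unfolding reduces_to_def by blast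
        thus ?thesis using * by simp
      qed
    qed
  qed
  moreover have "hom.S.independent K (map (\<lambda>t. cls (mterm t)) (u # us)) \<longleftrightarrow>
      cls (mterm u) \<notin> hom.S.Span K (map (\<lambda>t. cls (mterm t)) us) \<and>
      hom.S.independent K (map (\<lambda>t. cls (mterm t)) us)"
    unfolding list.map
    using hom.S.independent_backwards(1,2)[of K "cls (mterm u)" "map (\<lambda>t. cls (mterm t)) us"]
      hom.S.independent.li_Cons[OF carr, of K "map (\<lambda>t. cls (mterm t)) us"] by blast
  moreover have "hom.S.Span K (map (\<lambda>t. cls (mterm t)) us) = cls ` {p. keys p \<subseteq> set us}"
    using Cons.prems by (intro Span_Q) auto
  ultimately show ?case using Cons red by auto
qed

lemma dimension_card:
  assumes "finite U" "U \<subseteq> V" "V \<subseteq> terms_in n" "indep_mod I U"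
    "\<And>t. t \<in> V \<Longrightarrow> reduces_to I U (mterm t)"
  shows "hom.S.dimension (card U) K (cls ` {p. keys p \<subseteq> V})"
proof -
  obtain us where us: "set us = U" "distinct us" using finite_distinct_list[OF assms(1)] by blast
  have "hom.S.independent K (map (\<lambda>t. cls (mterm t)) us)"
    using us assms by (subst independent_iff) auto
  from hom.S.dimension_independent[OF this] show ?thesis
    using us assms cls_image_reduce[of U V] by (subst (asm) Span_Q) (auto simp: distinct_card)
qed

lemma card_le_dimension:
  assumes "hom.S.dimension m K (cls ` {p. keys p \<subseteq> V})" "finite U" "U \<subseteq> V" "V \<subseteq> terms_in n"
    "indep_mod I U"
  shows "card U \<le> m"
proof -
  obtain us where us: "set us = U" "distinct us" using finite_distinct_list[OF assms(2)] by blast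
  have "hom.S.independent K (map (\<lambda>t. cls (mterm t)) us)"
    using us assms by (subst independent_iff) auto
  moreover have "set (map (\<lambda>t. cls (mterm t)) us) \<subseteq> cls ` {p. keys p \<subseteq> V}"
    using us assms(3) by auto
  ultimately have "length us \<le> m"
    using hom.S.independent_length_le_dimension[OF subfield_K assms(1)] by fastforce
  thus ?thesis using us by (auto simp: distinct_card)
qed

subsection \<open>Standard terms\<close>

text \<open>
  The terms that are not leading terms of elements of \<open>I\<close>.
\<close>

definition std :: "nat pp set" where
  "std = {t \<in> terms_in n. \<not> reduces_to I {s \<in> terms_in n. tless s t} (mterm t)}"

lemma std_terms_in: "std \<subseteq> terms_in n"
  by (auto simp: std_def)

lemma reduces_to_std:
  assumes "t \<in> terms_in n"
  shows "reduces_to I {s \<in> std. s = t \<or> tless s t} (mterm t)"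
  using assms
proof (induction rule: tless_induct)
  case (less t)
  show ?case
  proof (cases "t \<in> std")
    case True
    thus ?thesis by (intro reduces_to_self) auto
  next
    case False
    hence "reduces_to I {s \<in> terms_in n. tless s t} (mterm t)" using less.hyps by (simp add: std_def)
    thus ?thesis
      by (rule reduces_to_trans)
        (use less.IH in \<open>force intro: reduces_to_mono tless_trans\<close>)
  qed
qed

text \<open>
  A nonzero element of \<open>I\<close> supported on standard terms would reduce its own leading term.
\<close>

lemma indep_mod_std: "indep_mod I std"
  unfolding indep_mod_def
proof (intro ballI impI, rule ccontr)
  fix p assume p: "p \<in> I" "keys p \<subseteq> std" "p \<noteq> 0"
  then obtain t where t: "t \<in> keys p" "\<And>s. s \<in> keys p \<Longrightarrow> s = t \<or> tless s t"
    using tless_max[of "keys p"] by auto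
  let ?q = "mterm t - mconst (1 / lookup p t) * p"
  have "keys ?q \<subseteq> {s \<in> terms_in n. tless s t}"
  proof
    fix s assume s: "s \<in> keys ?q"
    hence "s \<noteq> t" using t(1) by (auto simp: in_keys_iff lookup_minus lookup_mterm)
    moreover from this s have "s \<in> keys p" by (auto simp: in_keys_iff lookup_minus lookup_mterm)
    ultimately show "s \<in> {s \<in> terms_in n. tless s t}" using t(2) p(2) std_terms_in by auto
  qed
  moreover have "mterm t - ?q \<in> I" using mconst_I[OF p(1)] by simp
  ultimately have "reduces_to I {s \<in> terms_in n. tless s t} (mterm t)" unfolding reduces_to_def by blast
  thus False using t(1) p(2) by (auto simp: std_def)
qed

lemma std_divisor:
  assumes "s \<in> terms_in n" "u \<in> terms_in n" "s + u \<in> std"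
  shows "s \<in> std"
proof (rule ccontr)
  assume "s \<notin> std"
  then obtain q where q: "keys q \<subseteq> {v \<in> terms_in n. tless v s}" "mterm s - q \<in> I"
    using assms(1) by (auto simp: std_def reduces_to_def)
  have "mterm u * (mterm s - q) \<in> I"
    using q(2) assms(2) by (intro I(4)) (auto simp flip: carrier_polyring simp: carrier_PX)
  hence "mterm (s + u) - mterm u * q \<in> I"
    by (simp add: mterm_add right_diff_distrib mult.commute)
  moreover have "keys (mterm u * q) \<subseteq> {v \<in> terms_in n. tless v (s + u)}"
    using keys_mult[of "mterm u" q] q(1) assms(2) tless_add[of _ s u]
    by (fastforce simp: terms_in_add add.commute[of s])
  ultimately have "reduces_to I {v \<in> terms_in n. tless v (s + u)} (mterm (s + u))"
    unfolding reduces_to_def by blast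
  thus False using assms(3) by (simp add: std_def)
qed

text \<open>
  The reduction of a term only involves standard terms of at most the same degree.
\<close>

lemma dimension_filt_std:
  "hom.S.dimension (card {t \<in> std. tdeg t \<le> i}) K (filt n I i)"
  unfolding filt_eq
proof (rule dimension_card)
  show "finite {t \<in> std. tdeg t \<le> i}"
    by (rule finite_subset[OF _ finite_terms_le[of n i]]) (use std_terms_in in auto)
  show "indep_mod I {t \<in> std. tdeg t \<le> i}" by (rule indep_mod_mono[OF indep_mod_std]) auto
  show "reduces_to I {t \<in> std. tdeg t \<le> i} (mterm t)" if "t \<in> {t \<in> terms_in n. tdeg t \<le> i}" for t
    by (rule reduces_to_mono[OF reduces_to_std]) (use that tless_le_tdeg in fastforce)+
qed (use std_terms_in in auto)

lemma dim_eq: "hom.S.dimension m K E \<Longrightarrow> hom.S.dim K E = m"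
  using hom.S.dimI[OF subfield_K] by (simp add: over_def)

lemma aff_HF_std: "aff_HF n I i = card {t \<in> std. tdeg t \<le> i}"
  unfolding aff_HF_def by (rule dim_eq[OF dimension_filt_std])

lemma dimension_filt: "hom.S.dimension (aff_HF n I i) K (filt n I i)"
  unfolding aff_HF_std by (rule dimension_filt_std)

lemma card_le_aff_HF:
  assumes "U \<subseteq> {t \<in> terms_in n. tdeg t \<le> i}" "indep_mod I U"
  shows "card U \<le> aff_HF n I i"
  by (rule card_le_dimension[OF dimension_filt[unfolded filt_eq]])
    (use assms finite_subset[OF _ finite_terms_le] in auto)

lemma card_std:
  assumes "hom.S.dimension \<mu> K (carrier Q)"
  shows "finite std" "card std = \<mu>"
proof -
  note dim = assms[unfolded carrier_Q]
  show fin: "finite std"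
  proof (rule ccontr)
    assume "infinite std"
    then obtain U where U: "finite U" "card U = Suc \<mu>" "U \<subseteq> std"
      using infinite_arbitrarily_large by blast
    hence "card U \<le> \<mu>"
      by (intro card_le_dimension[OF dim]) (use std_terms_in indep_mod_mono[OF indep_mod_std] in auto)
    thus False using U by simp
  qed
  have "hom.S.dimension (card std) K (cls ` {p. keys p \<subseteq> terms_in n})"
    by (rule dimension_card[OF fin std_terms_in _ indep_mod_std])
      (auto intro: reduces_to_mono[OF reduces_to_std])
  from hom.S.dimension_is_inj[OF subfield_K this dim] show "card std = \<mu>" .
qed

text \<open>
  Macaulay's basis theorem: the affine Hilbert function of a 0-dimensional scheme is that of an
  order ideal whose elements represent a basis of the coordinate ring.
\<close>

theorem order_ideal_std:
  assumes "hom.S.dimension \<mu> K (carrier Q)"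
  shows "order_ideal n std" "ord_HF std = aff_HF n I" "card std = \<mu>"
proof -
  have "0 \<in> std"
  proof -
    have empty: "{s \<in> terms_in n. tless s 0} = {}" by (auto simp: tless_def tdeg_eq_0_iff)
    have "\<not> reduces_to I {} (mterm 0)" using proper by (auto simp: reduces_to_def)
    thus ?thesis unfolding std_def mem_Collect_eq empty by simp
  qed
  thus "order_ideal n std"
    using card_std[OF assms] std_terms_in std_divisor unfolding order_ideal_def by blast
  show "ord_HF std = aff_HF n I" by (auto simp: ord_HF_def aff_HF_std)
  show "card std = \<mu>" by (rule card_std[OF assms])
qed

lemma has_df_border_basis_iff:
  assumes "set ts \<subseteq> terms_in n" "distinct ts"
  shows "has_df_border_basis n ts I \<longleftrightarrow>
    (\<forall>i. indep_mod I {t \<in> set ts. tdeg t \<le> i} \<and>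
      cls ` {p. keys p \<subseteq> {t \<in> set ts. tdeg t \<le> i}} = filt n I i)"
proof -
  have us: "set (filter (\<lambda>t. tdeg t \<le> i) ts) \<subseteq> terms_in n" "distinct (filter (\<lambda>t. tdeg t \<le> i) ts)" for i
    using assms by auto
  have "hom.S.independent K (map (\<lambda>t. cls (mterm t)) (filter (\<lambda>t. tdeg t \<le> i) ts)) \<longleftrightarrow>
      indep_mod I {t \<in> set ts. tdeg t \<le> i}"
    and "hom.S.Span K (map (\<lambda>t. cls (mterm t)) (filter (\<lambda>t. tdeg t \<le> i) ts)) =
      cls ` {p. keys p \<subseteq> {t \<in> set ts. tdeg t \<le> i}}" for i
    by (simp_all only: independent_iff[OF us] Span_Q[OF us(1)] set_filter)
  thus ?thesis by (simp only: has_df_border_basis_def Let_def)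
qed

text \<open>
  Equality of Hilbert functions upgrades a basis to one compatible with the filtration: in each
  degree the available independent elements are already as many as the dimension.
\<close>

lemma df_border_basisI:
  assumes ts: "set ts \<subseteq> terms_in n" "distinct ts" and "indep_mod I (set ts)"
    and HF: "ord_HF (set ts) = aff_HF n I"
  shows "has_df_border_basis n ts I"
  unfolding has_df_border_basis_iff[OF ts]
proof (intro allI conjI)
  fix i
  show ind: "indep_mod I {t \<in> set ts. tdeg t \<le> i}"
    by (rule indep_mod_mono[OF assms(3)]) auto
  let ?us = "filter (\<lambda>t. tdeg t \<le> i) ts"
  let ?vs = "map (\<lambda>t. cls (mterm t)) ?us"
  have us: "set ?us = {t \<in> set ts. tdeg t \<le> i}" "distinct ?us" "set ?us \<subseteq> terms_in n"
    using ts by auto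
  have "length ?vs = card (set ?us)" using us(2) by (metis distinct_card length_map)
  hence "length ?vs = aff_HF n I i" using HF us(1) by (auto simp: ord_HF_def fun_eq_iff)
  moreover have "set ?vs \<subseteq> filt n I i"
    unfolding filt_eq using ts by auto
  moreover have "hom.S.independent K ?vs"
    unfolding independent_iff[OF us(3,2)] us(1) by (rule ind)
  ultimately have "hom.S.Span K ?vs = filt n I i"
    using hom.S.independent_length_eq_dimension[OF subfield_K dimension_filt] by blast
  thus "cls ` {p. keys p \<subseteq> {t \<in> set ts. tdeg t \<le> i}} = filt n I i"
    using Span_Q[OF us(3)] us(1) by simp
qed

lemma df_border_basisD:
  assumes ts: "set ts \<subseteq> terms_in n" "distinct ts" and "has_df_border_basis n ts I" "t \<in> terms_in n"
  shows "reduces_to I {s \<in> set ts. tdeg s \<le> tdeg t} (mterm t)"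
proof -
  have "cls (mterm t) \<in> filt n I (tdeg t)" unfolding filt_eq using assms(4) by auto
  then obtain p where p: "keys p \<subseteq> {s \<in> set ts. tdeg s \<le> tdeg t}" "cls (mterm t) = cls p"
    using assms(3) unfolding has_df_border_basis_iff[OF ts] by blast
  hence "mterm t - p \<in> I"
    using p assms by (intro cls_eq_iff[THEN iffD1]) (auto simp del: carrier_polyring simp: carrier_PX)
  thus ?thesis using p(1) by (auto simp: reduces_to_def)
qed

end


section \<open>Points of the border basis scheme\<close>

\<comment> \<open>The exponent vector of an indeterminate is written with the exponent \<open>1\<close> throughout.\<close>
declare One_nat_def [simp del]

lemma mult_mat_vec_index:
  assumes "A \<in> carrier_mat nr nc" "v \<in> carrier_vec nc" "i < nr"
  shows "(A *\<^sub>v v) $ i = (\<Sum>j<nc. A $$ (i, j) * v $ j)"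
  using assms by (auto simp: scalar_prod_def atLeast0LessThan intro!: sum.cong)

lemma mult_unit_vec:
  assumes "(A :: 'a::comm_ring_1 mat) \<in> carrier_mat nr nc" "j < nc"
  shows "A *\<^sub>v unit_vec nc j = col A j"
proof (rule eq_vecI)
  fix i assume "i < dim_vec (col A j)"
  hence i: "i < nr" using assms by auto
  have "(A *\<^sub>v unit_vec nc j) $ i = (\<Sum>k<nc. A $$ (i, k) * unit_vec nc j $ k)"
    by (rule mult_mat_vec_index[OF assms(1) _ i]) simp
  also have "\<dots> = (\<Sum>k<nc. if k = j then A $$ (i, k) else 0)"
    by (intro sum.cong) (use assms(2) in auto)
  also have "\<dots> = col A j $ i" using assms i by (simp add: sum.delta)
  finally show "(A *\<^sub>v unit_vec nc j) $ i = col A j $ i" .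
qed (use assms in auto)

lemma pow_mat_commute:
  assumes "A \<in> carrier_mat m m" "B \<in> carrier_mat m m" "A * B = B * A"
  shows "A * B ^\<^sub>m k = B ^\<^sub>m k * A"
proof (induction k)
  case 0
  show ?case using assms by simp
next
  case (Suc k)
  have "A * B ^\<^sub>m Suc k = (A * B ^\<^sub>m k) * B"
    using assms by (simp add: assoc_mult_mat[of _ m m _ m _ m])
  also have "\<dots> = B ^\<^sub>m k * (A * B)"
    unfolding Suc using assms by (simp add: assoc_mult_mat[of _ m m _ m _ m])
  also have "\<dots> = B ^\<^sub>m Suc k * A"
    unfolding assms(3) using assms by (simp add: assoc_mult_mat[of _ m m _ m _ m])
  finally show ?case .
qed

text \<open>
  Stated for arbitrary matrices, so that it covers both \<open>term_mat\<close> and its specialization at a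
  point.
\<close>

definition term_value :: "nat \<Rightarrow> nat list \<Rightarrow> (nat \<Rightarrow> 'a::comm_ring_1 mat) \<Rightarrow> nat pp \<Rightarrow> 'a mat" where
  "term_value m rs M t = foldr (\<lambda>r A. (M r ^\<^sub>m lookup t r) * A) rs (1\<^sub>m m)"

lemma term_value_carrier:
  "(\<And>r. r \<in> set rs \<Longrightarrow> M r \<in> carrier_mat m m) \<Longrightarrow> term_value m rs M t \<in> carrier_mat m m"
  unfolding term_value_def by (induction rs) (auto intro!: mult_carrier_mat[of _ m m _ m])

lemma term_value_0:
  "(\<And>r. r \<in> set rs \<Longrightarrow> M r \<in> carrier_mat m m) \<Longrightarrow> term_value m rs M 0 = 1\<^sub>m m"
  unfolding term_value_def
proof (induction rs)
  case (Cons r rs)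
  hence "dim_row (M r) = m" by auto
  thus ?case using Cons by simp
qed simp

text \<open>
  Commutativity lets the additional factor be moved to the front.  The case distinction is needed
  for the induction on the list of indices.
\<close>

lemma term_value_single_add:
  assumes "\<And>r. r \<in> set rs \<Longrightarrow> M r \<in> carrier_mat m m"
    and "\<And>s. s \<in> set rs \<Longrightarrow> M r * M s = M s * M r" and "distinct rs" "M r \<in> carrier_mat m m"
  shows "term_value m rs M (Poly_Mapping.single r 1 + t) =
    (if r \<in> set rs then M r * term_value m rs M t else term_value m rs M t)"
  using assms
proof (induction rs)
  case Nil
  show ?case by (simp add: term_value_def)
next
  case (Cons s rs)
  let ?A = "term_value m rs M t"
  have A: "?A \<in> carrier_mat m m" by (rule term_value_carrier) (use Cons.prems in auto)
  have step: "term_value m (s # rs) M u = M s ^\<^sub>m lookup u s * term_value m rs M u" for u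
    by (simp add: term_value_def)
  have IH: "term_value m rs M (Poly_Mapping.single r 1 + t) =
      (if r \<in> set rs then M r * ?A else ?A)"
    using Cons by simp
  have Ms: "M s \<in> carrier_mat m m" and com: "M r * M s ^\<^sub>m k = M s ^\<^sub>m k * M r" for k
    using Cons.prems pow_mat_commute[of "M r" m "M s" k] by auto
  show ?case
  proof (cases "r = s")
    case True
    hence "r \<notin> set rs" using Cons.prems by auto
    hence "term_value m (s # rs) M (Poly_Mapping.single r 1 + t) = M s ^\<^sub>m Suc (lookup t s) * ?A"
      unfolding step IH using True by (simp add: lookup_add plus_1_eq_Suc)
    also have "\<dots> = (M r * M s ^\<^sub>m lookup t s) * ?A"
      unfolding com using True by simp
    also have "\<dots> = M r * (M s ^\<^sub>m lookup t s * ?A)"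
      using Cons.prems(4) Ms A by (intro assoc_mult_mat[of _ m m _ m _ m]) auto
    finally show ?thesis unfolding step[of t] using True by simp
  next
    case False
    hence l: "lookup (Poly_Mapping.single r 1 + t) s = lookup t s"
      by (simp add: lookup_add lookup_single)
    have "M s ^\<^sub>m k * (M r * ?A) = M r * (M s ^\<^sub>m k * ?A)" for k
    proof -
      have "M s ^\<^sub>m k * (M r * ?A) = (M s ^\<^sub>m k * M r) * ?A"
        using Cons.prems(4) Ms A by (intro assoc_mult_mat[of _ m m _ m _ m, symmetric]) auto
      also have "\<dots> = M r * (M s ^\<^sub>m k * ?A)"
        unfolding com[symmetric] using Cons.prems(4) Ms A
        by (intro assoc_mult_mat[of _ m m _ m _ m]) auto
      finally show ?thesis .
    qed
    thus ?thesis unfolding step IH l using False by auto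
  qed
qed

lemma terms_in_decompose:
  assumes "u \<in> terms_in n" "u \<noteq> 0"
  obtains r u' where "r < n" "u' \<in> terms_in n" "u = Poly_Mapping.single r 1 + u'"
proof -
  have "keys u \<noteq> {}" using assms(2) by simp
  then obtain r where r: "r \<in> keys u" by blast
  have "u = Poly_Mapping.single r 1 + (u - Poly_Mapping.single r 1)"
    using r by (intro poly_mapping_eqI) (auto simp: lookup_add lookup_minus lookup_single when_def in_keys_iff)
  moreover from this have "u - Poly_Mapping.single r 1 \<in> terms_in n" "r < n"
    using assms(1) r terms_in_add by (metis, auto simp: terms_in_def)
  ultimately show ?thesis using that by blast
qed

lemma terms_in_induct [consumes 1, case_names zero step]:
  assumes "u \<in> terms_in n" "P 0"
    and "\<And>r u. r < n \<Longrightarrow> u \<in> terms_in n \<Longrightarrow> P u \<Longrightarrow> P (Poly_Mapping.single r 1 + u)"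
  shows "P u"
  using assms(1)
proof (induction "tdeg u" arbitrary: u)
  case 0
  thus ?case using assms(2) by (simp add: tdeg_eq_0_iff)
next
  case (Suc d)
  hence "u \<noteq> 0" by auto
  with Suc.prems obtain r u' where u: "r < n" "u' \<in> terms_in n" "u = Poly_Mapping.single r 1 + u'"
    by (rule terms_in_decompose)
  moreover have "d = tdeg u'" using Suc.hyps(2) u by (simp add: tdeg_add)
  ultimately show ?case using Suc.hyps(1) assms(3) by auto
qed

locale border_frame =
  fixes n :: nat and ts bs :: "nat pp list"
  assumes oi: "order_ideal n (set ts)" and distinct_ts: "distinct ts"
    and sorted_ts: "sorted (map tdeg ts)"
    and distinct_bs: "distinct bs" and set_bs: "set bs = border n (set ts)"
begin

abbreviation "\<mu> \<equiv> length ts"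

lemma ts_terms: "set ts \<subseteq> terms_in n"
  using oi by (simp add: order_ideal_def)

lemma divisor_in_ts: "s \<in> terms_in n \<Longrightarrow> u \<in> terms_in n \<Longrightarrow> s + u \<in> set ts \<Longrightarrow> s \<in> set ts"
  using oi by (auto simp: order_ideal_def)

lemma mu_pos: "\<mu> > 0"
  using oi by (auto simp: order_ideal_def)

lemma ts_0: "ts ! 0 = 0"
proof -
  obtain t where "t \<in> set ts" using mu_pos by (meson length_pos_if_in_set nth_mem)
  hence "0 \<in> set ts" using divisor_in_ts[of 0 t] ts_terms by auto
  then obtain j where j: "j < \<mu>" "ts ! j = 0" by (metis in_set_conv_nth)
  have "tdeg (ts ! 0) \<le> tdeg (ts ! j)"
    using sorted_nth_mono[OF sorted_ts, of 0 j] j mu_pos by simp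
  thus ?thesis using j by (simp add: tdeg_eq_0_iff)
qed

lemma bs_terms: "set bs \<subseteq> terms_in n"
  using ts_terms by (auto simp: set_bs border_def terms_in_add terms_in_single)

lemma border_step:
  "r < n \<Longrightarrow> t \<in> set ts \<Longrightarrow> Poly_Mapping.single r 1 + t \<in> set ts \<union> set bs"
  by (auto simp: set_bs border_def)

lemma the_border_index: "m < length bs \<Longrightarrow> (THE l. l < length bs \<and> bs ! l = bs ! m) = m"
  using distinct_bs by (auto simp: nth_eq_iff_index_eq)

lemma ts_decompose:
  assumes "j < \<mu>" "ts ! j \<noteq> 0"
  obtains r k where "r < n" "k < \<mu>" "ts ! j = Poly_Mapping.single r 1 + ts ! k"
proof -
  have "ts ! j \<in> terms_in n" using assms(1) ts_terms by auto
  then obtain r u where u: "r < n" "u \<in> terms_in n" "ts ! j = Poly_Mapping.single r 1 + u"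
    using assms(2) by (rule terms_in_decompose)
  hence "u \<in> set ts"
    using assms(1) by (intro divisor_in_ts[of u "Poly_Mapping.single r 1"])
      (auto simp: add.commute terms_in_single dest: nth_mem)
  thus ?thesis using u that by (metis in_set_conv_nth)
qed

lemma bs_decompose:
  assumes "m < length bs"
  obtains r k where "r < n" "k < \<mu>" "bs ! m = Poly_Mapping.single r 1 + ts ! k"
proof -
  have "bs ! m \<in> border n (set ts)" using nth_mem[OF assms] unfolding set_bs .
  then obtain r t where rt: "r < n" "t \<in> set ts" "bs ! m = Poly_Mapping.single r 1 + t"
    unfolding border_def by blast
  then obtain k where "k < \<mu>" "t = ts ! k" by (auto simp: in_set_conv_nth)
  thus ?thesis using that rt by blast
qed

lemma bs_not_ts: "m < length bs \<Longrightarrow> bs ! m \<notin> set ts"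
  using set_bs nth_mem[of m bs] by (auto simp: border_def)

end

text \<open>
  The specialization of \<open>gen_mult_mat\<close> at the point \<open>\<Gamma>\<close>, written out so that the points can be
  studied over their own field, without reference to a base field.
\<close>

definition point_mat :: "nat pp list \<Rightarrow> nat pp list \<Rightarrow> 'l::field mat \<Rightarrow> nat \<Rightarrow> 'l mat" where
  "point_mat ts bs \<Gamma> r = mat (length ts) (length ts) (\<lambda>(i, j).
     let u = Poly_Mapping.single r 1 + ts ! j in
     if u \<in> set ts then (if ts ! i = u then 1 else 0)
     else \<Gamma> $$ (i, THE m. m < length bs \<and> bs ! m = u))"

lemma point_mat_carrier [simp]: "point_mat ts bs \<Gamma> r \<in> carrier_mat (length ts) (length ts)"
  by (simp add: point_mat_def)

locale border_point = border_frame n ts bs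
  for n :: nat and ts bs :: "nat pp list" +
  fixes \<Gamma> :: "'l::field mat"
  assumes \<Gamma>: "\<Gamma> \<in> carrier_mat (length ts) (length bs)"
    and commuting: "r < n \<Longrightarrow> s < n \<Longrightarrow>
      point_mat ts bs \<Gamma> r * point_mat ts bs \<Gamma> s = point_mat ts bs \<Gamma> s * point_mat ts bs \<Gamma> r"
begin

abbreviation "M \<equiv> point_mat ts bs \<Gamma>"

text \<open>
  The coordinate vector of the residue class of the term \<open>u\<close>: the class of \<open>u\<close> arises from that of
  \<open>1\<close>, the first basis element, by multiplication with \<open>u\<close>.
\<close>

definition phi :: "nat pp \<Rightarrow> 'l vec" where
  "phi u = col (term_value \<mu> [0..<n] M u) 0"

lemma phi_carrier [simp]: "phi u \<in> carrier_vec \<mu>"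
  unfolding phi_def using term_value_carrier[of "[0..<n]" M \<mu> u] by (intro col_carrier_vec) (use mu_pos in auto)

lemma dim_phi [simp]: "dim_vec (phi u) = \<mu>"
  using phi_carrier carrier_vecD by blast

lemma phi_0: "phi 0 = unit_vec \<mu> 0"
  unfolding phi_def using mu_pos by (subst term_value_0) auto

lemma phi_step: "r < n \<Longrightarrow> phi (Poly_Mapping.single r 1 + u) = M r *\<^sub>v phi u"
  unfolding phi_def using term_value_carrier[of "[0..<n]" M \<mu> u] mu_pos
  by (subst term_value_single_add) (auto simp: commuting intro!: col_mult2[of _ \<mu> \<mu> _ \<mu>])

lemma phi_step_index:
  "r < n \<Longrightarrow> i < \<mu> \<Longrightarrow> phi (Poly_Mapping.single r 1 + u) $ i = (\<Sum>j<\<mu>. M r $$ (i, j) * phi u $ j)"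
  by (simp add: phi_step mult_mat_vec_index[of _ \<mu> \<mu>] del: index_mult_mat_vec)

text \<open>
  Each \<open>t\<^sub>j \<noteq> 1\<close> is an indeterminate times some \<open>t\<^sub>k\<close> of smaller degree, and the corresponding
  column of the multiplication matrix is a unit vector.
\<close>

lemma phi_ts: "j < \<mu> \<Longrightarrow> phi (ts ! j) = unit_vec \<mu> j"
proof (induction "tdeg (ts ! j)" arbitrary: j)
  case 0
  hence "ts ! j = ts ! 0" by (simp add: ts_0 tdeg_eq_0_iff)
  hence "j = 0" using 0 distinct_ts mu_pos by (simp add: nth_eq_iff_index_eq)
  thus ?case by (simp add: ts_0 phi_0)
next
  case (Suc d)
  hence "ts ! j \<noteq> 0" by auto
  then obtain r k where rk: "r < n" "k < \<mu>" "ts ! j = Poly_Mapping.single r 1 + ts ! k"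
    using ts_decompose[OF Suc.prems] by blast
  have "d = tdeg (ts ! k)" using Suc.hyps(2) rk by (simp add: tdeg_add)
  hence "phi (ts ! k) = unit_vec \<mu> k" using Suc.hyps(1) rk(2) by blast
  hence "phi (ts ! j) = col (M r) k"
    using rk by (simp add: phi_step mult_unit_vec[of _ \<mu> \<mu>])
  also have "\<dots> = unit_vec \<mu> j"
  proof (rule eq_vecI)
    fix i assume "i < dim_vec (unit_vec \<mu> j :: 'l vec)"
    thus "col (M r) k $ i = unit_vec \<mu> j $ i"
      using rk(2) Suc.prems distinct_ts
      by (simp add: point_mat_def Let_def rk(3)[symmetric] nth_eq_iff_index_eq)
  qed (simp add: point_mat_def)
  finally show ?case .
qed

lemma phi_bs:
  assumes "m < length bs"
  shows "phi (bs ! m) = col \<Gamma> m"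
proof -
  obtain r k where rk: "r < n" "k < \<mu>" "bs ! m = Poly_Mapping.single r 1 + ts ! k"
    using bs_decompose[OF assms] .
  hence "phi (bs ! m) = col (M r) k"
    by (simp add: phi_step phi_ts mult_unit_vec[of _ \<mu> \<mu>])
  also have "\<dots> = col \<Gamma> m"
  proof (rule eq_vecI)
    fix i assume "i < dim_vec (col \<Gamma> m)"
    hence "i < \<mu>" using \<Gamma> by simp
    thus "col (M r) k $ i = col \<Gamma> m $ i"
      using rk(2) bs_not_ts[OF assms] assms the_border_index[OF assms] \<Gamma>
      by (simp add: point_mat_def Let_def rk(3)[symmetric])
  qed (use \<Gamma> in \<open>simp add: point_mat_def\<close>)
  finally show ?thesis .
qed

abbreviation coord :: "nat \<Rightarrow> (nat, 'l) mpol \<Rightarrow> 'l" where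
  "coord i \<equiv> lin (\<lambda>u. phi u $ i)"

text \<open>
  The kernel of the coordinate map.  It is an ideal because multiplication by an indeterminate acts
  on coordinate vectors through a matrix.
\<close>

definition ker :: "(nat, 'l) mpol set" where
  "ker = {p \<in> carrier (PX n). \<forall>i<\<mu>. coord i p = 0}"

lemma lin_mterm: "lin f (mterm t) = f t"
  and lin_mconst_mterm: "lin f (mconst c * mterm t) = c * f t"
  by (simp_all add: mconst_mterm) (simp add: mterm_def)

lemma lin_single_mult: "lin f (Poly_Mapping.single s c * p) = c * lin (\<lambda>u. f (s + u)) p"
  for f :: "nat pp \<Rightarrow> 'l"
proof -
  have "Poly_Mapping.single s c * p =
      (\<Sum>t\<in>keys p. Poly_Mapping.single (s + t) (c * lookup p t))"
    by (subst (1) sum_single_lookup[of p, symmetric]) (simp add: sum_distrib_left mult_single)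
  thus ?thesis by (simp add: lin_sum lin_def[of _ p] sum_distrib_left mult.assoc)
qed

lemma coord_shift:
  assumes "\<And>i. i < \<mu> \<Longrightarrow> coord i p = 0" "s \<in> terms_in n" "i < \<mu>"
  shows "lin (\<lambda>u. phi (s + u) $ i) p = 0"
  using assms(2,3)
proof (induction s arbitrary: i rule: terms_in_induct)
  case zero
  thus ?case using assms(1) by simp
next
  case (step r s)
  have "lin (\<lambda>u. phi (Poly_Mapping.single r 1 + s + u) $ i) p =
      (\<Sum>t\<in>keys p. lookup p t * (\<Sum>j<\<mu>. M r $$ (i, j) * phi (s + t) $ j))"
    using step by (simp add: lin_def add.assoc phi_step_index)
  also have "\<dots> = (\<Sum>j<\<mu>. M r $$ (i, j) * lin (\<lambda>u. phi (s + u) $ j) p)"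
    unfolding lin_def sum_distrib_left by (subst sum.swap) (simp add: mult_ac)
  also have "\<dots> = 0" using step by simp
  finally show ?case .
qed

lemma ideal_ker: "ideal ker (PX n)"
proof (rule ideal_polyringI)
  fix p q :: "(nat, 'l) mpol" assume p: "indets p \<subseteq> {..<n}" and q: "q \<in> ker"
  have "coord i (p * q) = 0" if "i < \<mu>" for i
  proof -
    have "p * q = (\<Sum>s\<in>keys p. Poly_Mapping.single s (lookup p s) * q)"
      by (subst (1) sum_single_lookup[of p, symmetric]) (simp add: sum_distrib_right)
    hence "coord i (p * q) = (\<Sum>s\<in>keys p. lookup p s * lin (\<lambda>u. phi (s + u) $ i) q)"
      by (simp add: lin_sum lin_single_mult)
    also have "\<dots> = 0"
    proof (intro sum.neutral ballI)
      fix s assume "s \<in> keys p"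
      hence "s \<in> terms_in n" using p by (auto simp: indets_def terms_in_def)
      thus "lookup p s * lin (\<lambda>u. phi (s + u) $ i) q = 0"
        using coord_shift[of q s i] q that by (simp add: ker_def)
    qed
    finally show ?thesis .
  qed
  thus "p * q \<in> ker" using p q indets_mult[of p q] by (auto simp: ker_def)
qed (auto simp: ker_def lin_add dest!: indets_add[THEN subsetD])

abbreviation "gen j \<equiv> mterm (bs ! j) - (\<Sum>i<\<mu>. mconst (\<Gamma> $$ (i, j)) * mterm (ts ! i))"

abbreviation "I \<equiv> scheme_ideal n ts bs \<Gamma>"

lemma coord_gen: "coord i (gen j) = phi (bs ! j) $ i - (\<Sum>k<\<mu>. \<Gamma> $$ (k, j) * phi (ts ! k) $ i)"
  by (simp add: lin_minus lin_sum lin_mterm lin_mconst_mterm)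

lemma gen_carrier:
  assumes "j < length bs"
  shows "gen j \<in> carrier (PX n)"
proof -
  have "indets (mterm (bs ! j) :: (nat, 'l) mpol) \<subseteq> {..<n}"
    using bs_terms assms by (fastforce simp: indets_mterm terms_in_def dest: nth_mem)
  moreover have "indets (mterm (ts ! i) :: (nat, 'l) mpol) \<subseteq> {..<n}" if "i < \<mu>" for i
    using ts_terms that by (fastforce simp: indets_mterm terms_in_def dest: nth_mem)
  ultimately show ?thesis
    unfolding carrier_polyring by (intro indets_minusI indets_sum indets_multI) auto
qed

lemma gens_carrier: "{gen j | j. j < length bs} \<subseteq> carrier (PX n)"
  using gen_carrier by auto

lemma ideal_I: "ideal I (PX n)"
  unfolding scheme_ideal_def by (rule polyring.genideal_ideal[OF gens_carrier])

lemma gen_in_I: "j < length bs \<Longrightarrow> gen j \<in> I"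
  unfolding scheme_ideal_def using polyring.genideal_self[OF gens_carrier] by blast

lemma I_subset_ker: "I \<subseteq> ker"
  unfolding scheme_ideal_def
proof (rule polyring.genideal_minimal[OF ideal_ker])
  have "coord i (gen j) = 0" if "i < \<mu>" "j < length bs" for i j
  proof -
    have "(\<Sum>k<\<mu>. \<Gamma> $$ (k, j) * phi (ts ! k) $ i) = (\<Sum>k<\<mu>. if k = i then \<Gamma> $$ (k, j) else 0)"
      using that by (intro sum.cong) (auto simp: phi_ts)
    thus ?thesis using that \<Gamma> by (simp add: coord_gen phi_bs)
  qed
  thus "{gen j | j. j < length bs} \<subseteq> ker" using gen_carrier by (auto simp: ker_def)
qed

end

sublocale border_point \<subseteq> PX_ideal n "scheme_ideal n ts bs \<Gamma>"
  unfolding PX_ideal_def by (rule ideal_I)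

context border_point
begin

lemma reduces_to_ts_bs:
  assumes "u \<in> set ts \<union> set bs"
  shows "reduces_to I (set ts) (mterm u)"
proof (cases "u \<in> set ts")
  case False
  then obtain j where j: "j < length bs" "u = bs ! j" using assms by (auto simp: in_set_conv_nth)
  have "keys (\<Sum>i<\<mu>. mconst (\<Gamma> $$ (i, j)) * mterm (ts ! i)) \<subseteq> set ts"
    using keys_sum_subset[of "\<lambda>i. mconst (\<Gamma> $$ (i, j)) * mterm (ts ! i)" "{..<\<mu>}"]
      keys_mconst_mult[of _ "mterm _ :: (nat, 'l) mpol"] by fastforce
  thus ?thesis using gen_in_I[OF j(1)] j(2) unfolding reduces_to_def by blast
qed (auto intro: reduces_to_self)

text \<open>
  Multiplying a reduced polynomial by an indeterminate yields terms in the order ideal or in its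
  border, and border terms are reduced by the generators of the ideal.
\<close>

lemma reduces_to_ts:
  assumes "u \<in> terms_in n"
  shows "reduces_to I (set ts) (mterm u)"
  using assms
proof (induction u rule: terms_in_induct)
  case zero
  have "0 \<in> set ts" using ts_0 mu_pos by (metis nth_mem)
  thus ?case by (intro reduces_to_self) simp
next
  case (step r u)
  then obtain q where q: "keys q \<subseteq> set ts" "mterm u - q \<in> I" by (auto simp: reduces_to_def)
  let ?x = "mterm (Poly_Mapping.single r 1) :: (nat, 'l) mpol"
  have "?x * (mterm u - q) \<in> I"
    using q(2) step by (intro I(4)) (auto simp: indets_mterm)
  hence "mterm (Poly_Mapping.single r 1 + u) - ?x * q \<in> I"
    by (simp add: mterm_add right_diff_distrib)
  moreover have "keys (?x * q) \<subseteq> set ts \<union> set bs"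
    using keys_mult[of ?x q] q(1) border_step[OF step(1)] by fastforce
  ultimately have "reduces_to I (set ts \<union> set bs) (mterm (Poly_Mapping.single r 1 + u))"
    unfolding reduces_to_def by blast
  thus ?case by (rule reduces_to_trans) (rule reduces_to_ts_bs)
qed

lemma coord_ts:
  assumes "keys q \<subseteq> set ts" "i < \<mu>"
  shows "coord i q = lookup q (ts ! i)"
proof -
  have "coord i q = (\<Sum>t\<in>set ts. lookup q t * phi t $ i)"
    by (rule lin_superset) (use assms in auto)
  also have "\<dots> = (\<Sum>j<\<mu>. lookup q (ts ! j) * phi (ts ! j) $ i)"
    by (rule sum.reindex_bij_betw[symmetric]) (rule bij_betw_nth[OF distinct_ts], auto)
  also have "\<dots> = (\<Sum>j<\<mu>. if j = i then lookup q (ts ! j) else 0)"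
    using assms(2) by (intro sum.cong) (auto simp: phi_ts)
  finally show ?thesis using assms(2) by simp
qed

lemma indep_mod_ker_ts:
  assumes "keys q \<subseteq> set ts" "\<And>i. i < \<mu> \<Longrightarrow> coord i q = 0"
  shows "q = 0"
proof (rule poly_mapping_eqI)
  fix t
  show "lookup q t = lookup 0 t"
  proof (cases "t \<in> set ts")
    case True
    then obtain i where "i < \<mu>" "t = ts ! i" by (auto simp: in_set_conv_nth)
    thus ?thesis using assms coord_ts[of q i] by simp
  next
    case False
    thus ?thesis using assms(1) by (auto simp: in_keys_iff)
  qed
qed

text \<open>
  The border basis theorem: every polynomial reduces to a combination of \<open>ts\<close>, on which the
  coordinate map is injective, so the generators of \<open>I\<close> generate the whole kernel.
\<close>

theorem scheme_ideal_iff: "p \<in> I \<longleftrightarrow> p \<in> carrier (PX n) \<and> (\<forall>i<\<mu>. coord i p = 0)"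
proof
  assume p: "p \<in> carrier (PX n) \<and> (\<forall>i<\<mu>. coord i p = 0)"
  hence "keys p \<subseteq> terms_in n" by (simp add: carrier_PX del: carrier_polyring)
  from reduces_to_linear[OF this reduces_to_ts]
  obtain q where q: "keys q \<subseteq> set ts" "p - q \<in> I" by (auto simp: reduces_to_def)
  have "coord i q = 0" if "i < \<mu>" for i
    using q(2) I_subset_ker p that by (auto simp: ker_def lin_minus subset_iff)
  hence "q = 0" by (rule indep_mod_ker_ts[OF q(1)])
  thus "p \<in> I" using q(2) by simp
qed (use I_subset_ker in \<open>auto simp: ker_def\<close>)

lemma indep_mod_ts: "indep_mod I (set ts)"
  unfolding indep_mod_def using indep_mod_ker_ts scheme_ideal_iff by blast

lemma one_notin_I: "1 \<notin> I"
proof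
  assume "1 \<in> I"
  hence "coord 0 1 = 0" using scheme_ideal_iff mu_pos by blast
  moreover have "coord 0 1 = phi 0 $ 0" using lin_single[of "\<lambda>u. phi u $ 0" 0 1] by simp
  ultimately show False using mu_pos by (simp add: phi_0)
qed

end

sublocale border_point \<subseteq> proper_PX_ideal n "scheme_ideal n ts bs \<Gamma>"
  by unfold_locales (rule one_notin_I)

context border_point
begin

lemma dimension_carrier: "hom.S.dimension \<mu> K (carrier Q)"
  using dimension_card[OF _ ts_terms _ indep_mod_ts reduces_to_ts] distinct_ts
  by (simp add: distinct_card carrier_Q)

lemma indep_mod_iff_mat:
  assumes us: "set us \<subseteq> terms_in n" "distinct us"
  shows "indep_mod I (set us) \<longleftrightarrow>
    (\<forall>v\<in>carrier_vec (length us). mat_of_cols \<mu> (map phi us) *\<^sub>v v = 0\<^sub>v \<mu> \<longrightarrow> v = 0\<^sub>v (length us))"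
    (is "_ \<longleftrightarrow> (\<forall>v\<in>?C. ?T *\<^sub>v v = _ \<longrightarrow> _)")
proof -
  have T: "?T \<in> carrier_mat \<mu> (length us)" using mat_of_cols_carrier(1)[of \<mu> "map phi us"] by simp
  have bij: "bij_betw ((!) us) {..<length us} (set us)" using us(2) by (rule bij_betw_nth) auto
  have coord: "coord i p = (?T *\<^sub>v v) $ i"
    if "keys p \<subseteq> set us" "v \<in> ?C" "\<And>j. j < length us \<Longrightarrow> (v :: 'l vec) $ j = lookup p (us ! j)" "i < \<mu>" for p i and v :: "'l vec"
  proof -
    have "coord i p = (\<Sum>t\<in>set us. lookup p t * phi t $ i)"
      by (rule lin_superset) (use that in auto)
    also have "\<dots> = (\<Sum>j<length us. lookup p (us ! j) * phi (us ! j) $ i)"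
      by (rule sum.reindex_bij_betw[OF bij, symmetric])
    also have "\<dots> = (\<Sum>j<length us. ?T $$ (i, j) * v $ j)"
      using that by (intro sum.cong) (auto simp: mat_of_cols_index)
    also have "\<dots> = (?T *\<^sub>v v) $ i"
      by (rule mult_mat_vec_index[symmetric]) (use T that in auto)
    finally show ?thesis .
  qed
  show ?thesis
  proof (intro iffI ballI impI)
    fix v assume ind: "indep_mod I (set us)" and v: "v \<in> ?C" "?T *\<^sub>v v = 0\<^sub>v \<mu>"
    define p where "p = (\<Sum>j<length us. Poly_Mapping.single (us ! j) (v $ j))"
    have keys: "keys p \<subseteq> set us"
      using keys_sum_subset[of "\<lambda>j. Poly_Mapping.single (us ! j) (v $ j)" "{..<length us}"]
      by (fastforce simp: p_def split: if_splits)
    have lookup: "v $ j = lookup p (us ! j)" if "j < length us" for j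
    proof -
      have "lookup p (us ! j) = (\<Sum>k<length us. if k = j then v $ k else 0)"
        unfolding p_def lookup_sum
        using that us(2) by (intro sum.cong) (auto simp: lookup_single nth_eq_iff_index_eq when_def)
      thus ?thesis using that by simp
    qed
    have "p \<in> I"
      unfolding scheme_ideal_iff
      using coord[OF keys v(1) lookup] v(2) keys us(1)
      by (auto simp: carrier_PX simp del: carrier_polyring)
    hence "p = 0" using ind keys by (simp add: indep_mod_def)
    thus "v = 0\<^sub>v (length us)" using lookup v(1) by (intro eq_vecI) auto
  next
    assume T0: "\<forall>v\<in>?C. ?T *\<^sub>v v = 0\<^sub>v \<mu> \<longrightarrow> v = 0\<^sub>v (length us)"
    show "indep_mod I (set us)"
      unfolding indep_mod_def
    proof (intro ballI impI)
      fix p assume p: "p \<in> I" "keys p \<subseteq> set us"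
      define v where "v = vec (length us) (\<lambda>j. lookup p (us ! j))"
      have "?T *\<^sub>v v = 0\<^sub>v \<mu>"
      proof (rule eq_vecI)
        fix i assume "i < dim_vec (0\<^sub>v \<mu> :: 'l vec)"
        thus "(?T *\<^sub>v v) $ i = 0\<^sub>v \<mu> $ i"
          using coord[OF p(2), of v i] p(1) scheme_ideal_iff by (simp add: v_def)
      qed (use T in simp)
      hence "v = 0\<^sub>v (length us)" using T0 by (simp add: v_def)
      hence "lookup p (us ! j) = 0" if "j < length us" for j
        using that by (metis index_vec index_zero_vec(1) v_def)
      hence "t \<notin> keys p" if "t \<in> set us" for t
        using that by (auto simp: in_set_conv_nth in_keys_iff)
      hence "keys p = {}" using p(2) by blast
      thus "p = 0" by simp
    qed
  qed
qed

lemma indep_mod_iff_det: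
  assumes "set us \<subseteq> terms_in n" "distinct us" "length us = \<mu>"
  shows "indep_mod I (set us) \<longleftrightarrow> det (mat_of_cols \<mu> (map phi us)) \<noteq> 0"
proof -
  have T: "mat_of_cols \<mu> (map phi us) \<in> carrier_mat \<mu> \<mu>"
    using mat_of_cols_carrier(1)[of \<mu> "map phi us"] assms(3) by simp
  show ?thesis
    unfolding indep_mod_iff_mat[OF assms(1,2)] assms(3) det_0_iff_vec_prod_zero[OF T] by blast
qed

text \<open>
  If \<open>T\<close> is the matrix of the change of basis, the multiplication matrices with respect to \<open>ts'\<close> are
  the conjugates under \<open>T\<close> of those with respect to \<open>ts\<close>, so they commute as well.  The ideal of
  the new point is contained in \<open>I\<close>, and both have the classes of \<open>ts'\<close> as a basis.
\<close>

lemma change_of_order_ideal: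
  assumes frame': "border_frame n ts' bs'" and len: "length ts' = \<mu>"
    and \<Gamma>': "\<Gamma>' \<in> carrier_mat (length ts') (length bs')"
    and det: "det (mat_of_cols \<mu> (map phi ts')) \<noteq> 0"
    and coords: "\<And>l. l < length bs' \<Longrightarrow> mat_of_cols \<mu> (map phi ts') *\<^sub>v col \<Gamma>' l = phi (bs' ! l)"
  shows "border_point n ts' bs' \<Gamma>'" "scheme_ideal n ts' bs' \<Gamma>' = I"
proof -
  interpret B: border_frame n ts' bs' by (rule frame')
  define T where "T = mat_of_cols \<mu> (map phi ts')"
  define M' where "M' = point_mat ts' bs' \<Gamma>'"
  have T: "T \<in> carrier_mat \<mu> \<mu>"
    using mat_of_cols_carrier(1)[of \<mu> "map phi ts'"] len by (simp add: T_def)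
  have M': "M' r \<in> carrier_mat \<mu> \<mu>" for r using point_mat_carrier[of ts' bs' \<Gamma>' r] len by (simp add: M'_def)
  have M: "M r \<in> carrier_mat \<mu> \<mu>" for r by simp
  have colT: "col T j = phi (ts' ! j)" if "j < \<mu>" for j
    unfolding T_def using that len by (subst col_mat_of_cols) auto
  have conj: "T * M' r = M r * T" if r: "r < n" for r
  proof (rule mat_col_eqI)
    fix j assume "j < dim_col (M r * T)"
    hence j: "j < \<mu>" using T by simp
    let ?u = "Poly_Mapping.single r 1 + ts' ! j"
    have "T *\<^sub>v col (M' r) j = phi ?u"
    proof (cases "?u \<in> set ts'")
      case True
      then obtain m where m: "m < \<mu>" "?u = ts' ! m" by (auto simp: in_set_conv_nth len)
      have "col (M' r) j = unit_vec \<mu> m"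
        using True j m B.distinct_ts len
        by (intro eq_vecI) (auto simp: M'_def point_mat_def Let_def m(2) nth_eq_iff_index_eq)
      thus ?thesis using m T colT by (simp add: mult_unit_vec[of _ \<mu> \<mu>])
    next
      case False
      moreover have "?u \<in> set ts' \<union> set bs'" by (rule B.border_step[OF r]) (simp add: j len)
      ultimately obtain m where m: "m < length bs'" "?u = bs' ! m" by (metis Un_iff in_set_conv_nth)
      have "col (M' r) j = col \<Gamma>' m"
        using False j m B.the_border_index[OF m(1)] \<Gamma>' len
        by (intro eq_vecI) (auto simp: M'_def point_mat_def Let_def m(2))
      thus ?thesis using coords[OF m(1)] m(2) by (simp add: T_def)
    qed
    also have "\<dots> = M r *\<^sub>v col T j" using r j colT by (simp add: phi_step)
    finally show "col (T * M' r) j = col (M r * T) j"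
      using j T M' M by (simp add: col_mult2[of _ \<mu> \<mu> _ \<mu>])
  qed (use T M' carrier_matD[OF M] in auto)
  have cancel: "A = B" if "A \<in> carrier_mat \<mu> \<mu>" "B \<in> carrier_mat \<mu> \<mu>" "T * A = T * B" for A B
  proof -
    have "det T \<cdot>\<^sub>m Z = adj_mat T * (T * Z)" if "Z \<in> carrier_mat \<mu> \<mu>" for Z
      using adj_mat[OF T] that T
      by (subst assoc_mult_mat[of _ \<mu> \<mu> _ \<mu> _ \<mu>, symmetric]) (auto simp: mult_smult_assoc_mat[of _ \<mu> \<mu> _ \<mu>])
    hence "det T \<cdot>\<^sub>m A = det T \<cdot>\<^sub>m B" using that by simp
    hence "det T * A $$ (i, j) = det T * B $$ (i, j)" if "i < \<mu>" "j < \<mu>" for i j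
      using \<open>A \<in> _\<close> \<open>B \<in> _\<close> that by (metis carrier_matD index_smult_mat(1))
    thus ?thesis using det that(1,2) by (intro eq_matI) (auto simp: T_def)
  qed
  show point': "border_point n ts' bs' \<Gamma>'"
  proof unfold_locales
    fix r s assume rs: "r < n" "s < n"
    have prod: "T * (M' a * M' b) = M a * M b * T" if "a < n" "b < n" for a b
    proof -
      have "T * (M' a * M' b) = T * M' a * M' b"
        using T M' by (simp add: assoc_mult_mat[of _ \<mu> \<mu> _ \<mu> _ \<mu>])
      also have "\<dots> = M a * (T * M' b)"
        unfolding conj[OF that(1)] using T M' M by (intro assoc_mult_mat[of _ \<mu> \<mu> _ \<mu> _ \<mu>]) auto
      also have "\<dots> = M a * M b * T"
        unfolding conj[OF that(2)] using T M by (simp add: assoc_mult_mat[of _ \<mu> \<mu> _ \<mu> _ \<mu>])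
      finally show ?thesis .
    qed
    have "M' r * M' s = M' s * M' r"
      by (rule cancel)
        (use M' prod[OF rs] prod[OF rs(2,1)] commuting[OF rs] in \<open>auto intro!: mult_carrier_mat[of _ \<mu> \<mu>]\<close>)
    thus "point_mat ts' bs' \<Gamma>' r * point_mat ts' bs' \<Gamma>' s =
        point_mat ts' bs' \<Gamma>' s * point_mat ts' bs' \<Gamma>' r" by (simp add: M'_def)
  qed (rule \<Gamma>')
  interpret P: border_point n ts' bs' \<Gamma>' by (rule point')
  have sub: "P.I \<subseteq> I"
    unfolding scheme_ideal_def[of n ts' bs' \<Gamma>']
  proof (rule polyring.genideal_minimal[OF ideal_I])
    have "coord i (P.gen l) = 0" if l: "l < length bs'" and i: "i < \<mu>" for l i
    proof -
      have "coord i (P.gen l) = phi (bs' ! l) $ i - (\<Sum>k<\<mu>. \<Gamma>' $$ (k, l) * phi (ts' ! k) $ i)"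
        using len by (simp add: lin_minus lin_sum lin_mterm lin_mconst_mterm)
      also have "(\<Sum>k<\<mu>. \<Gamma>' $$ (k, l) * phi (ts' ! k) $ i) = (\<Sum>k<\<mu>. T $$ (i, k) * col \<Gamma>' l $ k)"
        using i l len \<Gamma>' by (intro sum.cong) (auto simp: T_def mat_of_cols_index)
      also have "\<dots> = (T *\<^sub>v col \<Gamma>' l) $ i"
        using i l len \<Gamma>' T by (intro mult_mat_vec_index[symmetric]) auto
      also have "\<dots> = phi (bs' ! l) $ i" using coords[OF l] by (simp add: T_def)
      finally show ?thesis by simp
    qed
    thus "{P.gen j | j. j < length bs'} \<subseteq> I" using P.gen_carrier by (auto simp: scheme_ideal_iff)
  qed
  have ind: "indep_mod I (set ts')"
    using indep_mod_iff_det[OF B.ts_terms B.distinct_ts len] det by simp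
  show "P.I = I"
  proof (intro equalityI sub subsetI)
    fix p assume p: "p \<in> I"
    hence "keys p \<subseteq> terms_in n" using scheme_ideal_iff by (simp add: carrier_PX del: carrier_polyring)
    from P.reduces_to_linear[OF this P.reduces_to_ts]
    obtain q where q: "keys q \<subseteq> set ts'" "p - q \<in> P.I" by (auto simp: reduces_to_def)
    have "p - (p - q) \<in> I" using p q(2) sub I(6)[of p "p - q"] by auto
    hence "q = 0" using ind q(1) by (simp add: indep_mod_def)
    thus "p \<in> P.I" using q(2) by simp
  qed
qed

text \<open>
  In a degree filtered basis a border term only involves basis elements of at most its own degree.
  Thus the points with such a basis lie in the subscheme defined by \<open>df_ideal\<close>.
\<close>

lemma df_border_basis_coeff:
  assumes "has_df_border_basis n ts I" "i < \<mu>" "j < length bs" "tdeg (ts ! i) > tdeg (bs ! j)"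
  shows "\<Gamma> $$ (i, j) = 0"
proof -
  have "bs ! j \<in> terms_in n" using bs_terms assms(3) by auto
  from df_border_basisD[OF ts_terms distinct_ts assms(1) this]
  obtain q where q: "keys q \<subseteq> {s \<in> set ts. tdeg s \<le> tdeg (bs ! j)}" "mterm (bs ! j) - q \<in> I"
    by (auto simp: reduces_to_def)
  have "coord i (mterm (bs ! j) - q) = 0" using q(2) assms(2) scheme_ideal_iff by blast
  moreover have "coord i q = lookup q (ts ! i)" using q(1) assms(2) by (intro coord_ts) auto
  moreover have "lookup q (ts ! i) = 0" using q(1) assms(4) by (auto simp: in_keys_iff)
  ultimately show ?thesis
    using \<Gamma> assms(2,3) by (simp add: lin_minus lin_mterm phi_bs)
qed

end


section \<open>Minors and linear independence\<close>

lemma mat_delete_last: "A \<in> carrier_mat (Suc d) (Suc d) \<Longrightarrow> k < Suc d \<Longrightarrow> p < d \<Longrightarrow> q < d \<Longrightarrow>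
    mat_delete A d k $$ (p, q) = A $$ (p, if q < k then q else Suc q)"
  by (auto simp: mat_delete_def)

text \<open>
  Induction on the number of columns.  If no row completes a nonzero minor of the first \<open>d\<close> columns,
  then expanding along the additional row shows that the cofactors, which do not depend on this row,
  form a linear relation between the columns; its last coefficient is the given nonzero minor.
\<close>

lemma exists_nonzero_minor_rows:
  fixes a :: "nat \<Rightarrow> nat \<Rightarrow> 'a::field"
  assumes "\<And>c. (\<forall>i<m. (\<Sum>k<d. a i k * c k) = 0) \<Longrightarrow> (\<forall>k<d. c k = 0)"
  shows "\<exists>r. (\<forall>k<d. r k < m) \<and> det (mat d d (\<lambda>(p, k). a (r p) k)) \<noteq> 0"
  using assms
proof (induction d)
  case 0
  show ?case by simp
next
  case (Suc d)
  have "\<forall>k<d. c k = 0" if "\<forall>i<m. (\<Sum>k<d. a i k * c k) = 0" for c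
    using Suc.prems[of "\<lambda>k. if k < d then c k else 0"] that by (auto simp: less_Suc_eq)
  then obtain r where r: "\<forall>k<d. r k < m" "det (mat d d (\<lambda>(p, k). a (r p) k)) \<noteq> 0"
    using Suc.IH by blast
  define B where "B i = mat (Suc d) (Suc d) (\<lambda>(p, k). a ((r(d := i)) p) k)" for i
  have B: "B i \<in> carrier_mat (Suc d) (Suc d)" for i by (simp add: B_def)
  define c where "c k = cofactor (B 0) d k" for k
  have del: "mat_delete (B i) d k $$ (p, q) = a (r p) (if q < k then q else Suc q)"
    if "k < Suc d" "p < d" "q < d" for i k p q
    unfolding mat_delete_last[OF B that] using that by (auto simp: B_def)
  have dim: "dim_row (mat_delete (B i) d k) = d" "dim_col (mat_delete (B i) d k) = d" for i k
    using B[of i] by auto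
  have eq: "mat_delete (B i) d k = mat_delete (B 0) d k" if "k < Suc d" for i k
    by (rule eq_matI, unfold dim) (simp_all add: del[OF that])
  have cof: "cofactor (B i) d k = c k" if "k < Suc d" for i k
    unfolding cofactor_def c_def eq[OF that, of i] ..
  have det_B: "det (B i) = (\<Sum>k<Suc d. a i k * c k)" for i
  proof -
    have "B i $$ (d, k) = a i k" if "k < Suc d" for k using that by (simp add: B_def)
    thus ?thesis unfolding laplace_expansion_row[OF B lessI, of i] by (simp add: cof)
  qed
  have "mat_delete (B 0) d d = mat d d (\<lambda>(p, k). a (r p) k)"
    by (rule eq_matI, unfold dim) (simp_all add: dim del del: mat_delete_dim)
  hence cd: "c d \<noteq> 0" using r(2) by (simp add: c_def cofactor_def)
  have "\<exists>i<m. det (B i) \<noteq> 0"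
  proof (rule ccontr)
    assume "\<not> (\<exists>i<m. det (B i) \<noteq> 0)"
    hence "\<forall>i<m. (\<Sum>k<Suc d. a i k * c k) = 0" unfolding det_B by blast
    from Suc.prems[OF this] cd show False by blast
  qed
  then obtain i where i: "i < m" "det (B i) \<noteq> 0" by blast
  show ?case
    using r(1) i by (intro exI[of _ "r(d := i)"]) (auto simp: B_def less_Suc_eq)
qed

lemma submatrix_rows_index:
  assumes "B \<in> carrier_mat m d" "I \<subseteq> {..<m}" "card I = d"
  shows "submatrix B I UNIV \<in> carrier_mat d d"
    and "p < d \<Longrightarrow> k < d \<Longrightarrow> submatrix B I UNIV $$ (p, k) = B $$ (pick I p, k)"
proof -
  have "{i. i < m \<and> i \<in> I} = I" using assms by auto
  thus "submatrix B I UNIV \<in> carrier_mat d d"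
    "p < d \<Longrightarrow> k < d \<Longrightarrow> submatrix B I UNIV $$ (p, k) = B $$ (pick I p, k)"
    using assms by (auto simp: submatrix_def pick_UNIV)
qed

lemma bij_betw_pick: "finite I \<Longrightarrow> bij_betw (pick I) {..<card I} I"
proof -
  assume fin: "finite I"
  have inj: "inj_on (pick I) {..<card I}"
    by (rule linorder_inj_onI) (auto dest: pick_mono_le)
  have "pick I ` {..<card I} \<subseteq> I" by (auto intro: pick_in_set_le)
  moreover have "card (pick I ` {..<card I}) = card I" using inj by (simp add: card_image)
  ultimately have "pick I ` {..<card I} = I" using fin by (simp add: card_subset_eq)
  thus ?thesis using inj by (simp add: bij_betw_def)
qed

text \<open>
  The previous lemma provides the rows in some order, but \<open>submatrix\<close> lists them increasingly.
  Comparing kernels instead of determinants avoids the sign of the permutation.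
\<close>

lemma injective_iff_nonzero_minor:
  fixes B :: "'a::field mat"
  assumes B: "B \<in> carrier_mat m d"
  shows "(\<forall>v\<in>carrier_vec d. B *\<^sub>v v = 0\<^sub>v m \<longrightarrow> v = 0\<^sub>v d) \<longleftrightarrow>
    (\<exists>I\<subseteq>{..<m}. card I = d \<and> det (submatrix B I UNIV) \<noteq> 0)"
proof (intro iffI ballI impI)
  fix v assume "\<exists>I\<subseteq>{..<m}. card I = d \<and> det (submatrix B I UNIV) \<noteq> 0"
    and v: "v \<in> carrier_vec d" "B *\<^sub>v v = 0\<^sub>v m"
  then obtain I where I: "I \<subseteq> {..<m}" "card I = d" "det (submatrix B I UNIV) \<noteq> 0" by blast
  let ?S = "submatrix B I UNIV"
  note S = submatrix_rows_index[OF B I(1,2)]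
  have fin: "finite I" using I(1) finite_subset by blast
  have "?S *\<^sub>v v = 0\<^sub>v d"
  proof (rule eq_vecI)
    fix p assume "p < dim_vec (0\<^sub>v d :: 'a vec)"
    hence p: "p < d" by simp
    hence pk: "pick I p < m" using bij_betw_pick[OF fin] I by (auto simp: bij_betw_def)
    have "(?S *\<^sub>v v) $ p = (B *\<^sub>v v) $ pick I p"
      using p pk by (simp add: mult_mat_vec_index[OF S(1) v(1)] mult_mat_vec_index[OF B v(1)] S(2)
          del: index_mult_mat_vec)
    thus "(?S *\<^sub>v v) $ p = 0\<^sub>v d $ p" using p pk v(2) by simp
  qed (use S(1) in simp)
  thus "v = 0\<^sub>v d" using I(3) det_0_iff_vec_prod_zero[OF S(1)] v(1) by blast
next
  assume inj: "\<forall>v\<in>carrier_vec d. B *\<^sub>v v = 0\<^sub>v m \<longrightarrow> v = 0\<^sub>v d"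
  have "\<forall>k<d. c k = 0" if c: "\<forall>i<m. (\<Sum>k<d. B $$ (i, k) * c k) = 0" for c
  proof -
    have "B *\<^sub>v vec d c = 0\<^sub>v m"
    proof (rule eq_vecI)
      fix i assume "i < dim_vec (0\<^sub>v m :: 'a vec)"
      thus "(B *\<^sub>v vec d c) $ i = 0\<^sub>v m $ i"
        using c by (subst mult_mat_vec_index[OF B]) auto
    qed (use B in simp)
    hence "vec d c = 0\<^sub>v d" using inj by simp
    thus ?thesis by (metis index_vec index_zero_vec(1))
  qed
  then obtain r where r: "\<forall>k<d. r k < m" "det (mat d d (\<lambda>(p, k). B $$ (r p, k))) \<noteq> 0"
    using exists_nonzero_minor_rows[where m = m and d = d and a = "\<lambda>i k. B $$ (i, k)"] by blast
  let ?R = "mat d d (\<lambda>(p, k). B $$ (r p, k))"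
  have R: "?R \<in> carrier_mat d d" by simp
  have "inj_on r {..<d}"
  proof (rule inj_onI, rule ccontr)
    fix p q assume pq: "p \<in> {..<d}" "q \<in> {..<d}" "r p = r q" "p \<noteq> q"
    hence "row ?R p = row ?R q" by (intro eq_vecI) auto
    thus False using det_identical_rows[OF R pq(4)] pq r(2) by auto
  qed
  hence card: "card (r ` {..<d}) = d" by (simp add: card_image)
  have sub: "r ` {..<d} \<subseteq> {..<m}" using r(1) by auto
  note S = submatrix_rows_index[OF B sub card]
  have "v = 0\<^sub>v d" if v: "v \<in> carrier_vec d" "submatrix B (r ` {..<d}) UNIV *\<^sub>v v = 0\<^sub>v d" for v
  proof -
    have "?R *\<^sub>v v = 0\<^sub>v d"
    proof (rule eq_vecI)
      fix p assume "p < dim_vec (0\<^sub>v d :: 'a vec)"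
      hence p: "p < d" by simp
      have "r p \<in> pick (r ` {..<d}) ` {..<d}"
        using bij_betw_pick[of "r ` {..<d}"] card p by (auto simp: bij_betw_def)
      then obtain q where q: "q < d" "r p = pick (r ` {..<d}) q" by auto
      have "(?R *\<^sub>v v) $ p = (submatrix B (r ` {..<d}) UNIV *\<^sub>v v) $ q"
        using p q by (simp add: mult_mat_vec_index[OF R v(1)] mult_mat_vec_index[OF S(1) v(1)] S(2)
            del: index_mult_mat_vec)
      thus "(?R *\<^sub>v v) $ p = 0\<^sub>v d $ p" using p q v(2) by simp
    qed simp
    thus ?thesis using det_0_iff_vec_prod_zero[OF R] r(2) v(1) by blast
  qed
  hence "det (submatrix B (r ` {..<d}) UNIV) \<noteq> 0"
    using det_0_iff_vec_prod_zero[OF S(1)] by blast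
  thus "\<exists>I\<subseteq>{..<m}. card I = d \<and> det (submatrix B I UNIV) \<noteq> 0" using sub card by blast
qed

section \<open>Hilbert function strata\<close>

context border_point
begin

text \<open>
  A nonvanishing minor provides independent classes of terms of degree at most \<open>i\<close>; conversely the
  standard terms of degree at most \<open>i\<close> are independent and thus have a nonvanishing minor.
\<close>

theorem aff_HF_le_iff_minors:
  fixes i g :: nat
  defines "ws \<equiv> sorted_list_of_set {u \<in> terms_in n. tdeg u \<le> i}"
  shows "aff_HF n I i \<le> g \<longleftrightarrow>
    (\<forall>f\<in>minors (g + 1) (mat_of_cols \<mu> (map phi ws)). f = 0)"
proof -
  have ws: "set ws = {u \<in> terms_in n. tdeg u \<le> i}" "distinct ws"
    using finite_terms_le by (auto simp: ws_def)
  let ?A = "mat_of_cols \<mu> (map phi ws)"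
  have dim_A: "dim_row ?A = \<mu>" "dim_col ?A = length ws" by simp_all
  have crit: "indep_mod I ((!) ws ` J) \<longleftrightarrow>
      (\<exists>R\<subseteq>{..<\<mu>}. card R = card J \<and> det (submatrix ?A R J) \<noteq> 0)" if J: "J \<subseteq> {..<length ws}" for J
  proof -
    have fin: "finite J" using J finite_subset by blast
    define us where "us = map (\<lambda>k. ws ! pick J k) [0..<card J]"
    have pick_lt: "pick J k < length ws" if "k < card J" for k
      using pick_in_set_le[OF that] J by auto
    have "set us = (!) ws ` (pick J ` {..<card J})"
      by (simp add: us_def atLeast0LessThan image_image)
    hence set_us: "set us = (!) ws ` J"
      using bij_betw_pick[OF fin] by (simp add: bij_betw_def)
    have "inj_on (\<lambda>k. ws ! pick J k) {..<card J}"
      using bij_betw_pick[OF fin] pick_lt ws(2)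
      by (auto simp: bij_betw_def inj_on_def nth_eq_iff_index_eq)
    hence dist: "distinct us" by (simp add: us_def distinct_map atLeast0LessThan)
    have len: "length us = card J" by (simp add: us_def)
    have sub: "set us \<subseteq> terms_in n" using set_us J ws(1) nth_mem by fastforce
    have J': "{j. j < length ws \<and> j \<in> J} = J" using J by auto
    have cols: "mat_of_cols \<mu> (map phi us) = submatrix ?A UNIV J"
      using pick_lt by (intro eq_matI)
        (auto simp: submatrix_def J' us_def mat_of_cols_index pick_UNIV)
    have "mat_of_cols \<mu> (map phi us) \<in> carrier_mat \<mu> (card J)"
      using mat_of_cols_carrier(1)[of \<mu> "map phi us"] len by simp
    from injective_iff_nonzero_minor[OF this] show ?thesis
      unfolding set_us[symmetric] indep_mod_iff_mat[OF sub dist] len cols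
      by (simp flip: submatrix_split)
  qed
  show ?thesis
  proof
    assume le: "aff_HF n I i \<le> g"
    show "\<forall>f\<in>minors (g + 1) ?A. f = 0"
    proof (intro ballI, rule ccontr)
      fix f assume "f \<in> minors (g + 1) ?A" "f \<noteq> 0"
      then obtain R J where RJ: "R \<subseteq> {..<\<mu>}" "J \<subseteq> {..<length ws}" "card R = g + 1" "card J = g + 1"
          "det (submatrix ?A R J) \<noteq> 0"
        by (auto simp: minors_def)
      hence "indep_mod I ((!) ws ` J)" using crit[OF RJ(2)] by auto
      moreover have "(!) ws ` J \<subseteq> {u \<in> terms_in n. tdeg u \<le> i}" using RJ(2) ws(1) nth_mem by blast
      ultimately have "card ((!) ws ` J) \<le> aff_HF n I i" by (intro card_le_aff_HF)
      moreover have "inj_on ((!) ws) J"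
        using RJ(2) ws(2) by (intro inj_on_nth) auto
      ultimately show False using le RJ(4) by (simp add: card_image)
    qed
  next
    assume zero: "\<forall>f\<in>minors (g + 1) ?A. f = 0"
    show "aff_HF n I i \<le> g"
    proof (rule ccontr)
      assume "\<not> aff_HF n I i \<le> g"
      hence "g + 1 \<le> card {t \<in> std. tdeg t \<le> i}" by (simp add: aff_HF_std)
      then obtain U where U: "U \<subseteq> {t \<in> std. tdeg t \<le> i}" "card U = g + 1"
        by (rule obtain_subset_with_card_n)
      define J where "J = {j. j < length ws \<and> ws ! j \<in> U}"
      have J: "J \<subseteq> {..<length ws}" by (auto simp: J_def)
      have "U \<subseteq> set ws" using U(1) std_terms_in ws(1) by auto
      hence UJ: "(!) ws ` J = U" by (fastforce simp: J_def in_set_conv_nth)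
      moreover have "inj_on ((!) ws) J"
        using J ws(2) by (intro inj_on_nth) auto
      ultimately have cardJ: "card J = g + 1" using U(2) by (metis card_image)
      have "indep_mod I U" by (rule indep_mod_mono[OF indep_mod_std]) (use U(1) in auto)
      then obtain R where "R \<subseteq> {..<\<mu>}" "card R = g + 1" "det (submatrix ?A R J) \<noteq> 0"
        using crit[OF J] UJ cardJ by auto
      hence "det (submatrix ?A R J) \<in> minors (g + 1) ?A"
        using J cardJ unfolding minors_def dim_A by blast
      thus False using zero \<open>det _ \<noteq> 0\<close> by blast
    qed
  qed
qed

lemma aff_HF_eq_ord_HF:
  obtains T where "order_ideal n T" "card T = \<mu>" "ord_HF T = aff_HF n I" "indep_mod I T"
  using order_ideal_std[OF dimension_carrier] indep_mod_std that by metis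

lemma ord_HF_le_aff_HF: "ord_HF (set ts) i \<le> aff_HF n I i"
  unfolding ord_HF_def
  by (rule card_le_aff_HF) (use ts_terms indep_mod_mono[OF indep_mod_ts] in auto)

end

subsection \<open>Matrices over the coordinate ring and their specializations\<close>

definition mat_over :: "'v set \<Rightarrow> ('v, 'a::comm_ring_1) mpol mat \<Rightarrow> bool" where
  "mat_over V A \<longleftrightarrow> (\<forall>i<dim_row A. \<forall>j<dim_col A. indets (A $$ (i, j)) \<subseteq> V)"

lemma mat_over_mult:
  assumes "mat_over V A" "mat_over V B" "dim_col A = dim_row B"
  shows "mat_over V (A * B)"
  unfolding mat_over_def
proof (intro allI impI)
  fix i j assume ij: "i < dim_row (A * B)" "j < dim_col (A * B)"
  hence "(A * B) $$ (i, j) = (\<Sum>k<dim_row B. A $$ (i, k) * B $$ (k, j))"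
    using assms(3) by (simp add: scalar_prod_def atLeast0LessThan)
  moreover have "indets \<dots> \<subseteq> V"
    by (intro indets_sum indets_multI) (use assms ij in \<open>auto simp: mat_over_def\<close>)
  ultimately show "indets ((A * B) $$ (i, j)) \<subseteq> V" by simp
qed

lemma mat_over_one: "mat_over V (1\<^sub>m m)"
  by (auto simp: mat_over_def)

lemma mat_over_pow: "mat_over V A \<Longrightarrow> A \<in> carrier_mat m m \<Longrightarrow> mat_over V (A ^\<^sub>m k)"
  by (induction k) (auto intro!: mat_over_mult mat_over_one)

lemma mat_over_term_value:
  assumes "\<And>r. r \<in> set rs \<Longrightarrow> M r \<in> carrier_mat m m" "\<And>r. r \<in> set rs \<Longrightarrow> mat_over V (M r)"
  shows "mat_over V (term_value m rs M t)"
  using assms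
proof (induction rs)
  case (Cons r rs)
  have "term_value m rs M t \<in> carrier_mat m m" by (rule term_value_carrier) (use Cons in auto)
  moreover have "M r ^\<^sub>m lookup t r \<in> carrier_mat m m" using Cons by auto
  ultimately have "mat_over V (M r ^\<^sub>m lookup t r * term_value m rs M t)"
    using Cons by (intro mat_over_mult mat_over_pow[of _ _ m]) auto
  thus ?case by (simp add: term_value_def)
qed (simp add: term_value_def mat_over_one)

lemma indets_det:
  fixes A :: "('v, 'a::comm_ring_1) mpol mat"
  assumes "mat_over V A"
  shows "indets (det A) \<subseteq> V"
proof (cases "dim_row A = dim_col A")
  case True
  have sg: "indets (of_int (sign p) :: ('v, 'a) mpol) \<subseteq> V" for p :: "nat \<Rightarrow> nat"
    by (simp add: sign_def)
  show ?thesis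
    unfolding det_def if_P[OF True]
  proof (intro indets_sum indets_multI sg indets_prod)
    fix p i assume "p \<in> {p. p permutes {0..<dim_row A}}" "i \<in> {0..<dim_row A}"
    hence "i < dim_row A" "p i < dim_col A" using True permutes_in_image[of p "{0..<dim_row A}" i] by auto
    thus "indets (A $$ (i, p i)) \<subseteq> V" using assms by (simp add: mat_over_def)
  qed
qed (simp add: det_def)

lemma (in comm_ring_hom) mat_hom_term_value:
  assumes "\<And>r. r \<in> set rs \<Longrightarrow> M r \<in> carrier_mat m m"
  shows "mat\<^sub>h (term_value m rs M t) = term_value m rs (\<lambda>r. mat\<^sub>h (M r)) t"
  using assms
proof (induction rs)
  case Nil
  show ?case by (simp add: term_value_def mat_hom_one)
next
  case (Cons r rs)
  have "term_value m rs M t \<in> carrier_mat m m" by (rule term_value_carrier) (use Cons in auto)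
  moreover have "M r ^\<^sub>m lookup t r \<in> carrier_mat m m" using Cons by auto
  ultimately have "mat\<^sub>h (M r ^\<^sub>m lookup t r * term_value m rs M t) =
      mat\<^sub>h (M r) ^\<^sub>m lookup t r * mat\<^sub>h (term_value m rs M t)"
    using Cons.prems by (simp add: mat_hom_mult[of _ m m _ m] mat_hom_pow[of _ m])
  thus ?case using Cons by (simp add: term_value_def)
qed

lemma term_mat_eq: "term_mat n ts bs = term_value (length ts) [0..<n] (gen_mult_mat ts bs)"
  by (intro ext) (simp add: term_mat_def term_value_def)

lemma gen_mult_mat_carrier [simp]: "gen_mult_mat ts bs r \<in> carrier_mat (length ts) (length ts)"
  by (simp add: gen_mult_mat_def)

lemma dim_gen_mult_mat [simp]:
  "dim_row (gen_mult_mat ts bs r) = length ts" "dim_col (gen_mult_mat ts bs r) = length ts"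
  by (simp_all add: gen_mult_mat_def)

lemma dim_point_mat [simp]:
  "dim_row (point_mat ts bs \<Gamma> r) = length ts" "dim_col (point_mat ts bs \<Gamma> r) = length ts"
  by (simp_all add: point_mat_def)

context border_frame
begin

abbreviation "V \<equiv> {..<length ts} \<times> {..<length bs}"

lemma gen_mult_mat_over: "r < n \<Longrightarrow> mat_over V (gen_mult_mat ts bs r)"
  unfolding mat_over_def
proof (intro allI impI)
  fix i j assume "r < n" "i < dim_row (gen_mult_mat ts bs r)" "j < dim_col (gen_mult_mat ts bs r)"
  hence ij: "i < \<mu>" "j < \<mu>" by (simp_all add: gen_mult_mat_def)
  let ?u = "Poly_Mapping.single r 1 + ts ! j"
  show "indets (gen_mult_mat ts bs r $$ (i, j)) \<subseteq> V"
  proof (cases "?u \<in> set ts")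
    case False
    then obtain m where m: "m < length bs" "?u = bs ! m"
      using border_step[OF \<open>r < n\<close>, of "ts ! j"] ij by (metis Un_iff in_set_conv_nth nth_mem)
    thus ?thesis using False ij the_border_index[OF m(1)]
      by (simp add: gen_mult_mat_def Let_def indets_mvar)
  qed (use ij in \<open>simp add: gen_mult_mat_def Let_def\<close>)
qed

lemma term_mat_carrier: "term_mat n ts bs u \<in> carrier_mat \<mu> \<mu>"
  unfolding term_mat_eq by (rule term_value_carrier) simp

lemma first_col_carrier [simp]: "first_col n ts bs u \<in> carrier_vec \<mu>"
  unfolding first_col_def using term_mat_carrier[of u] by (metis carrier_matD(1) carrier_vec_dim_vec dim_col)

lemma indets_first_col:
  assumes i: "i < \<mu>"
  shows "indets (first_col n ts bs u $ i :: 'a::field cpol) \<subseteq> V"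
proof -
  have "mat_over V (term_mat n ts bs u :: 'a cpol mat)"
    unfolding term_mat_eq by (rule mat_over_term_value) (auto simp: gen_mult_mat_over)
  moreover have "(first_col n ts bs u $ i :: 'a cpol) = term_mat n ts bs u $$ (i, 0)"
    using carrier_matD[OF term_mat_carrier[of u, where ?'a = 'a]] i mu_pos by (simp add: first_col_def)
  ultimately show ?thesis
    using carrier_matD[OF term_mat_carrier[of u, where ?'a = 'a]] i mu_pos by (simp add: mat_over_def)
qed

lemma mat_over_cols: "mat_over V (mat_of_cols \<mu> (map (first_col n ts bs) us))"
  unfolding mat_over_def using indets_first_col by (auto simp: mat_of_cols_index subset_iff)

lemma border_gens_carrier:
  "(\<Union>r<n. \<Union>s<n. elements_mat (gen_mult_mat ts bs r * gen_mult_mat ts bs s -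
      gen_mult_mat ts bs s * gen_mult_mat ts bs r)) \<subseteq> carrier (KC ts bs :: 'a::field cpol ring)"
proof (intro UN_least subsetI)
  fix r s and f :: "'a cpol" assume rs: "r \<in> {..<n}" "s \<in> {..<n}" and
    "f \<in> elements_mat (gen_mult_mat ts bs r * gen_mult_mat ts bs s - gen_mult_mat ts bs s * gen_mult_mat ts bs r)"
  then obtain i j where ij: "i < \<mu>" "j < \<mu>" "f = (gen_mult_mat ts bs r * gen_mult_mat ts bs s -
      gen_mult_mat ts bs s * gen_mult_mat ts bs r) $$ (i, j)"
    by (fastforce simp: gen_mult_mat_def)
  have "mat_over V (gen_mult_mat ts bs a * gen_mult_mat ts bs b :: 'a cpol mat)" if "a < n" "b < n" for a b
    using that by (intro mat_over_mult gen_mult_mat_over) (auto simp: gen_mult_mat_def)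
  hence "indets ((gen_mult_mat ts bs a * gen_mult_mat ts bs b) $$ (i, j) :: 'a cpol) \<subseteq> V" if "a < n" "b < n" for a b
    using that ij by (simp add: mat_over_def del: index_mult_mat(1))
  moreover have "f = (gen_mult_mat ts bs r * gen_mult_mat ts bs s) $$ (i, j) -
      (gen_mult_mat ts bs s * gen_mult_mat ts bs r) $$ (i, j)"
    using ij by (simp del: index_mult_mat(1))
  ultimately show "f \<in> carrier (KC ts bs)"
    using rs by (simp add: indets_minusI)
qed

lemma ideal_border_ideal: "ideal (border_ideal n ts bs) (KC ts bs)"
  unfolding border_ideal_def by (rule polyring.genideal_ideal[OF border_gens_carrier])

lemma minors_carrier:
  "minors k (mat_of_cols \<mu> (map (first_col n ts bs) us)) \<subseteq> carrier (KC ts bs :: 'a::field cpol ring)"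
proof
  fix f :: "'a cpol" assume "f \<in> minors k (mat_of_cols \<mu> (map (first_col n ts bs) us))"
  then obtain R J where f: "f = det (submatrix (mat_of_cols \<mu> (map (first_col n ts bs) us)) R J)"
      "R \<subseteq> {..<\<mu>}" "J \<subseteq> {..<length us}"
    by (auto simp: minors_def)
  have eq: "{i. i < \<mu> \<and> i \<in> R} = R" "{j. j < length us \<and> j \<in> J} = J" using f by auto
  have "mat_over V (submatrix (mat_of_cols \<mu> (map (first_col n ts bs) us)) R J :: 'a cpol mat)"
    unfolding mat_over_def
  proof (intro allI impI)
    fix i j assume "i < dim_row (submatrix (mat_of_cols \<mu> (map (first_col n ts bs) us)) R J)"
      "j < dim_col (submatrix (mat_of_cols \<mu> (map (first_col n ts bs) us)) R J)"
    hence ij: "i < card R" "j < card J" by (simp_all only: dim_submatrix mat_of_cols_carrier length_map eq)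
    hence "pick R i < \<mu>" "pick J j < length us" using pick_in_set_le f by blast+
    thus "indets (submatrix (mat_of_cols \<mu> (map (first_col n ts bs) us)) R J $$ (i, j)) \<subseteq> V"
      using ij indets_first_col by (simp add: submatrix_def eq mat_of_cols_index)
  qed
  thus "f \<in> carrier (KC ts bs)" unfolding f carrier_polyring by (rule indets_det)
qed

lemma ideal_minor_ideal: "ideal (minor_ideal n ts bs G i) (KC ts bs)"
  unfolding minor_ideal_def by (rule polyring.genideal_ideal[OF minors_carrier])

lemma ideal_closed_stratum_ideal: "ideal (closed_stratum_ideal n ts bs G) (KC ts bs)"
proof -
  have "minor_ideal n ts bs G i \<subseteq> carrier (KC ts bs)" for i
    by (rule ideal_polyring_subset[OF ideal_minor_ideal])
  thus ?thesis
    unfolding closed_stratum_ideal_def ideal_sum_def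
    by (intro polyring.add_ideals ideal_border_ideal polyring.genideal_ideal) blast
qed

context
  fixes \<iota> :: "'k::field \<Rightarrow> 'l::field"
  assumes \<iota>: "field_hom \<iota>"
begin

interpretation \<iota>: comm_ring_hom \<iota> using \<iota> by (rule field_hom_imp_comm_ring_hom)

lemma map_gen_mult_mat: "map_mat (meval \<iota> (($$) \<Gamma>)) (gen_mult_mat ts bs r) = point_mat ts bs \<Gamma> r"
proof -
  interpret m: comm_ring_hom "meval \<iota> (($$) \<Gamma>)" by (rule \<iota>.meval_comm_ring_hom)
  show ?thesis
    by (intro eq_matI) (auto simp: gen_mult_mat_def point_mat_def Let_def \<iota>.meval_mvar)
qed

lemma zeros_border_ideal: "\<Gamma> \<in> zeros \<iota> ts bs (border_ideal n ts bs) \<longleftrightarrow> border_point n ts bs \<Gamma>"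
proof -
  interpret m: comm_ring_hom "meval \<iota> (($$) \<Gamma>)" by (rule \<iota>.meval_comm_ring_hom)
  let ?A = "gen_mult_mat ts bs" and ?M = "point_mat ts bs \<Gamma>"
  have *: "(\<forall>f\<in>elements_mat (?A r * ?A s - ?A s * ?A r). meval \<iota> (($$) \<Gamma>) f = 0) \<longleftrightarrow>
      ?M r * ?M s = ?M s * ?M r" for r s
  proof -
    let ?D = "?A r * ?A s - ?A s * ?A r"
    have D: "map_mat (meval \<iota> (($$) \<Gamma>)) ?D = ?M r * ?M s - ?M s * ?M r"
    proof -
      have "map_mat (meval \<iota> (($$) \<Gamma>)) ?D =
          map_mat (meval \<iota> (($$) \<Gamma>)) (?A r * ?A s) - map_mat (meval \<iota> (($$) \<Gamma>)) (?A s * ?A r)"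
        by (intro eq_matI) (simp_all add: m.hom_minus del: index_mult_mat(1))
      thus ?thesis
        using m.mat_hom_mult[of "?A r" \<mu> \<mu> "?A s" \<mu>] m.mat_hom_mult[of "?A s" \<mu> \<mu> "?A r" \<mu>]
        by (simp add: map_gen_mult_mat)
    qed
    have idx: "meval \<iota> (($$) \<Gamma>) (?D $$ (i, j)) = (?M r * ?M s) $$ (i, j) - (?M s * ?M r) $$ (i, j)"
      if "i < \<mu>" "j < \<mu>" for i j
    proof -
      have "meval \<iota> (($$) \<Gamma>) (?D $$ (i, j)) = map_mat (meval \<iota> (($$) \<Gamma>)) ?D $$ (i, j)"
        by (rule index_map_mat(1)[symmetric]) (use that in simp_all)
      thus ?thesis unfolding D using that by (simp del: index_mult_mat(1))
    qed
    have dim: "?D \<in> carrier_mat \<mu> \<mu>" "?M r * ?M s \<in> carrier_mat \<mu> \<mu>" "?M s * ?M r \<in> carrier_mat \<mu> \<mu>"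
      by (auto simp: gen_mult_mat_def point_mat_def)
    have "(\<forall>f\<in>elements_mat ?D. meval \<iota> (($$) \<Gamma>) f = 0) \<longleftrightarrow>
        (\<forall>i<\<mu>. \<forall>j<\<mu>. meval \<iota> (($$) \<Gamma>) (?D $$ (i, j)) = 0)"
      using elements_matI[OF dim(1)] elements_matD[of _ ?D] dim(1) by (metis carrier_matD)
    also have "\<dots> \<longleftrightarrow> (\<forall>i<\<mu>. \<forall>j<\<mu>. (?M r * ?M s) $$ (i, j) = (?M s * ?M r) $$ (i, j))"
      using idx by simp
    also have "\<dots> \<longleftrightarrow> ?M r * ?M s = ?M s * ?M r"
      using dim(2,3) by (auto simp: mat_eq_iff simp del: index_mult_mat(1))
    finally show ?thesis .
  qed
  have "\<Gamma> \<in> zeros \<iota> ts bs (border_ideal n ts bs) \<longleftrightarrow>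
      \<Gamma> \<in> carrier_mat \<mu> (length bs) \<and> (\<forall>r<n. \<forall>s<n. ?M r * ?M s = ?M s * ?M r)"
    unfolding border_ideal_def zeros_genideal[OF \<iota> border_gens_carrier]
    by (auto simp: zeros_def *[symmetric])
  thus ?thesis
    by (simp add: border_point_def border_point_axioms_def border_frame_axioms)
qed

lemma map_first_col:
  assumes "border_point n ts bs \<Gamma>"
  shows "map_vec (meval \<iota> (($$) \<Gamma>)) (first_col n ts bs u) = border_point.phi n ts bs \<Gamma> u"
proof -
  interpret m: comm_ring_hom "meval \<iota> (($$) \<Gamma>)" by (rule \<iota>.meval_comm_ring_hom)
  interpret border_point n ts bs \<Gamma> by (rule assms)
  have "map_mat (meval \<iota> (($$) \<Gamma>)) (term_mat n ts bs u) = term_value \<mu> [0..<n] M u"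
    unfolding term_mat_eq by (subst m.mat_hom_term_value) (auto simp: map_gen_mult_mat)
  thus ?thesis
    unfolding phi_def first_col_def using term_mat_carrier[of u] mu_pos
    by (metis carrier_matD(2) col_map_mat)
qed

lemma map_cols:
  assumes "border_point n ts bs \<Gamma>"
  shows "map_mat (meval \<iota> (($$) \<Gamma>)) (mat_of_cols \<mu> (map (first_col n ts bs) us)) =
    mat_of_cols \<mu> (map (border_point.phi n ts bs \<Gamma>) us)"
proof -
  have "map_mat (meval \<iota> (($$) \<Gamma>)) (mat_of_cols \<mu> (map (first_col n ts bs) us)) =
      mat_of_cols \<mu> (map (map_vec (meval \<iota> (($$) \<Gamma>))) (map (first_col n ts bs) us))"
    by (rule mat_of_cols_map[symmetric]) auto
  thus ?thesis by (simp add: o_def map_first_col[OF assms])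
qed

lemma zeros_minor_ideal:
  assumes "border_point n ts bs \<Gamma>"
  shows "\<Gamma> \<in> zeros \<iota> ts bs (minor_ideal n ts bs G i) \<longleftrightarrow> aff_HF n (scheme_ideal n ts bs \<Gamma>) i \<le> G i"
proof -
  interpret m: comm_ring_hom "meval \<iota> (($$) \<Gamma>)" by (rule \<iota>.meval_comm_ring_hom)
  interpret border_point n ts bs \<Gamma> by (rule assms)
  let ?ws = "sorted_list_of_set {u \<in> terms_in n. tdeg u \<le> i}"
  let ?A = "mat_of_cols \<mu> (map (first_col n ts bs) ?ws)"
  have sub: "submatrix (map_mat h A) R J = map_mat h (submatrix A R J)"
    if "R \<subseteq> {..<dim_row A}" "J \<subseteq> {..<dim_col A}" for h :: "'k cpol \<Rightarrow> 'l" and A R J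
  proof -
    have eq: "{a. a < dim_row A \<and> a \<in> R} = R" "{a. a < dim_col A \<and> a \<in> J} = J" using that by auto
    have "pick R a < dim_row A" if "a < card R" for a using pick_in_set_le[OF that] \<open>R \<subseteq> _\<close> by auto
    moreover have "pick J a < dim_col A" if "a < card J" for a using pick_in_set_le[OF that] \<open>J \<subseteq> _\<close> by auto
    ultimately show ?thesis by (intro eq_matI) (auto simp: submatrix_def eq)
  qed
  have "minors k (map_mat (meval \<iota> (($$) \<Gamma>)) A) = meval \<iota> (($$) \<Gamma>) ` minors k A" for k A
  proof -
    have "det (submatrix (map_mat (meval \<iota> (($$) \<Gamma>)) A) R J) = meval \<iota> (($$) \<Gamma>) (det (submatrix A R J))"
      if "R \<subseteq> {..<dim_row A}" "J \<subseteq> {..<dim_col A}" for R J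
      using sub[OF that] by simp
    thus ?thesis unfolding minors_def by (auto simp: image_iff) metis+
  qed
  hence "minors (G i + 1) (mat_of_cols \<mu> (map phi ?ws)) = meval \<iota> (($$) \<Gamma>) ` minors (G i + 1) ?A"
    by (simp only: map_cols[OF assms, symmetric])
  hence "(\<forall>f\<in>minors (G i + 1) ?A. meval \<iota> (($$) \<Gamma>) f = 0) \<longleftrightarrow>
      (\<forall>f\<in>minors (G i + 1) (mat_of_cols \<mu> (map phi ?ws)). f = 0)"
    by simp
  also have "\<dots> \<longleftrightarrow> aff_HF n I i \<le> G i" by (rule aff_HF_le_iff_minors[symmetric])
  finally show ?thesis
    unfolding minor_ideal_def zeros_genideal[OF \<iota> minors_carrier] using \<Gamma> by (simp add: zeros_def)
qed

text \<open>
  The ideal only bounds the Hilbert function in the degrees from \<open>1\<close> up to the first one where \<open>G\<close>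
  takes the value \<open>\<mu>\<close>.  The other bounds hold anyway: the Hilbert function is at most \<open>1\<close> in
  degree \<open>0\<close> and at most \<open>\<mu>\<close> everywhere.  As \<open>G\<close> is not assumed monotone, the second assumption is
  stated explicitly.
\<close>

lemma zeros_closed_stratum_ideal:
  assumes "1 \<le> G 0" "\<And>j. (LEAST i. G i = \<mu>) \<le> j \<Longrightarrow> \<mu> \<le> G j"
  shows "\<Gamma> \<in> zeros \<iota> ts bs (closed_stratum_ideal n ts bs G) \<longleftrightarrow>
    border_point n ts bs \<Gamma> \<and> aff_HF n (scheme_ideal n ts bs \<Gamma>) \<le> G"
proof -
  let ?F = "minor_ideal n ts bs G ` {1..<(LEAST i. G i = \<mu>)} :: 'k cpol set set"
  have F: "N \<subseteq> carrier (KC ts bs)" if "N \<in> ?F" for N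
    using that ideal_polyring_subset[OF ideal_minor_ideal] by blast
  hence id: "ideal (ideal_sum (KC ts bs) ?F) (KC ts bs)"
    unfolding ideal_sum_def by (intro polyring.genideal_ideal) blast
  have zeros_sum: "zeros \<iota> ts bs (ideal_sum (KC ts bs) ?F) =
      {\<Gamma> \<in> carrier_mat \<mu> (length bs). \<forall>N\<in>?F. \<Gamma> \<in> zeros \<iota> ts bs N}"
    by (rule zeros_ideal_sum[OF \<iota>]) (rule F)
  have "\<Gamma> \<in> zeros \<iota> ts bs (closed_stratum_ideal n ts bs G) \<longleftrightarrow>
      border_point n ts bs \<Gamma> \<and>
      (\<forall>i\<in>{1..<(LEAST i. G i = \<mu>)}. aff_HF n (scheme_ideal n ts bs \<Gamma>) i \<le> G i)"
    unfolding closed_stratum_ideal_def zeros_set_add[OF \<iota> ideal_border_ideal id] zeros_sum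
    by (auto simp: zeros_border_ideal zeros_minor_ideal border_point.\<Gamma>)
  also have "\<dots> \<longleftrightarrow> border_point n ts bs \<Gamma> \<and> aff_HF n (scheme_ideal n ts bs \<Gamma>) \<le> G"
  proof (intro conj_cong refl iffI)
    assume point: "border_point n ts bs \<Gamma>"
      and le: "\<forall>i\<in>{1..<(LEAST i. G i = \<mu>)}. aff_HF n (scheme_ideal n ts bs \<Gamma>) i \<le> G i"
    interpret border_point n ts bs \<Gamma> by (rule point)
    show "aff_HF n I \<le> G"
    proof (rule le_funI)
      fix i
      consider "i = 0" | "i \<in> {1..<(LEAST i. G i = \<mu>)}" | "(LEAST i. G i = \<mu>) \<le> i"
        by fastforce
      thus "aff_HF n I i \<le> G i"
      proof cases
        case 1
        have "card {t \<in> std. tdeg t \<le> 0} \<le> card {0 :: nat pp}"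
          by (rule card_mono) (auto simp: tdeg_eq_0_iff)
        thus ?thesis using 1 assms(1) by (simp add: aff_HF_std)
      next
        case 3
        have "aff_HF n I i \<le> \<mu>"
          unfolding aff_HF_std using card_std[OF dimension_carrier] by (metis (no_types, lifting) card_mono mem_Collect_eq subsetI)
        thus ?thesis using assms(2)[OF 3] by simp
      qed (use le in blast)
    qed
  qed (auto simp: le_fun_def)
  finally show ?thesis .
qed

end

end


subsection \<open>The strata as zero loci\<close>

lemma order_ideal_0: "order_ideal n T \<Longrightarrow> 0 \<in> T"
  unfolding order_ideal_def by (metis add.left_neutral all_not_in_conv subsetD terms_in_0)

lemma ord_HF_0: "order_ideal n T \<Longrightarrow> ord_HF T 0 = 1"
proof -
  assume "order_ideal n T"
  hence "{t \<in> T. tdeg t \<le> 0} = {0}" using order_ideal_0 by (auto simp: tdeg_eq_0_iff)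
  thus ?thesis by (simp add: ord_HF_def)
qed

lemma ord_HF_mono: "finite T \<Longrightarrow> i \<le> j \<Longrightarrow> ord_HF T i \<le> ord_HF T j"
  unfolding ord_HF_def by (intro card_mono) auto

lemma ord_HF_le_card: "finite T \<Longrightarrow> ord_HF T i \<le> card T"
  unfolding ord_HF_def by (intro card_mono) auto

lemma ord_HF_eventually:
  assumes "finite T"
  obtains d where "\<And>i. d \<le> i \<Longrightarrow> ord_HF T i = card T"
proof -
  have "{t \<in> T. tdeg t \<le> i} = T" if "Max (insert 0 (tdeg ` T)) \<le> i" for i
    using that assms by (auto simp: Max_le_iff)
  thus ?thesis using that unfolding ord_HF_def by metis
qed

text \<open>
  This gives access to the elementary properties of admissible Hilbert functions: they are monotone,
  start with \<open>1\<close>, and finally take the value \<open>\<mu>\<close>.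
\<close>

lemma admissible_imp_ord_HF:
  assumes "admissible TYPE('k::field) n \<mu> H" "\<mu> > 0"
  obtains T where "order_ideal n T" "card T = \<mu>" "ord_HF T = H"
proof -
  obtain N :: "(nat, 'k) mpol set" where N: "ideal N (PX n)"
      "ring.dimension (PX n Quot N) \<mu> (scalars n N) (carrier (PX n Quot N))" "H = aff_HF n N"
    using assms(1) by (auto simp: admissible_def)
  interpret PX_ideal n N by (simp add: PX_ideal_def N(1))
  have "1 \<notin> N"
  proof
    assume one: "1 \<in> N"
    have "cls p = \<zero>\<^bsub>Q\<^esub>" if "p \<in> carrier (PX n)" for p
    proof -
      have "p * 1 \<in> N" using one that by (intro I(4)) simp_all
      hence "cls p = cls 0" using that by (subst cls_eq_iff) auto
      thus ?thesis using hom.hom_zero by simp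
    qed
    hence "carrier Q \<subseteq> {\<zero>\<^bsub>Q\<^esub>}"
      unfolding carrier_Q carrier_PX[symmetric] by auto
    hence "carrier Q = {\<zero>\<^bsub>Q\<^esub>}" using hom.S.zero_closed by blast
    with dimension_trivial[OF N(2)] assms(2) show False by simp
  qed
  then interpret proper_PX_ideal n N by unfold_locales
  show ?thesis using order_ideal_std[OF N(2)] N(3) that by metis
qed

locale border_frame_HF = border_frame +
  fixes H :: "nat \<Rightarrow> nat" and T
  assumes T: "order_ideal n T" "card T = length ts" "ord_HF T = H"
begin

abbreviation "\<rho> \<equiv> LEAST i. H i = \<mu>"

lemma finite_T: "finite T"
  using T(1) by (simp add: order_ideal_def)

lemma H_0: "H 0 = 1" and H_mono: "i \<le> j \<Longrightarrow> H i \<le> H j" and H_le: "H i \<le> \<mu>"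
  using ord_HF_0[OF T(1)] ord_HF_mono[OF finite_T] ord_HF_le_card[OF finite_T] T(2,3) by auto

lemma H_eventually: "\<exists>d. \<forall>i\<ge>d. H i = \<mu>"
  using ord_HF_eventually[OF finite_T] T(2,3) by metis

lemma H_rho: "\<rho> \<le> i \<longleftrightarrow> H i = \<mu>"
proof
  have "H \<rho> = \<mu>" using H_eventually by (metis (mono_tags, lifting) LeastI order_refl)
  thus "\<rho> \<le> i \<Longrightarrow> H i = \<mu>" using H_mono[of \<rho> i] H_le[of i] by simp
qed (rule Least_le)

context
  fixes \<iota> :: "'k::field \<Rightarrow> 'l::field"
  assumes \<iota>: "field_hom \<iota>"
begin

lemma zeros_closed_stratum_ideal_H:
  "\<Gamma> \<in> zeros \<iota> ts bs (closed_stratum_ideal n ts bs H) \<longleftrightarrow>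
    border_point n ts bs \<Gamma> \<and> aff_HF n (scheme_ideal n ts bs \<Gamma>) \<le> H"
  by (rule zeros_closed_stratum_ideal[OF \<iota>]) (auto simp: H_0 H_rho)

text \<open>
  Lowering \<open>H\<close> at \<open>\<rho>\<close> shifts the first place with value \<open>\<mu>\<close>, and lowering it elsewhere leaves
  that place unchanged; in both cases the lowered function has the value \<open>\<mu>\<close> from there on.
\<close>

lemma zeros_closed_stratum_ideal_pred:
  assumes i: "i \<in> {1..\<rho>}"
  shows "\<Gamma> \<in> zeros \<iota> ts bs (closed_stratum_ideal n ts bs (H(i := H i - 1))) \<longleftrightarrow>
    border_point n ts bs \<Gamma> \<and> aff_HF n (scheme_ideal n ts bs \<Gamma>) \<le> H(i := H i - 1)"
proof (rule zeros_closed_stratum_ideal[OF \<iota>])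
  define G where "G = H(i := H i - 1)"
  define \<sigma> where "\<sigma> = (LEAST j. G j = \<mu>)"
  show "1 \<le> (H(i := H i - 1)) 0" using i by (simp add: H_0)
  obtain d where d: "\<And>j. d \<le> j \<Longrightarrow> H j = \<mu>" using H_eventually by blast
  have "max d (Suc i) \<noteq> i" by linarith
  hence "G (max d (Suc i)) = \<mu>" using d[of "max d (Suc i)"] by (simp add: G_def)
  hence \<sigma>: "G \<sigma> = \<mu>" unfolding \<sigma>_def by (rule LeastI)
  have "G i < \<mu>" using H_le[of i] mu_pos unfolding G_def fun_upd_same by linarith
  hence neq: "\<sigma> \<noteq> i" using \<sigma> by auto
  hence ge: "\<rho> \<le> \<sigma>" using \<sigma> by (simp add: H_rho G_def)
  fix j assume "(LEAST j. (H(i := H i - 1)) j = \<mu>) \<le> j"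
  hence "\<sigma> \<le> j" by (simp only: \<sigma>_def G_def)
  hence "j \<noteq> i" "\<rho> \<le> j" using ge neq i by auto
  thus "\<mu> \<le> (H(i := H i - 1)) j" by (simp add: H_rho)
qed

text \<open>
  A Hilbert function below \<open>H\<close> differs from \<open>H\<close> in some degree between \<open>1\<close> and \<open>\<rho>\<close>, so it is below
  one of the functions obtained by lowering \<open>H\<close> by one.  The lowered
  value is still at least that of the order ideal, because no point has a smaller Hilbert function
  than the order ideal itself.
\<close>

lemma zeros_Z_ideal:
  "\<Gamma> \<in> zeros \<iota> ts bs (Z_ideal n ts bs H) \<longleftrightarrow>
    border_point n ts bs \<Gamma> \<and> aff_HF n (scheme_ideal n ts bs \<Gamma>) < H"
proof -
  let ?A = "{i \<in> {1..\<rho>}. H i - 1 \<ge> ord_HF (set ts) i}"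
  have "\<Gamma> \<in> zeros \<iota> ts bs (Z_ideal n ts bs H) \<longleftrightarrow>
      (\<exists>i\<in>?A. border_point n ts bs \<Gamma> \<and> aff_HF n (scheme_ideal n ts bs \<Gamma>) \<le> H(i := H i - 1))"
    unfolding Z_ideal_def
    by (subst zeros_Inter[OF \<iota>]) (auto simp: zeros_closed_stratum_ideal_pred intro: ideal_closed_stratum_ideal)
  also have "\<dots> \<longleftrightarrow> border_point n ts bs \<Gamma> \<and> aff_HF n (scheme_ideal n ts bs \<Gamma>) < H"
  proof (intro iffI)
    assume "\<exists>i\<in>?A. border_point n ts bs \<Gamma> \<and> aff_HF n (scheme_ideal n ts bs \<Gamma>) \<le> H(i := H i - 1)"
    then obtain i where i: "i \<in> {1..\<rho>}" "border_point n ts bs \<Gamma>"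
        "aff_HF n (scheme_ideal n ts bs \<Gamma>) \<le> H(i := H i - 1)"
      by blast
    have "H i \<ge> 1" using H_mono[of 0 i] by (simp add: H_0)
    hence "H i - 1 < H i" by simp
    hence "aff_HF n (scheme_ideal n ts bs \<Gamma>) i < H i" using le_funD[OF i(3), of i] by simp
    moreover have "aff_HF n (scheme_ideal n ts bs \<Gamma>) \<le> H"
    proof (rule le_funI)
      fix j show "aff_HF n (scheme_ideal n ts bs \<Gamma>) j \<le> H j"
        using le_funD[OF i(3), of j] by (auto split: if_splits)
    qed
    ultimately show "border_point n ts bs \<Gamma> \<and> aff_HF n (scheme_ideal n ts bs \<Gamma>) < H"
      using i(2) by (metis order_less_irrefl order_le_less)
  next
    assume *: "border_point n ts bs \<Gamma> \<and> aff_HF n (scheme_ideal n ts bs \<Gamma>) < H"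
    then interpret border_point n ts bs \<Gamma> by simp
    obtain T' where T': "order_ideal n T'" "card T' = \<mu>" "ord_HF T' = aff_HF n I"
      by (rule aff_HF_eq_ord_HF)
    have fin: "finite T'" using T'(1) by (simp add: order_ideal_def)
    have "\<not> H \<le> aff_HF n I" using * by (simp add: less_le_not_le)
    then obtain k where k: "aff_HF n I k < H k" by (auto simp: le_fun_def not_le)
    \<comment> \<open>\<open>H\<close> is constant from \<open>\<rho>\<close> on and \<open>aff_HF\<close> is monotone, so \<open>\<rho>\<close> can replace a later \<open>k\<close>.\<close>
    define i where "i = min k \<rho>"
    have less: "aff_HF n I i < H i"
    proof (cases "k \<le> \<rho>")
      case False
      hence i: "i = \<rho>" "i \<le> k" by (simp_all add: i_def)
      have "H i = \<mu>" using H_rho[of i] i(1) by blast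
      moreover have "H k = \<mu>" using H_rho[of k] False by linarith
      moreover have "aff_HF n I i \<le> aff_HF n I k" using ord_HF_mono[OF fin i(2)] T'(3) by metis
      ultimately show ?thesis using k by linarith
    next
      case True
      hence "i = k" by (simp add: i_def)
      thus ?thesis using k by simp
    qed
    have "i \<noteq> 0"
    proof
      assume "i = 0"
      thus False using less ord_HF_0[OF T'(1)] T'(3) H_0 by simp
    qed
    moreover have "i \<le> \<rho>" by (simp add: i_def)
    ultimately have "i \<in> ?A" using less ord_HF_le_aff_HF[of i] by simp
    moreover have "aff_HF n I \<le> H(i := H i - 1)"
      using * less order_less_imp_le[of "aff_HF n I" H] by (auto simp: le_fun_def)
    ultimately show "\<exists>i\<in>?A. border_point n ts bs \<Gamma> \<and> aff_HF n I \<le> H(i := H i - 1)"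
      using * by blast
  qed
  finally show ?thesis .
qed

end

lemma ideal_Z_ideal: "ideal (Z_ideal n ts bs H :: 'k::field cpol set) (KC ts bs)"
  unfolding Z_ideal_def
  by (rule zeros_Inter(2)[OF field_hom_to_ac]) (auto intro: ideal_closed_stratum_ideal)

lemma closed_stratum_eq:
  assumes "field_hom (\<iota> :: 'k::field \<Rightarrow> 'l::field)"
  shows "closed_stratum \<iota> n ts bs H =
    {\<Gamma>. border_point n ts bs \<Gamma> \<and> aff_HF n (scheme_ideal n ts bs \<Gamma>) \<le> H}"
proof -
  have "{\<gamma> \<in> zeros to_ac ts bs (border_ideal n ts bs :: 'k cpol set). aff_HF n (scheme_ideal n ts bs \<gamma>) \<le> H} =
      zeros to_ac ts bs (closed_stratum_ideal n ts bs H :: 'k cpol set)"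
    using zeros_border_ideal[OF field_hom_to_ac] zeros_closed_stratum_ideal_H[OF field_hom_to_ac] by blast
  thus ?thesis
    unfolding closed_stratum_def
    using zeros_vanishing_ideal_zeros[OF assms ideal_polyring_subset[OF ideal_closed_stratum_ideal]]
      zeros_closed_stratum_ideal_H[OF assms] by auto
qed

lemma stratum_eq:
  assumes "field_hom (\<iota> :: 'k::field \<Rightarrow> 'l::field)"
  shows "stratum \<iota> n ts bs H =
    {\<Gamma>. border_point n ts bs \<Gamma> \<and> aff_HF n (scheme_ideal n ts bs \<Gamma>) = H}"
proof -
  have "{\<gamma> \<in> zeros to_ac ts bs (border_ideal n ts bs :: 'k cpol set). aff_HF n (scheme_ideal n ts bs \<gamma>) < H} =
      zeros to_ac ts bs (Z_ideal n ts bs H :: 'k cpol set)"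
    using zeros_border_ideal[OF field_hom_to_ac] zeros_Z_ideal[OF field_hom_to_ac] by blast
  thus ?thesis
    unfolding stratum_def closed_stratum_eq[OF assms]
    using zeros_vanishing_ideal_zeros[OF assms ideal_polyring_subset[OF ideal_Z_ideal]]
      zeros_Z_ideal[OF assms] by (auto simp: order.order_iff_strict)
qed

end

section \<open>Change of the order ideal\<close>

lemma mat_over_mat_delete: "mat_over V A \<Longrightarrow> mat_over V (mat_delete A i j)"
  unfolding mat_over_def by (auto simp: mat_delete_def)

lemma mat_over_adj:
  fixes A :: "('v, 'a::comm_ring_1) mpol mat"
  assumes A: "mat_over V A"
  shows "mat_over V (adj_mat A)"
proof -
  have "indets ((- 1) ^ k :: ('v, 'a) mpol) = {}" for k :: nat
    using indets_power[of "- 1 :: ('v, 'a) mpol" k] by simp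
  hence "indets (cofactor A i j) \<subseteq> V" for i j
    unfolding cofactor_def using mat_over_mat_delete[OF A] by (intro indets_multI indets_det) auto
  thus ?thesis by (auto simp: mat_over_def adj_mat_def)
qed

lemma tdeg_le_mdeg: "t \<in> keys p \<Longrightarrow> tdeg t \<le> mdeg p"
  unfolding mdeg_def by (intro Max_ge) auto

text \<open>
  Clearing denominators: \<open>y None\<close> is the common denominator of the fractions \<open>x v\<close> with numerators
  \<open>y (Some v)\<close>.
\<close>

lemma (in comm_ring_hom) meval_homogenize:
  assumes "\<And>v. v \<in> indets p \<Longrightarrow> y (Some v) = y None * x v"
  shows "meval hom y (homogenize p) = y None ^ mdeg p * meval hom x p"
proof -
  have "mon y (\<Sum>v\<in>keys t. Poly_Mapping.single (Some v) (lookup t v)) * y None ^ (mdeg p - tdeg t) =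
      y None ^ mdeg p * mon x t" if t: "t \<in> keys p" for t
  proof -
    have "mon y (\<Sum>v\<in>keys t. Poly_Mapping.single (Some v) (lookup t v)) =
        (\<Prod>v\<in>keys t. y None ^ lookup t v * x v ^ lookup t v)"
      unfolding mon_sum mon_single
      by (intro prod.cong refl) (use assms t in \<open>force simp: indets_def power_mult_distrib\<close>)
    also have "\<dots> = y None ^ tdeg t * mon x t"
      by (simp add: prod.distrib power_sum tdeg_def mon_def)
    finally have "mon y (\<Sum>v\<in>keys t. Poly_Mapping.single (Some v) (lookup t v)) * y None ^ (mdeg p - tdeg t) =
        y None ^ (tdeg t + (mdeg p - tdeg t)) * mon x t"
      by (simp add: power_add mult_ac)
    thus ?thesis using tdeg_le_mdeg[OF t] by simp
  qed
  thus ?thesis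
    by (simp add: homogenize_def meval_sum mon_add mult.left_commute meval_mon[of _ x] sum_distrib_left)
qed

lemma indets_homogenize: "indets (homogenize p) \<subseteq> insert None (Some ` indets p)"
  unfolding homogenize_def
proof (rule indets_sum)
  fix t assume t: "t \<in> keys p"
  have "keys (\<Sum>v\<in>keys t. Poly_Mapping.single (Some v) (lookup t v)) \<subseteq> Some ` keys t"
    using keys_sum_subset[of "\<lambda>v. Poly_Mapping.single (Some v) (lookup t v)" "keys t"]
    by (auto split: if_splits)
  thus "indets (Poly_Mapping.single
      ((\<Sum>v\<in>keys t. Poly_Mapping.single (Some v) (lookup t v)) + Poly_Mapping.single None (mdeg p - tdeg t))
      (lookup p t)) \<subseteq> insert None (Some ` indets p)"
    using t by (auto simp: indets_def keys_pp_add split: if_splits)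
qed

lemma indets_meval_mconst:
  assumes "\<And>v. v \<in> indets q \<Longrightarrow> indets (y v) \<subseteq> V"
  shows "indets (meval mconst y q) \<subseteq> V"
  unfolding meval_mon mon_def
proof (intro indets_sum indets_multI indets_prod)
  fix t v assume "t \<in> keys q" "v \<in> keys t"
  hence "indets (y v) \<subseteq> V" by (intro assms) (auto simp: indets_def)
  thus "indets (y v ^ lookup t v) \<subseteq> V" by (rule order_trans[OF indets_power])
qed simp

context border_frame
begin

context
  fixes ts' bs' :: "nat pp list"
  assumes len: "length ts' = \<mu>"
begin

lemma change_mat_carrier: "change_mat n ts bs ts' \<in> carrier_mat \<mu> \<mu>"
  unfolding change_mat_def using mat_of_cols_carrier(1)[of \<mu> "map (first_col n ts bs) ts'"] len by simp

lemma indets_change_det: "indets (change_det n ts bs ts' :: 'a::field cpol) \<subseteq> V"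
  unfolding change_det_def change_mat_def by (intro indets_det mat_over_cols)

lemma indets_change_num:
  assumes "\<kappa> < \<mu>"
  shows "indets (change_num n ts bs ts' bs' (\<kappa>, l) :: 'a::field cpol) \<subseteq> V"
proof -
  have adj: "adj_mat (change_mat n ts bs ts' :: 'a cpol mat) \<in> carrier_mat \<mu> \<mu>"
    by (rule adj_mat(1)[OF change_mat_carrier])
  have over: "mat_over V (adj_mat (change_mat n ts bs ts' :: 'a cpol mat))"
    unfolding change_mat_def by (intro mat_over_adj mat_over_cols)
  have "(change_num n ts bs ts' bs' (\<kappa>, l) :: 'a cpol) =
      (\<Sum>j<\<mu>. adj_mat (change_mat n ts bs ts') $$ (\<kappa>, j) * first_col n ts bs (bs' ! l) $ j)"
    unfolding change_num_def split_conv by (rule mult_mat_vec_index[OF adj _ assms]) simp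
  also have "indets \<dots> \<subseteq> V"
    using over adj assms by (intro indets_sum indets_multI indets_first_col) (auto simp: mat_over_def)
  finally show ?thesis .
qed

lemma change_poly_carrier:
  assumes "a \<in> carrier (KC ts' bs')"
  shows "(change_poly n ts bs ts' bs' a :: 'a::field cpol) \<in> carrier (KC ts bs)"
  unfolding change_poly_def carrier_polyring
proof (rule indets_meval_mconst)
  fix v assume "v \<in> indets (homogenize a)"
  then consider "v = None" | w where "w \<in> indets a" "v = Some w"
    using indets_homogenize[of a] by blast
  thus "indets (case_option (change_det n ts bs ts') (change_num n ts bs ts' bs') v :: 'a cpol) \<subseteq> V"
  proof cases
    case 1
    thus ?thesis unfolding 1 option.case by (intro indets_change_det)
  next
    case 2
    obtain \<kappa> l where w: "w = (\<kappa>, l)" by (cases w)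
    have "indets a \<subseteq> {..<length ts'} \<times> {..<length bs'}" using assms by (simp only: carrier_polyring)
    from subsetD[OF this 2(1)] have "\<kappa> < \<mu>" using w len by simp
    thus ?thesis unfolding 2 option.case w by (rule indets_change_num)
  qed
qed

end

end

text \<open>
  Where \<open>change_det\<close> does not vanish, this is the point of the second border basis scheme that
  represents the same scheme as \<open>\<Gamma>\<close>.
\<close>

definition change_point :: "('k::field \<Rightarrow> 'l::field) \<Rightarrow> nat \<Rightarrow> nat pp list \<Rightarrow> nat pp list \<Rightarrow>
    nat pp list \<Rightarrow> nat pp list \<Rightarrow> 'l mat \<Rightarrow> 'l mat" where
  "change_point \<iota> n ts bs ts' bs' \<Gamma> = mat (length ts') (length bs') (\<lambda>v.
     meval \<iota> (($$) \<Gamma>) (change_num n ts bs ts' bs' v) / meval \<iota> (($$) \<Gamma>) (change_det n ts bs ts'))"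

context border_point
begin

context
  fixes \<iota> :: "'k::field \<Rightarrow> 'l" and ts' bs' :: "nat pp list"
  assumes \<iota>: "field_hom \<iota>" and frame': "border_frame n ts' bs'" and len: "length ts' = \<mu>"
begin

interpretation \<iota>: comm_ring_hom \<iota> using \<iota> by (rule field_hom_imp_comm_ring_hom)

interpretation h: comm_ring_hom "meval \<iota> (($$) \<Gamma>)" by (rule \<iota>.meval_comm_ring_hom)

abbreviation "h \<equiv> meval \<iota> (($$) \<Gamma>)"

abbreviation "\<delta> \<equiv> h (change_det n ts bs ts')"

abbreviation "\<Gamma>' \<equiv> change_point \<iota> n ts bs ts' bs' \<Gamma>"

lemma map_change_mat: "map_mat h (change_mat n ts bs ts') = mat_of_cols \<mu> (map phi ts')"
  unfolding change_mat_def by (rule map_cols[OF \<iota> border_point_axioms])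

lemma det_eq: "\<delta> = det (mat_of_cols \<mu> (map phi ts'))"
  unfolding change_det_def map_change_mat[symmetric] by simp

lemma det_nonzero_iff: "\<delta> \<noteq> 0 \<longleftrightarrow> indep_mod I (set ts')"
proof -
  interpret B: border_frame n ts' bs' by (rule frame')
  show ?thesis using indep_mod_iff_det[OF B.ts_terms B.distinct_ts len] by (simp add: det_eq)
qed

text \<open>
  Specialization of the identity \<open>T' * adj T' = det T'\<close>.
\<close>

lemma cramer:
  assumes "\<delta> \<noteq> 0" "l < length bs'"
  shows "mat_of_cols \<mu> (map phi ts') *\<^sub>v col \<Gamma>' l = phi (bs' ! l)"
proof -
  let ?C = "change_mat n ts bs ts' :: 'k cpol mat" and ?f = "first_col n ts bs (bs' ! l) :: 'k cpol vec"
  have C: "?C \<in> carrier_mat \<mu> \<mu>" and adj: "adj_mat ?C \<in> carrier_mat \<mu> \<mu>"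
    using change_mat_carrier[OF len] adj_mat(1)[OF change_mat_carrier[OF len]] by auto
  let ?p = "adj_mat ?C *\<^sub>v ?f"
  have p: "?p \<in> carrier_vec \<mu>" using adj by auto
  have "?C *\<^sub>v ?p = (?C * adj_mat ?C) *\<^sub>v ?f"
    by (rule assoc_mult_mat_vec[symmetric]) (use C adj in auto)
  also have "\<dots> = (det ?C \<cdot>\<^sub>m 1\<^sub>m \<mu>) *\<^sub>v ?f" by (simp only: adj_mat(2)[OF C])
  also have "\<dots> = det ?C \<cdot>\<^sub>v ?f"
  proof (rule eq_vecI)
    have f: "dim_vec ?f = \<mu>" using first_col_carrier carrier_vecD by blast
    fix i assume "i < dim_vec (det ?C \<cdot>\<^sub>v ?f)"
    hence i: "i < \<mu>" using f by simp
    have "((det ?C \<cdot>\<^sub>m 1\<^sub>m \<mu>) *\<^sub>v ?f) $ i = (\<Sum>j<\<mu>. (det ?C \<cdot>\<^sub>m 1\<^sub>m \<mu>) $$ (i, j) * ?f $ j)"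
      by (rule mult_mat_vec_index) (use i in simp_all)
    also have "\<dots> = (\<Sum>j<\<mu>. if j = i then det ?C * ?f $ j else 0)"
      by (intro sum.cong) (use i in auto)
    also have "\<dots> = det ?C * ?f $ i" using i by simp
    also have "\<dots> = (det ?C \<cdot>\<^sub>v ?f) $ i"
      by (rule index_smult_vec(1)[symmetric]) (simp only: f i)
    finally show "((det ?C \<cdot>\<^sub>m 1\<^sub>m \<mu>) *\<^sub>v ?f) $ i = (det ?C \<cdot>\<^sub>v ?f) $ i" .
  qed (simp add: carrier_vecD[OF first_col_carrier])
  finally have "map_vec h (?C *\<^sub>v ?p) = map_vec h (det ?C \<cdot>\<^sub>v ?f)" by simp
  hence "map_mat h ?C *\<^sub>v map_vec h ?p = \<delta> \<cdot>\<^sub>v map_vec h ?f"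
    unfolding h.mult_mat_vec_hom[OF C p] change_det_def
    by (simp add: h.vec_hom_smult)
  hence key: "mat_of_cols \<mu> (map phi ts') *\<^sub>v map_vec h ?p = \<delta> \<cdot>\<^sub>v phi (bs' ! l)"
    by (simp add: map_change_mat map_first_col[OF \<iota> border_point_axioms])
  have T: "mat_of_cols \<mu> (map phi ts') \<in> carrier_mat \<mu> \<mu>"
    using mat_of_cols_carrier(1)[of \<mu> "map phi ts'"] len by simp
  have "col \<Gamma>' l = (1 / \<delta>) \<cdot>\<^sub>v map_vec h ?p"
    using assms(2) len adj by (intro eq_vecI) (auto simp: change_point_def change_num_def)
  hence "mat_of_cols \<mu> (map phi ts') *\<^sub>v col \<Gamma>' l = (1 / \<delta>) \<cdot>\<^sub>v (\<delta> \<cdot>\<^sub>v phi (bs' ! l))"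
    using T p by (simp add: mult_mat_vec[of _ \<mu> \<mu>] key)
  thus ?thesis using assms(1) by (simp add: smult_smult_assoc)
qed

lemma border_point_change_point: "\<delta> \<noteq> 0 \<Longrightarrow> border_point n ts' bs' \<Gamma>'"
  and scheme_ideal_change_point: "\<delta> \<noteq> 0 \<Longrightarrow> scheme_ideal n ts' bs' \<Gamma>' = I"
  using change_of_order_ideal[OF frame' len, of \<Gamma>'] cramer
  by (auto simp: change_point_def[of \<iota>] det_eq)

lemma eval_change_poly:
  assumes "\<delta> \<noteq> 0" "a \<in> carrier (KC ts' bs')"
  shows "h (change_poly n ts bs ts' bs' a) = \<delta> ^ mdeg a * meval \<iota> (($$) \<Gamma>') a"
proof -
  have "h (change_poly n ts bs ts' bs' a) =
      meval \<iota> (\<lambda>v. h (case_option (change_det n ts bs ts') (change_num n ts bs ts' bs') v)) (homogenize a)"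
    unfolding change_poly_def by (rule \<iota>.meval_meval_mconst)
  also have "\<dots> = \<delta> ^ mdeg a * meval \<iota> (($$) \<Gamma>') a"
    by (subst \<iota>.meval_homogenize[where x = "($$) \<Gamma>'"])
      (use assms in \<open>auto simp: change_point_def subset_iff\<close>)
  finally show ?thesis .
qed

end

end

section \<open>The ideal of the points with the given property\<close>

lemma border_frame_numbering:
  "numbering n ts bs \<Longrightarrow> order_ideal n T \<Longrightarrow> border_frame n (ts T) (bs T)"
  unfolding numbering_def border_frame_def by auto

theorem mainTheorem11:
  fixes \<iota> :: "'k::field \<Rightarrow> 'l::field"
    and n :: nat
    and ts bs :: "nat pp set \<Rightarrow> nat pp list"
    and \<O> :: "nat pp set"
    and H :: "nat \<Rightarrow> nat"
    and \<P> :: "(nat, 'l) mpol set \<Rightarrow> bool"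
    and J :: "nat pp set \<Rightarrow> 'k cpol set"
    and gens :: "nat pp set \<Rightarrow> 'k cpol list"
  assumes "field_hom \<iota>"
    and "numbering n ts bs"
    and "order_ideal n \<O>"
    and "admissible TYPE('k) n (card \<O>) H"
    and "ord_HF \<O> \<le> H"
    and "\<And>\<O>'. order_ideal n \<O>' \<Longrightarrow> ord_HF \<O>' = H \<Longrightarrow>
           ideal (J \<O>') (KC (ts \<O>') (bs \<O>')) \<and>
           zeros \<iota> (ts \<O>') (bs \<O>') (df_ideal n (ts \<O>') (bs \<O>'))
             - zeros \<iota> (ts \<O>') (bs \<O>') (J \<O>') =
           {\<Gamma> \<in> zeros \<iota> (ts \<O>') (bs \<O>') (border_ideal n (ts \<O>') (bs \<O>')).
              has_df_border_basis n (ts \<O>') (scheme_ideal n (ts \<O>') (bs \<O>') \<Gamma>) \<and>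
              \<P> (scheme_ideal n (ts \<O>') (bs \<O>') \<Gamma>)}"
    and "\<And>\<O>'. order_ideal n \<O>' \<Longrightarrow> ord_HF \<O>' = H \<Longrightarrow>
           set (gens \<O>') \<subseteq> carrier (KC (ts \<O>') (bs \<O>')) \<and>
           J \<O>' = Idl\<^bsub>KC (ts \<O>') (bs \<O>')\<^esub> (set (gens \<O>'))"
  shows "closed_stratum \<iota> n (ts \<O>) (bs \<O>) H
           - zeros \<iota> (ts \<O>) (bs \<O>)
               (ideal_sum (KC (ts \<O>) (bs \<O>))
                 {summand_ideal n (ts \<O>) (bs \<O>) (ts \<O>') (bs \<O>') H (gens \<O>') | \<O>'.
                    order_ideal n \<O>' \<and> ord_HF \<O>' = H}) =
         {\<Gamma> \<in> stratum \<iota> n (ts \<O>) (bs \<O>) H. \<P> (scheme_ideal n (ts \<O>) (bs \<O>) \<Gamma>)}"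
proof -
  interpret \<iota>: comm_ring_hom \<iota> by (rule field_hom_imp_comm_ring_hom[OF assms(1)])
  let ?t = "ts \<O>" and ?b = "bs \<O>"
  let ?S = "\<lambda>U. summand_ideal n ?t ?b (ts U) (bs U) H (gens U)"
  have frame: "border_frame n (ts U) (bs U)" and len: "length (ts U) = card U" and set_ts: "set (ts U) = U"
    if "order_ideal n U" for U
    using border_frame_numbering[OF assms(2) that] assms(2) that distinct_card[of "ts U"]
    by (auto simp: numbering_def)
  interpret F: border_frame n ?t ?b by (rule frame[OF assms(3)])
  note len_O = len[OF assms(3)]
  obtain T where T: "order_ideal n T" "card T = card \<O>" "ord_HF T = H"
    by (rule admissible_imp_ord_HF[OF assms(4)]) (use F.mu_pos len_O in auto)
  interpret border_frame_HF n ?t ?b H T by unfold_locales (use T len_O in auto)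
  have len': "length (ts U) = length ?t" if U: "order_ideal n U" "ord_HF U = H" for U
  proof -
    have "finite U" using U(1) by (simp add: order_ideal_def)
    then obtain d where d: "\<And>i. d \<le> i \<Longrightarrow> H i = card U" using ord_HF_eventually U(2) by metis
    obtain e where e: "\<And>i. e \<le> i \<Longrightarrow> H i = length ?t" using H_eventually by blast
    have "H (max d e) = card U" by (rule d) simp
    moreover have "H (max d e) = length ?t" by (rule e) simp
    ultimately show ?thesis using len[OF U(1)] by simp
  qed
  have change_carrier: "change_poly n ?t ?b (ts U) (bs U) ` set (gens U) \<subseteq> carrier (KC ?t ?b)"
      and det_carrier: "{change_det n ?t ?b (ts U)} \<subseteq> carrier (KC ?t ?b :: 'k cpol ring)"
    if U: "order_ideal n U" "ord_HF U = H" for U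
  proof -
    show "change_poly n ?t ?b (ts U) (bs U) ` set (gens U) \<subseteq> carrier (KC ?t ?b)"
      using assms(7)[OF U] by (intro image_subsetI F.change_poly_carrier[OF len'[OF U]]) blast
    have "(change_det n ?t ?b (ts U) :: 'k cpol) \<in> carrier (KC ?t ?b)"
      unfolding carrier_polyring by (rule F.indets_change_det[OF len'[OF U]])
    thus "{change_det n ?t ?b (ts U)} \<subseteq> carrier (KC ?t ?b :: 'k cpol ring)" by blast
  qed
  have ideals: "ideal (dfb_ideal n ?t ?b (ts U) H) (KC ?t ?b :: 'k cpol ring)"
      "ideal (dfb_ideal n ?t ?b (ts U) H <+>\<^bsub>KC ?t ?b\<^esub> closed_stratum_ideal n ?t ?b H)
        (KC ?t ?b :: 'k cpol ring)"
      "ideal (Idl\<^bsub>KC ?t ?b\<^esub> (change_poly n ?t ?b (ts U) (bs U) ` set (gens U))) (KC ?t ?b)"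
      "ideal (Idl\<^bsub>KC ?t ?b\<^esub> (change_poly n ?t ?b (ts U) (bs U) ` set (gens U))
        <+>\<^bsub>KC ?t ?b\<^esub> closed_stratum_ideal n ?t ?b H) (KC ?t ?b)"
    if U: "order_ideal n U" "ord_HF U = H" for U
  proof -
    show 1: "ideal (dfb_ideal n ?t ?b (ts U) H) (KC ?t ?b :: 'k cpol ring)"
      unfolding dfb_ideal_def
      by (intro polyring.i_intersect ideal_Z_ideal polyring.genideal_ideal det_carrier[OF U])
    show 3: "ideal (Idl\<^bsub>KC ?t ?b\<^esub> (change_poly n ?t ?b (ts U) (bs U) ` set (gens U))) (KC ?t ?b)"
      by (rule polyring.genideal_ideal[OF change_carrier[OF U]])
    show "ideal (dfb_ideal n ?t ?b (ts U) H <+>\<^bsub>KC ?t ?b\<^esub> closed_stratum_ideal n ?t ?b H)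
        (KC ?t ?b :: 'k cpol ring)"
      by (intro polyring.add_ideals 1 F.ideal_closed_stratum_ideal)
    show "ideal (Idl\<^bsub>KC ?t ?b\<^esub> (change_poly n ?t ?b (ts U) (bs U) ` set (gens U))
        <+>\<^bsub>KC ?t ?b\<^esub> closed_stratum_ideal n ?t ?b H) (KC ?t ?b)"
      by (intro polyring.add_ideals 3 F.ideal_closed_stratum_ideal)
  qed
  have S_carrier: "?S U \<subseteq> carrier (KC ?t ?b)" if U: "order_ideal n U" "ord_HF U = H" for U
    unfolding summand_ideal_def using ideal_polyring_subset[OF ideals(2)[OF U]] by blast
  \<comment> \<open>The ideal of the closed stratum vanishes at these points, so adding it changes nothing.\<close>
  have S_zeros: "\<Gamma> \<in> zeros \<iota> ?t ?b (?S U) \<longleftrightarrow>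
      aff_HF n (scheme_ideal n ?t ?b \<Gamma>) < H \<or> meval \<iota> (($$) \<Gamma>) (change_det n ?t ?b (ts U)) = 0 \<or>
      (\<forall>a\<in>set (gens U). meval \<iota> (($$) \<Gamma>) (change_poly n ?t ?b (ts U) (bs U) a) = 0)"
    if U: "order_ideal n U" "ord_HF U = H" and
      point: "border_point n ?t ?b \<Gamma>" "aff_HF n (scheme_ideal n ?t ?b \<Gamma>) \<le> H" for U \<Gamma>
  proof -
    have \<Gamma>: "\<Gamma> \<in> carrier_mat (length ?t) (length ?b)" by (rule border_point.\<Gamma>[OF point(1)])
    have cs: "\<Gamma> \<in> zeros \<iota> ?t ?b (closed_stratum_ideal n ?t ?b H)"
      using point zeros_closed_stratum_ideal_H[OF assms(1)] by blast
    have "\<Gamma> \<in> zeros \<iota> ?t ?b (?S U) \<longleftrightarrow> \<Gamma> \<in> zeros \<iota> ?t ?b (dfb_ideal n ?t ?b (ts U) H) \<or>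
        \<Gamma> \<in> zeros \<iota> ?t ?b (Idl\<^bsub>KC ?t ?b\<^esub> (change_poly n ?t ?b (ts U) (bs U) ` set (gens U)))"
      unfolding summand_ideal_def zeros_Int[OF assms(1) ideals(2,4)[OF U]]
        zeros_set_add[OF assms(1) ideals(1)[OF U] F.ideal_closed_stratum_ideal]
        zeros_set_add[OF assms(1) ideals(3)[OF U] F.ideal_closed_stratum_ideal]
      using cs by blast
    also have "\<Gamma> \<in> zeros \<iota> ?t ?b (dfb_ideal n ?t ?b (ts U) H) \<longleftrightarrow>
        aff_HF n (scheme_ideal n ?t ?b \<Gamma>) < H \<or> meval \<iota> (($$) \<Gamma>) (change_det n ?t ?b (ts U)) = 0"
      unfolding dfb_ideal_def
        zeros_Int[OF assms(1) ideal_Z_ideal polyring.genideal_ideal[OF det_carrier[OF U]]]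
        zeros_genideal[OF assms(1) det_carrier[OF U]]
      using point(1) \<Gamma> by (auto simp: zeros_Z_ideal[OF assms(1)] zeros_def[of _ _ _ "{_}"])
    also have "\<Gamma> \<in> zeros \<iota> ?t ?b (Idl\<^bsub>KC ?t ?b\<^esub> (change_poly n ?t ?b (ts U) (bs U) ` set (gens U))) \<longleftrightarrow>
        (\<forall>a\<in>set (gens U). meval \<iota> (($$) \<Gamma>) (change_poly n ?t ?b (ts U) (bs U) a) = 0)"
      unfolding zeros_genideal[OF assms(1) change_carrier[OF U]] using \<Gamma> by (simp add: zeros_def)
    finally show ?thesis by blast
  qed
  \<comment> \<open>The transported point has a degree filtered basis, so there the given ideal decides the property.\<close>
  have transport: "(\<exists>a\<in>set (gens U). meval \<iota> (($$) \<Gamma>) (change_poly n ?t ?b (ts U) (bs U) a) \<noteq> 0) \<longleftrightarrow>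
      \<P> (scheme_ideal n ?t ?b \<Gamma>)"
    if U: "order_ideal n U" "ord_HF U = H" and
      point: "border_point n ?t ?b \<Gamma>" "aff_HF n (scheme_ideal n ?t ?b \<Gamma>) = H" and
      det: "meval \<iota> (($$) \<Gamma>) (change_det n ?t ?b (ts U)) \<noteq> 0" for U \<Gamma>
  proof -
    interpret P: border_point n ?t ?b \<Gamma> by (rule point(1))
    let ?t' = "ts U" and ?b' = "bs U"
    define \<Delta> where "\<Delta> = change_point \<iota> n ?t ?b ?t' ?b' \<Gamma>"
    note setting = assms(1) frame[OF U(1)] len'[OF U]
    have point': "border_point n ?t' ?b' \<Delta>" and same: "scheme_ideal n ?t' ?b' \<Delta> = scheme_ideal n ?t ?b \<Gamma>"
      unfolding \<Delta>_def
      by (rule P.border_point_change_point[OF setting det] P.scheme_ideal_change_point[OF setting det])+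
    interpret P': border_point n ?t' ?b' \<Delta> by (rule point')
    have indep: "indep_mod (scheme_ideal n ?t ?b \<Gamma>) (set ?t')"
      using P.det_nonzero_iff[OF setting] det by blast
    have df: "has_df_border_basis n ?t' (scheme_ideal n ?t' ?b' \<Delta>)"
      unfolding same
      by (rule P.df_border_basisI[OF P'.ts_terms P'.distinct_ts indep])
        (use U set_ts point(2) in simp)
    have border': "\<Delta> \<in> zeros \<iota> ?t' ?b' (border_ideal n ?t' ?b')"
      using P'.zeros_border_ideal[OF assms(1)] point' by blast
    let ?D = "{mvar (i, j) | i j. i < length ?t' \<and> j < length ?b' \<and> tdeg (?t' ! i) > tdeg (?b' ! j)} :: 'k cpol set"
    have D: "?D \<subseteq> carrier (KC ?t' ?b')" by (auto simp: indets_mvar)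
    have "\<Delta> \<in> zeros \<iota> ?t' ?b' ?D"
      using P'.df_border_basis_coeff[OF df] P'.\<Gamma> by (auto simp: zeros_def \<iota>.meval_mvar)
    hence "\<Delta> \<in> zeros \<iota> ?t' ?b' (df_ideal n ?t' ?b')"
      unfolding df_ideal_def
        zeros_set_add[OF assms(1) P'.ideal_border_ideal polyring.genideal_ideal[OF D]]
        zeros_genideal[OF assms(1) D]
      using border' by blast
    hence "\<Delta> \<notin> zeros \<iota> ?t' ?b' (J U) \<longleftrightarrow> \<P> (scheme_ideal n ?t' ?b' \<Delta>)"
      using assms(6)[OF U] border' df by blast
    moreover have "\<Delta> \<in> zeros \<iota> ?t' ?b' (J U) \<longleftrightarrow> (\<forall>a\<in>set (gens U). meval \<iota> (($$) \<Delta>) a = 0)"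
    proof -
      have gens: "set (gens U) \<subseteq> carrier (KC ?t' ?b')" "J U = Idl\<^bsub>KC ?t' ?b'\<^esub> (set (gens U))"
        using assms(7)[OF U] by auto
      show ?thesis
        unfolding gens(2) zeros_genideal[OF assms(1) gens(1)] using P'.\<Gamma> by (simp add: zeros_def)
    qed
    moreover have "meval \<iota> (($$) \<Gamma>) (change_poly n ?t ?b ?t' ?b' a) = 0 \<longleftrightarrow> meval \<iota> (($$) \<Delta>) a = 0"
      if "a \<in> set (gens U)" for a
      using P.eval_change_poly[OF setting det, of a] assms(7)[OF U] that det by (auto simp: \<Delta>_def)
    ultimately show ?thesis unfolding same by blast
  qed
  let ?N = "{?S U | U. order_ideal n U \<and> ord_HF U = H}"
  have N_carrier: "N \<subseteq> carrier (KC ?t ?b)" if "N \<in> ?N" for N using that S_carrier by blast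
  have zeros_N: "zeros \<iota> ?t ?b (ideal_sum (KC ?t ?b) ?N) =
      {\<Gamma> \<in> carrier_mat (length ?t) (length ?b). \<forall>N\<in>?N. \<Gamma> \<in> zeros \<iota> ?t ?b N}"
    by (rule zeros_ideal_sum[OF assms(1)]) (rule N_carrier)
  have main: "\<Gamma> \<notin> zeros \<iota> ?t ?b (ideal_sum (KC ?t ?b) ?N) \<longleftrightarrow>
      aff_HF n (scheme_ideal n ?t ?b \<Gamma>) = H \<and> \<P> (scheme_ideal n ?t ?b \<Gamma>)"
    if point: "border_point n ?t ?b \<Gamma>" "aff_HF n (scheme_ideal n ?t ?b \<Gamma>) \<le> H" for \<Gamma>
  proof -
    interpret P: border_point n ?t ?b \<Gamma> by (rule point(1))
    have "\<Gamma> \<notin> zeros \<iota> ?t ?b (ideal_sum (KC ?t ?b) ?N) \<longleftrightarrow>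
        (\<exists>U. order_ideal n U \<and> ord_HF U = H \<and> \<Gamma> \<notin> zeros \<iota> ?t ?b (?S U))"
      unfolding zeros_N using P.\<Gamma> by blast
    also have "\<dots> \<longleftrightarrow> (\<exists>U. order_ideal n U \<and> ord_HF U = H \<and> aff_HF n (scheme_ideal n ?t ?b \<Gamma>) = H \<and>
        meval \<iota> (($$) \<Gamma>) (change_det n ?t ?b (ts U)) \<noteq> 0 \<and> \<P> (scheme_ideal n ?t ?b \<Gamma>))"
      using S_zeros[OF _ _ point] transport[OF _ _ point(1)] point(2)
      by (metis (no_types, lifting) order.order_iff_strict order_less_irrefl)
    also have "\<dots> \<longleftrightarrow> aff_HF n (scheme_ideal n ?t ?b \<Gamma>) = H \<and> \<P> (scheme_ideal n ?t ?b \<Gamma>)"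
    proof (intro iffI)
      assume *: "aff_HF n (scheme_ideal n ?t ?b \<Gamma>) = H \<and> \<P> (scheme_ideal n ?t ?b \<Gamma>)"
      obtain U where U: "order_ideal n U" "ord_HF U = H" "indep_mod (scheme_ideal n ?t ?b \<Gamma>) U"
        using P.aff_HF_eq_ord_HF * by metis
      have "meval \<iota> (($$) \<Gamma>) (change_det n ?t ?b (ts U)) \<noteq> 0"
        using P.det_nonzero_iff[OF assms(1) frame[OF U(1)] len'[OF U(1,2)]] U(3) set_ts[OF U(1)] by simp
      thus "\<exists>U. order_ideal n U \<and> ord_HF U = H \<and> aff_HF n (scheme_ideal n ?t ?b \<Gamma>) = H \<and>
          meval \<iota> (($$) \<Gamma>) (change_det n ?t ?b (ts U)) \<noteq> 0 \<and> \<P> (scheme_ideal n ?t ?b \<Gamma>)"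
        using U * by blast
    qed blast
    finally show ?thesis .
  qed
  show ?thesis
    unfolding closed_stratum_eq[OF assms(1)] stratum_eq[OF assms(1)] using main by auto
qed

end
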